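(* Let $m\ge2$, $n\ge1$ be integers. For any lattice point $(i,j)\in\mathbb Z^2$ with $0\le j\le m$ and any integer $\ell_0$, the sequence $f:\mathbb N\to\mathbb Z[\mathbf x^{\pm1}]$ given by $f(\ell)=Z_m(i+\ell n,j,\ell n+\ell_0)$ satisfies, for all but finitely many $\ell$, a linear recurrence with characteristic polynomial $Q^{(e_{m-j})}_{N_{n,m}}(t)$.
   Context: Let $\mathcal S_m=\{(x,y)\in\mathbb R^2:0\le y\le m\}$. To each lattice point $(i,j)\in\mathbb Z^2$ with $0\le j\le m$ assign a weight $w_{i,j}$ with $w_{i+2n,j}=w_{i,j}$, $w_{i,0}=w_{i,m}=1$, and $w_{i,j}=x_{ij}$ (independent indeterminates, forming the set $\mathbf x$ of $2n(m-1)$ variables) for $0\le i<2n$, $0<j<m$. A unit square with center $(i+1/2,j+1/2)$ ($i,j\in\mathbb Z$) is white if $i+j$ is even, black if odd. The Aztec diamond $\mathcal A(i,j,\ell)$ is the union of all unit lattice squares fully contained in $\{|x-i|+|y-j|\le\ell+1\}$, and $\mathcal A_m(i,j,\ell)=\mathcal A(i,j,\ell)\cap\mathcal S_m$. A domino tiling of a region is a covering by $2\times1$ or $1\times2$ rectangles with lattice-point corners and pairwise disjoint interiors. For a domino tiling $T$ of $\mathcal A_m(i,j,\ell)$, $\mathrm{wt}(T)=\prod w_{i',j'}^{\epsilon}$ over the lattice points $(i',j')$ in the interior of $\mathcal A_m(i,j,\ell)$, where $\epsilon=+1,0,-1$ according as $(i',j')$ belongs to $4$, $3$ or $2$ dominoes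 of $T$. $Z_m(i,j,\ell)$ is the sum of $\mathrm{wt}(T)$ over all domino tilings $T$ of $\mathcal A_m(i,j,\ell)$. The network $\tilde N_{n,m}$ has as vertices the centers of black unit squares contained in $\mathcal S_m$, and an edge from $(i'+1/2,j'+1/2)$ to $(i+1/2,j+1/2)$ exactly when $(i,j)=(i'+1,j'+1)$, $(i'+2,j')$ or $(i'+1,j'-1)$, with weights $w_{i+1,j+1}/w_{i,j}$, $w_{i+1,j+1}w_{i+1,j}/(w_{i,j}w_{i,j+1})$, $w_{i+1,j}/w_{i,j+1}$ respectively; it is invariant under the shift $\tilde g=(2n,0)$. Its projection $N_{n,m}$ is the quotient by $\mathbb Z\tilde g$. A simple cycle of $N_{n,m}$ is a directed cycle visiting each vertex at most once, weight = product of edge weights, winding number = the $\ell$ such that a lift goes from $\tilde w$ to $\tilde w+\ell\tilde g$. An $r$-cycle is a collection (counted once) of $r$ pairwise vertex-disjoint simple cycles, weight the product, winding the sum; $\mathcal C^r$ is their set ($\mathcal C^0$ = empty collection, weight 1, winding 0). With $d$ the maximal winding number of an $r$-cycle, $Q_{N_{n,m}}(t)=\sum_{r\ge0}(-1)^{d-r}\sum_{\mathbf C\in\mathcal C^r}t^{d-\mathrm{wind}(\mathbf C)}\mathrm{wt}(\mathbf C)=\prod_{k=1}^d(t-\gamma_k)$ over an algebraic closure of $\mathbb Q(\mathbf x)$, and $Q^{(e_r)}_{N_{n,m}}(t)=\prod_{1\le k_1<\dots<k_r\le d}(t-\gamma_{k_1}\cdots\gamma_{k_r})$. A sequence satisfies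 a linear recurrence with characteristic polynomial $t^D-\alpha_1t^{D-1}+\dots+(-1)^D\alpha_D$ if $f(k+D)-\alpha_1f(k+D-1)+\dots+(-1)^D\alpha_Df(k)=0$.
   Formalization: The claim as stated fails when i+j+ℓ₀ is odd (e.g. m=3, n=1, j=1); the formal theorem proves it with e_{m-j} when i+j+ℓ₀ is even and with e_j in place of e_{m-j} when i+j+ℓ₀ is odd. *)

theory Defs
  imports
    "HOL-Analysis.Analysis"
    "HOL-Library.Poly_Mapping"
    "HOL-Library.Nat_Bijection"
    "HOL-Computational_Algebra.Fraction_Field"
    "HOL-Algebra.Algebraic_Closure_Type"
begin

text \<open>
  Laurent polynomials with integer coefficients form the group algebra over the integers of the
  additive group of finitely supported exponent vectors. There is one indeterminate for every
  natural number; the indeterminate \<open>x\<^sub>i\<^sub>j\<close> is the one numbered \<open>prod_encode (i, j)\<close>, and the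
  remaining ones are never used.
\<close>

type_synonym laurent = "(nat \<Rightarrow>\<^sub>0 int) \<Rightarrow>\<^sub>0 int"

text \<open>The field of rational functions is the fraction field of the ring of Laurent polynomials.\<close>

type_synonym ratfun_closure = "laurent fract alg_closure"

definition emb :: "laurent \<Rightarrow> ratfun_closure" where
  "emb a = to_ac (Fraction_Field.Fract a 1)"

text \<open>\<open>w_pow n m i j e\<close> is the integer power \<open>w\<^sub>i\<^sub>j\<^sup>e\<close> of the vertex weight, with
  \<open>w\<^sub>i\<^sub>j = 1\<close> on the boundary of the strip.\<close>

definition w_pow :: "int \<Rightarrow> int \<Rightarrow> int \<Rightarrow> int \<Rightarrow> int \<Rightarrow> laurent" where
  "w_pow n m i j e =
     (if 0 < j \<and> j < m
      then Poly_Mapping.single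
             (Poly_Mapping.single (prod_encode (nat (i mod (2 * n)), nat j)) e) 1
      else 1)"

lemma w_pow_add: "w_pow n m i j a * w_pow n m i j b = w_pow n m i j (a + b)"
  by (simp add: w_pow_def Poly_Mapping.mult_single Poly_Mapping.single_add)

lemma w_pow_0: "w_pow n m i j 0 = 1"
  by (simp add: w_pow_def)

abbreviation w :: "int \<Rightarrow> int \<Rightarrow> int \<Rightarrow> int \<Rightarrow> laurent" where
  "w n m i j \<equiv> w_pow n m i j 1"

abbreviation w_inv :: "int \<Rightarrow> int \<Rightarrow> int \<Rightarrow> int \<Rightarrow> laurent" where
  "w_inv n m i j \<equiv> w_pow n m i j (- 1)"


section \<open>Aztec diamonds in a strip and their domino tilings\<close>

definition strip :: "int \<Rightarrow> (real \<times> real) set" where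
  "strip m = {(x, y). 0 \<le> y \<and> y \<le> of_int m}"

definition rect :: "int \<Rightarrow> int \<Rightarrow> int \<Rightarrow> int \<Rightarrow> (real \<times> real) set" where
  "rect a b a' b' = {of_int a .. of_int a'} \<times> {of_int b .. of_int b'}"

abbreviation unit_square :: "int \<Rightarrow> int \<Rightarrow> (real \<times> real) set" where
  "unit_square a b \<equiv> rect a b (a + 1) (b + 1)"

definition aztec :: "int \<Rightarrow> int \<Rightarrow> int \<Rightarrow> (real \<times> real) set" where
  "aztec i j l =
     \<Union> {unit_square a b | a b.
          unit_square a b \<subseteq> {(x, y). \<bar>x - of_int i\<bar> + \<bar>y - of_int j\<bar> \<le> of_int l + 1}}"

definition aztec_strip :: "int \<Rightarrow> int \<Rightarrow> int \<Rightarrow> int \<Rightarrow> (real \<times> real) set" where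
  "aztec_strip m i j l = aztec i j l \<inter> strip m"

definition dominoes :: "(real \<times> real) set set" where
  "dominoes = {rect a b (a + 2) (b + 1) | a b. True} \<union> {rect a b (a + 1) (b + 2) | a b. True}"

definition domino_tiling :: "(real \<times> real) set \<Rightarrow> (real \<times> real) set set \<Rightarrow> bool" where
  "domino_tiling R T \<longleftrightarrow>
     T \<subseteq> dominoes \<and> \<Union> T = R \<and> pairwise (\<lambda>D E. interior D \<inter> interior E = {}) T"

text \<open>An interior lattice point lies in 4, 3 or 2 dominoes, and the exponent is then
  1, 0 or -1, that is, the number of dominoes minus 3.\<close>

definition tiling_wt ::
    "int \<Rightarrow> int \<Rightarrow> (real \<times> real) set \<Rightarrow> (real \<times> real) set set \<Rightarrow> laurent" where
  "tiling_wt n m R T =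
     (\<Prod>(a, b) \<in> {(a, b). (of_int a, of_int b) \<in> interior R}.
        w_pow n m a b (int (card {D \<in> T. (of_int a, of_int b) \<in> D}) - 3))"

definition Z :: "int \<Rightarrow> int \<Rightarrow> int \<Rightarrow> int \<Rightarrow> int \<Rightarrow> laurent" where
  "Z n m i j l =
     (\<Sum>T \<in> {T. domino_tiling (aztec_strip m i j l) T}. tiling_wt n m (aztec_strip m i j l) T)"


section \<open>The network on the infinite strip\<close>

text \<open>The vertex \<open>(i, j)\<close> stands for the square with centre \<open>(i + 1/2, j + 1/2)\<close>.\<close>

type_synonym vertex = "int \<times> int"
type_synonym edge = "vertex \<times> vertex"

definition cover_verts :: "int \<Rightarrow> vertex set" where
  "cover_verts m = {(i, j). odd (i + j) \<and> unit_square i j \<subseteq> strip m}"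

definition cover_edges :: "int \<Rightarrow> edge set" where
  "cover_edges m =
     {((i', j'), (i, j)) | i' j' i j.
        (i', j') \<in> cover_verts m \<and> (i, j) \<in> cover_verts m \<and>
        (i, j) \<in> {(i' + 1, j' + 1), (i' + 2, j'), (i' + 1, j' - 1)}}"

text \<open>In the edge weights, \<open>(i, j)\<close> is the endpoint of the edge, not its starting point.\<close>

definition edge_wt :: "int \<Rightarrow> int \<Rightarrow> edge \<Rightarrow> laurent" where
  "edge_wt n m = (\<lambda>((i', j'), (i, j)).
     if (i, j) = (i' + 1, j' + 1) then w n m (i + 1) (j + 1) * w_inv n m i j
     else if (i, j) = (i' + 2, j') then
       w n m (i + 1) (j + 1) * w n m (i + 1) j * (w_inv n m i j * w_inv n m i (j + 1))
     else w n m (i + 1) j * w_inv n m i (j + 1))"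

definition shift :: "int \<Rightarrow> int \<Rightarrow> vertex \<Rightarrow> vertex" where
  "shift n k = (\<lambda>(i, j). (i + 2 * n * k, j))"


section \<open>The projected network on the cylinder\<close>

text \<open>
  A vertex of the quotient is represented by its unique lift \<open>(i, j)\<close> with \<open>0 \<le> i < 2 * n\<close>,
  and an edge by its unique lift starting at such a vertex. The starting point of the edge \<open>e\<close>
  of the quotient is thus \<open>fst e\<close>, its endpoint is \<open>vert_proj n (snd e)\<close>, and its weight is
  \<open>edge_wt n m e\<close>.
\<close>

definition vert_proj :: "int \<Rightarrow> vertex \<Rightarrow> vertex" where
  "vert_proj n = (\<lambda>(i, j). (i mod (2 * n), j))"

definition edge_proj :: "int \<Rightarrow> edge \<Rightarrow> edge" where
  "edge_proj n = (\<lambda>(u, v).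
     let k = fst u div (2 * n) in (shift n (- k) u, shift n (- k) v))"

definition net_edges :: "int \<Rightarrow> int \<Rightarrow> edge set" where
  "net_edges n m = edge_proj n ` cover_edges m"

definition is_cycle :: "int \<Rightarrow> int \<Rightarrow> edge list \<Rightarrow> bool" where
  "is_cycle n m es \<longleftrightarrow>
     es \<noteq> [] \<and> set es \<subseteq> net_edges n m \<and> distinct (map fst es) \<and>
     (\<forall>k < length es. vert_proj n (snd (es ! k)) = fst (es ! (Suc k mod length es)))"

text \<open>Taking the set of edges identifies cycles that differ only in the starting vertex.\<close>

definition simple_cycles :: "int \<Rightarrow> int \<Rightarrow> edge set set" where
  "simple_cycles n m = set ` {es. is_cycle n m es}"

definition cycle_verts :: "edge set \<Rightarrow> vertex set" where
  "cycle_verts C = fst ` C"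

definition cycle_wt :: "int \<Rightarrow> int \<Rightarrow> edge set \<Rightarrow> laurent" where
  "cycle_wt n m C = (\<Prod>e\<in>C. edge_wt n m e)"

definition is_lift :: "int \<Rightarrow> int \<Rightarrow> vertex list \<Rightarrow> edge list \<Rightarrow> bool" where
  "is_lift n m p es \<longleftrightarrow>
     length p = Suc (length es) \<and>
     (\<forall>k < length es. (p ! k, p ! Suc k) \<in> cover_edges m \<and>
                      edge_proj n (p ! k, p ! Suc k) = es ! k)"

definition wind :: "int \<Rightarrow> int \<Rightarrow> edge set \<Rightarrow> int" where
  "wind n m C =
     (THE l. \<exists>es p. is_cycle n m es \<and> set es = C \<and> is_lift n m p es \<and>
                    last p = shift n l (hd p))"

definition r_cycles :: "int \<Rightarrow> int \<Rightarrow> nat \<Rightarrow> edge set set set" where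
  "r_cycles n m r =
     {S. S \<subseteq> simple_cycles n m \<and> finite S \<and> card S = r \<and>
         pairwise (\<lambda>C D. cycle_verts C \<inter> cycle_verts D = {}) S}"

definition r_cycle_wt :: "int \<Rightarrow> int \<Rightarrow> edge set set \<Rightarrow> laurent" where
  "r_cycle_wt n m S = (\<Prod>C\<in>S. cycle_wt n m C)"

definition r_cycle_wind :: "int \<Rightarrow> int \<Rightarrow> edge set set \<Rightarrow> int" where
  "r_cycle_wind n m S = (\<Sum>C\<in>S. wind n m C)"

definition max_wind :: "int \<Rightarrow> int \<Rightarrow> int" where
  "max_wind n m = Max (\<Union>r. r_cycle_wind n m ` r_cycles n m r)"


section \<open>The characteristic polynomials\<close>

text \<open>
  Only finitely many \<open>r\<close> have an \<open>r\<close>-cycle. Every simple cycle winds at least once around the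
  cylinder, hence \<open>r \<le> max_wind n m\<close> for those \<open>r\<close> and the subtraction in the exponent of the
  sign does not truncate.
\<close>

definition Q_net :: "int \<Rightarrow> int \<Rightarrow> laurent poly" where
  "Q_net n m =
     (\<Sum>r \<in> {r. r_cycles n m r \<noteq> {}}.
        (- 1) ^ (nat (max_wind n m) - r) *
        (\<Sum>S \<in> r_cycles n m r.
           Polynomial.monom (r_cycle_wt n m S) (nat (max_wind n m - r_cycle_wind n m S))))"

text \<open>The roots \<open>\<gamma>\<close>, with multiplicity, in an arbitrary order; they do not depend on the leading
  coefficient of the polynomial, which is \<open>1\<close> or \<open>- 1\<close> for the one above.\<close>

definition root_list :: "'a :: alg_closed_field poly \<Rightarrow> 'a list" where
  "root_list P = (SOME gs. mset gs = proots P)"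

definition elem_sym_poly :: "nat \<Rightarrow> 'a :: alg_closed_field poly \<Rightarrow> 'a poly" where
  "elem_sym_poly r P =
     (\<Prod>K \<in> {K. K \<subseteq> {..<length (root_list P)} \<and> card K = r}.
        [:- (\<Prod>k\<in>K. root_list P ! k), 1:])"

text \<open>
  The colour of the leftmost squares of a diamond \<open>\<A>(i, j, l)\<close> depends on the parity of
  \<open>i + j + l\<close>, while the network always uses the squares with \<open>i + j\<close> odd. A tiling therefore
  corresponds to \<open>m - j\<close> disjoint paths across the diamond if \<open>i + j + l\<close> is even, and to \<open>j\<close>
  such paths if it is odd; accordingly the products in the recurrence for the partition
  functions have \<open>m - j\<close> or \<open>j\<close> factors.
\<close>

definition Q_net_e :: "int \<Rightarrow> int \<Rightarrow> nat \<Rightarrow> ratfun_closure poly" where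
  "Q_net_e n m r = elem_sym_poly r (map_poly emb (Q_net n m))"

text \<open>The recurrence with (monic) characteristic polynomial \<open>P\<close>, at the single index \<open>k\<close>.\<close>

definition recurrence_at :: "'a :: comm_ring_1 poly \<Rightarrow> (nat \<Rightarrow> 'a) \<Rightarrow> nat \<Rightarrow> bool" where
  "recurrence_at P f k \<longleftrightarrow> (\<Sum>s\<le>Polynomial.degree P. Polynomial.coeff P s * f (k + s)) = 0"

end

theory Submission
  imports Defs "Jordan_Normal_Form.Determinant" "Jordan_Normal_Form.Char_Poly"
begin

text \<open>
  Cut a tiling by the vertical lines through the columns. Its dominoes crossing a line determine a
  set of cells of the column, of constant size \<open>r\<close>, and these sets trace \<open>r\<close> noncrossing lattice
  paths. One column is described by a matrix that is sparse enough for nonzero entries never to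
  cross, so each of its minors is a single product; by Cauchy--Binet, \<open>Z\<close> is then a minor of a
  product of column matrices (Lindstroem--Gessel--Viennot). Away from the two ends of the Aztec
  diamond, the columns are periodic, so \<open>Z\<close> is a linear combination, with coefficients from the
  ends, of the \<open>r\<close>-minors of \<open>T\<^sup>k\<close>, where \<open>T\<close> is the product of the \<open>2n\<close> column matrices of one turn
  around the cylinder. The same argument for the network shows that the principal minors of \<open>T\<close>
  enumerate the vertex-disjoint collections of closed paths: all simple cycles wind once, and
  \<open>Q_net\<close> is the characteristic polynomial of \<open>T\<close> up to sign. Bringing \<open>T\<close> into triangular form, its
  \<open>r\<close>-th compound becomes triangular with the products of \<open>r\<close> eigenvalues on the diagonal, and the
  powers of a triangular matrix satisfy the recurrence given by its diagonal. The parity of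
  \<open>i + j + l0\<close> decides whether \<open>r\<close> is \<open>m - j\<close> or \<open>j\<close>.
\<close>

section \<open>Minors and the Cauchy--Binet formula\<close>

text \<open>The centre moves by \<open>n\<close> while the radius grows by \<open>n\<close>. So the
  left end of the diamond stays at \<open>i - l0\<close>, the right end moves by
  \<open>2 * n\<close>, and increasing \<open>l\<close> by one inserts one factor \<open>T\<close>
  between two fixed end pieces. The finitely many exceptional \<open>l\<close> are those whose
  diamond may be too short to be split in this way; the recurrence for minors of powers of
  \<open>T\<close> holds at every index.

  The obstacle is the shape of the diamond: its rows have different lengths, its boundary points
  carry no weight, and near the ends some vertical dominoes do not fit. Column matrices therefore
  take arbitrary weights \<open>u\<close>, \<open>v\<close> and a predicate \<open>E\<close> of
  admissible vertical dominoes, and rows are prolonged by forced dominoes so that every column has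
  the same index set \<open>{0..<m}\<close>.

  The number of paths comes from a colouring argument: the leftmost cells of the rows from
  \<open>j\<close> upwards and of the rows below \<open>j\<close> have opposite colours, so the
  initial state is \<open>{j..<m}\<close> or \<open>{0..<j}\<close>. A simple cycle winds once
  because its lift cannot cross the translate of that lift by one turn.\<close>

definition nth_elem :: "'i::linorder set \<Rightarrow> nat \<Rightarrow> 'i" where
  "nth_elem S k = sorted_list_of_set S ! k"

lemma nth_elem_bij: "finite S \<Longrightarrow> bij_betw (nth_elem S) {..<card S} S"
  unfolding nth_elem_def
  using bij_betw_nth[of "sorted_list_of_set S" "{..<card S}" S] by simp

lemma nth_elem_in: "finite S \<Longrightarrow> k < card S \<Longrightarrow> nth_elem S k \<in> S"
  using nth_elem_bij[of S] by (auto simp: bij_betw_def)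

lemma nth_elem_less_iff:
  assumes "finite S" "k < card S" "l < card S"
  shows "nth_elem S k < nth_elem S l \<longleftrightarrow> k < l"
proof -
  have *: "sorted_wrt (<) (sorted_list_of_set S)"
    by (rule strict_sorted_list_of_set)
  have "nth_elem S k < nth_elem S l" if "k < l" "l < card S" for k l
    using sorted_wrt_nth_less[OF * that(1)] that assms(1) by (simp add: nth_elem_def)
  from this[of k l] this[of l k] assms show ?thesis
    by (metis less_irrefl less_trans linorder_neqE)
qed

lemma nth_elem_le_iff:
  assumes "finite S" "k < card S" "l < card S"
  shows "nth_elem S k \<le> nth_elem S l \<longleftrightarrow> k \<le> l"
  using nth_elem_less_iff[of S l k] assms by (auto simp: not_less[symmetric])

lemma nth_elem_eq_iff:
  assumes "finite S" "k < card S" "l < card S"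
  shows "nth_elem S k = nth_elem S l \<longleftrightarrow> k = l"
  using nth_elem_le_iff[of S] assms by (metis order_antisym order_refl)

text \<open>Increasing bijections match elements by rank. This reduces noncrossing families to the
  diagonal term of a minor.\<close>

lemma strict_mono_on_nth_elem:
  assumes "finite S" and f: "bij_betw f S S'" and mono: "strict_mono_on S f" and k: "k < card S"
  shows "f (nth_elem S k) = nth_elem S' k"
proof -
  have "map f (sorted_list_of_set S) = sorted_list_of_set S'"
  proof (rule strict_sorted_equal)
    show "sorted_wrt (<) (map f (sorted_list_of_set S))"
      unfolding sorted_wrt_map
      by (rule sorted_wrt_mono_rel[OF _ strict_sorted_list_of_set])
        (use assms in \<open>auto dest: strict_mono_onD\<close>)
    show "sorted_wrt (<) (sorted_list_of_set S')"
      by (rule strict_sorted_list_of_set)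
    have "finite S'" using f assms(1) bij_betw_finite by blast
    then show "set (map f (sorted_list_of_set S)) = set (sorted_list_of_set S')"
      using f assms(1) by (simp add: bij_betw_def)
  qed
  then show ?thesis
    unfolding nth_elem_def using k assms(1) by (metis length_sorted_list_of_set nth_map)
qed

lemma det_mat_eq_sum:
  "Determinant.det (Matrix.mat r r (\<lambda>(k, l). f k l)) =
     (\<Sum>p | p permutes {..<r}. signof p * (\<Prod>k<r. f k (p k)))"
proof -
  have "p k < r" if "p permutes {..<r}" "k < r" for p k
    using permutes_in_image[OF that(1), of k] that(2) by simp
  then show ?thesis
    by (subst det_def'[of _ r]) (auto simp: atLeast0LessThan intro!: sum.cong prod.cong)
qed

text \<open>Index sets are listed increasingly, which fixes the sign. The size is read off from the
  first set; this is the usual minor when the second set is equally large.\<close>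

definition minor :: "('i::linorder \<Rightarrow> 'j::linorder \<Rightarrow> 'a::comm_ring_1) \<Rightarrow> 'i set \<Rightarrow> 'j set \<Rightarrow> 'a" where
  "minor A S S' = Determinant.det (Matrix.mat (card S) (card S)
     (\<lambda>(k, l). A (nth_elem S k) (nth_elem S' l)))"

lemma minor_altdef:
  "minor A S S' = (\<Sum>p | p permutes {..<card S}.
     signof p * (\<Prod>k<card S. A (nth_elem S k) (nth_elem S' (p k))))"
  unfolding minor_def by (rule det_mat_eq_sum)

lemma minor_cong:
  assumes "\<And>s s'. s \<in> S \<Longrightarrow> s' \<in> S' \<Longrightarrow> A s s' = B s s'" "finite S" "finite S'" "card S = card S'"
  shows "minor A S S' = minor B S S'"
proof -
  have "A (nth_elem S k) (nth_elem S' (p k)) = B (nth_elem S k) (nth_elem S' (p k))"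
    if "p permutes {..<card S}" "k < card S" for p k
    using permutes_in_image[OF that(1), of k] that(2) assms by (auto intro!: assms(1) nth_elem_in)
  then show ?thesis unfolding minor_altdef by (intro sum.cong prod.cong refl arg_cong2[of _ _ _ _ "(*)"]) auto
qed

text \<open>Minors are computed over Laurent polynomials but analysed over an algebraically closed
  field; this carries them along \<open>emb\<close>.\<close>

lemma hom_minor:
  assumes "comm_ring_hom h"
  shows "h (minor A S S') = minor (\<lambda>s s'. h (A s s')) S S'"
proof -
  interpret comm_ring_hom h by fact
  show ?thesis
    by (simp add: minor_altdef hom_sum hom_mult hom_prod)
qed

section \<open>Matrix products and the expansion of their minors\<close>

definition ksubsets :: "'i set \<Rightarrow> nat \<Rightarrow> 'i set set" where
  "ksubsets J r = {S. S \<subseteq> J \<and> card S = r}"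

lemma finite_ksubsets [simp]: "finite J \<Longrightarrow> finite (ksubsets J r)"
  by (simp add: ksubsets_def)

lemma ksubsets_finite: "finite J \<Longrightarrow> S \<in> ksubsets J r \<Longrightarrow> finite S"
  by (auto simp: ksubsets_def intro: finite_subset)

text \<open>Matrices are total functions of which only the entries indexed by the relevant finite
  sets matter. Identities involving \<open>delta\<close> therefore hold only for indices in these
  sets.\<close>

definition mm :: "'j set \<Rightarrow> ('i \<Rightarrow> 'j \<Rightarrow> 'a::comm_ring_1) \<Rightarrow> ('j \<Rightarrow> 'k \<Rightarrow> 'a) \<Rightarrow> 'i \<Rightarrow> 'k \<Rightarrow> 'a" where
  "mm J A B = (\<lambda>s s'. \<Sum>l\<in>J. A s l * B l s')"

lemma mm_assoc: "mm J (mm I A B) C = mm I A (mm J B C)"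
  by (auto simp: mm_def fun_eq_iff sum_distrib_left sum_distrib_right mult.assoc intro: sum.swap)

lemma det_rows_not_inj:
  assumes "\<not> inj_on f {..<r}"
  shows "Determinant.det (Matrix.mat r r (\<lambda>(k, l). B (f k) (g l))) = (0::'a::comm_ring_1)"
proof -
  obtain a b where ab: "a < r" "b < r" "a \<noteq> b" "f a = f b"
    using assms by (auto simp: inj_on_def)
  show ?thesis
    by (rule det_identical_rows[of _ r a b]) (use ab in \<open>auto intro!: eq_vecI\<close>)
qed

lemma permutes_nat_less:
  fixes p :: "nat \<Rightarrow> nat"
  shows "p permutes {0..<r} \<Longrightarrow> k < r \<Longrightarrow> p k < r"
  using permutes_in_image[of p "{0..<r}" k] by simp

text \<open>Expanding every entry of the product gives a sum over maps \<open>f\<close> that choose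
  a middle index for each row. A map that repeats an index yields a determinant with two equal rows.
  An injective map lists its image \<open>R\<close> in the order of some permutation, whose sign
  splits off.\<close>

theorem cauchy_binet:
  fixes A :: "'i::linorder \<Rightarrow> 'j::linorder \<Rightarrow> 'a::comm_ring_1" and B :: "'j \<Rightarrow> 'k::linorder \<Rightarrow> 'a"
  assumes J: "finite J" and cS: "card S = r"
  shows "minor (mm J A B) S S' = (\<Sum>R\<in>ksubsets J r. minor A S R * minor B R S')"
proof -
  define F where "F = ({..<r} \<rightarrow>\<^sub>E J)"
  define D where "D = (\<lambda>f. Determinant.det (Matrix.mat r r (\<lambda>(k, l). B (f k) (nth_elem S' l))))"
  have finF: "finite F" unfolding F_def by (intro finite_PiE J) auto
  have D_alt: "D f = (\<Sum>p | p permutes {..<r}. signof p * (\<Prod>k<r. B (f k) (nth_elem S' (p k))))" for f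
    unfolding D_def by (rule det_mat_eq_sum)
  have "minor (mm J A B) S S' = (\<Sum>p | p permutes {..<r}. signof p *
      (\<Sum>f\<in>F. \<Prod>k<r. A (nth_elem S k) (f k) * B (f k) (nth_elem S' (p k))))"
    unfolding minor_altdef mm_def cS F_def by (subst prod_sum_PiE) (auto simp: J)
  also have "\<dots> = (\<Sum>f\<in>F. (\<Prod>k<r. A (nth_elem S k) (f k)) * D f)"
    unfolding D_alt prod.distrib sum_distrib_left
    by (subst sum.swap) (simp add: mult_ac)
  also have "\<dots> = (\<Sum>f\<in>{f\<in>F. inj_on f {..<r}}. (\<Prod>k<r. A (nth_elem S k) (f k)) * D f)"
    by (rule sum.mono_neutral_right) (auto simp: finF D_def det_rows_not_inj)
  also have "\<dots> = (\<Sum>R\<in>ksubsets J r. \<Sum>f\<in>{f\<in>{f\<in>F. inj_on f {..<r}}. f ` {..<r} = R}.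
      (\<Prod>k<r. A (nth_elem S k) (f k)) * D f)"
  proof (rule sum.group[symmetric])
    show "(\<lambda>f. f ` {..<r}) ` {f \<in> F. inj_on f {..<r}} \<subseteq> ksubsets J r"
      by (force simp: F_def ksubsets_def card_image)
  qed (use finF J in auto)
  also have "\<dots> = (\<Sum>R\<in>ksubsets J r. minor A S R * minor B R S')"
  proof (rule sum.cong[OF refl])
    fix R assume "R \<in> ksubsets J r"
    then have R: "R \<subseteq> J" "card R = r" "finite R" using J by (auto simp: ksubsets_def intro: finite_subset)
    have bR: "bij_betw (nth_elem R) {..<r} R" using nth_elem_bij[OF R(3)] R by simp
    define e where "e = inv_into {..<r} (nth_elem R)"
    have e: "e (nth_elem R k) = k" if "k < r" for k
      using bR that by (auto simp: e_def bij_betw_def)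
    have e': "nth_elem R (e x) = x" "e x < r" if "x \<in> R" for x
      using bR that unfolding e_def
      by (auto simp: bij_betw_def f_inv_into_f) (metis inv_into_into lessThan_iff)
    have "(\<Sum>f\<in>{f\<in>{f\<in>F. inj_on f {..<r}}. f ` {..<r} = R}. (\<Prod>k<r. A (nth_elem S k) (f k)) * D f)
      = (\<Sum>q | q permutes {..<r}. (\<Prod>k<r. A (nth_elem S k) (nth_elem R (q k))) * D (nth_elem R \<circ> q))"
    \<comment> \<open>A permutation has to fix the numbers outside \<open>{..<r}\<close>, while an
      element of \<open>F\<close> has to be undefined there, hence the two different
      extensions.\<close>
    proof (rule sum.reindex_bij_witness[where
          j = "\<lambda>f k. if k < r then e (f k) else k" and i = "\<lambda>q. restrict (nth_elem R \<circ> q) {..<r}"])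
      fix f assume f: "f \<in> {f\<in>{f\<in>F. inj_on f {..<r}}. f ` {..<r} = R}"
      then have fR: "f k \<in> R" if "k < r" for k using that by auto
      show "restrict (nth_elem R \<circ> (\<lambda>k. if k < r then e (f k) else k)) {..<r} = f"
        using f fR by (auto simp: fun_eq_iff e' F_def PiE_def extensional_def restrict_def)
      have "(\<lambda>k. if k < r then e (f k) else k) permutes {..<r}"
      proof (rule bij_imp_permutes)
        have "bij_betw f {..<r} R" using f by (auto simp: bij_betw_def)
        moreover have "bij_betw e R {..<r}" unfolding e_def by (rule bij_betw_inv_into[OF bR])
        ultimately have "bij_betw (e \<circ> f) {..<r} {..<r}" by (rule bij_betw_trans)
        then show "bij_betw (\<lambda>k. if k < r then e (f k) else k) {..<r} {..<r}"
          by (subst bij_betw_cong[of _ _ "e \<circ> f"]) auto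
      qed auto
      then show "(\<lambda>k. if k < r then e (f k) else k) \<in> {q. q permutes {..<r}}" by simp
      show "(\<Prod>k<r. A (nth_elem S k) (nth_elem R (if k < r then e (f k) else k))) *
          D (nth_elem R \<circ> (\<lambda>k. if k < r then e (f k) else k)) = (\<Prod>k<r. A (nth_elem S k) (f k)) * D f"
        unfolding D_alt by (simp add: e' fR)
    next
      fix q assume "q \<in> {q. q permutes {..<r}}"
      then have q: "q permutes {..<r}" by simp
      have ql: "q k < r \<longleftrightarrow> k < r" for k using permutes_in_image[OF q, of k] by simp
      show "(\<lambda>k. if k < r then e (restrict (nth_elem R \<circ> q) {..<r} k) else k) = q"
        using q by (auto simp: fun_eq_iff e ql permutes_def)
      have "bij_betw (nth_elem R \<circ> q) {..<r} R"
        by (rule bij_betw_trans[OF permutes_imp_bij[OF q] bR])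
      then have "bij_betw (restrict (nth_elem R \<circ> q) {..<r}) {..<r} R"
        by (subst bij_betw_cong[of _ _ "nth_elem R \<circ> q"]) auto
      then show "restrict (nth_elem R \<circ> q) {..<r} \<in> {f\<in>{f\<in>F. inj_on f {..<r}}. f ` {..<r} = R}"
        using R by (auto simp: F_def bij_betw_def)
    qed
    also have "\<dots> = (\<Sum>q | q permutes {..<r}.
        (\<Prod>k<r. A (nth_elem S k) (nth_elem R (q k))) * (signof q * minor B R S'))"
    proof (rule sum.cong[OF refl], rule arg_cong2[of _ _ _ _ "(*)", OF refl])
      fix q assume "q \<in> {q. q permutes {..<r}}"
      then have q: "q permutes {0..<r}" by (simp add: atLeast0LessThan)
      show "D (nth_elem R \<circ> q) = signof q * minor B R S'"
        unfolding minor_def D_def R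
        by (subst det_permute_rows[OF _ q, symmetric])
          (auto intro!: arg_cong[of _ _ Determinant.det] eq_matI simp: permutes_nat_less[OF q])
    qed
    also have "\<dots> = minor A S R * minor B R S'"
      unfolding minor_altdef[of A] cS sum_distrib_right by (simp add: mult_ac)
    finally show "(\<Sum>f\<in>{f\<in>{f\<in>F. inj_on f {..<r}}. f ` {..<r} = R}. (\<Prod>k<r. A (nth_elem S k) (f k)) * D f) =
      minor A S R * minor B R S'" .
  qed
  finally show ?thesis .
qed

section \<open>Minors of noncrossing matrices\<close>

lemma permutes_mono_id:
  assumes p: "p permutes {..<r::nat}" and le: "\<And>k l. k < l \<Longrightarrow> l < r \<Longrightarrow> p k < p l"
  shows "p = id"
proof -
  have "strict_mono_on {..<r} p" using le by (auto simp: strict_mono_on_def)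
  then have "p (nth_elem {..<r} k) = nth_elem {..<r} k" if "k < r" for k
    using strict_mono_on_nth_elem[of "{..<r}" p "{..<r}" k] permutes_imp_bij[OF p] that by simp
  moreover have "nth_elem {..<r} k = k" if "k < r" for k
    using that by (simp add: nth_elem_def lessThan_atLeast0)
  ultimately have "p k = k" if "k < r" for k using that by simp
  moreover have "p k = k" if "\<not> k < r" for k using p that by (auto simp: permutes_def)
  ultimately show ?thesis by (auto simp: fun_eq_iff)
qed

text \<open>A permutation other than the identity has an inversion, and the two entries at this
  inversion already multiply to zero.\<close>

lemma minor_noncrossing:
  assumes fin: "finite S" "finite S'" "card S = card S'"
    and nc: "\<And>s s' t t'. s < s' \<Longrightarrow> t' < t \<Longrightarrow> {s, s'} \<subseteq> S \<Longrightarrow> {t, t'} \<subseteq> S' \<Longrightarrow> A s t * A s' t' = 0"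
  shows "minor A S S' = (\<Prod>k<card S. A (nth_elem S k) (nth_elem S' k))"
proof -
  have "signof p * (\<Prod>k<card S. A (nth_elem S k) (nth_elem S' (p k))) = 0"
    if p: "p permutes {..<card S}" "p \<noteq> id" for p
  proof -
    obtain k l where kl: "k < l" "l < card S" "\<not> p k < p l"
      using permutes_mono_id[OF p(1)] p(2) by blast
    have "p k \<noteq> p l" using kl permutes_inj[OF p(1)] by (auto simp: inj_def)
    then have pk: "p l < p k" using kl by simp
    have pp: "p k < card S" "p l < card S" using permutes_in_image[OF p(1)] kl by fastforce+
    have 0: "A (nth_elem S k) (nth_elem S' (p k)) * A (nth_elem S l) (nth_elem S' (p l)) = 0"
      by (rule nc) (use kl pk pp fin in \<open>auto simp: nth_elem_less_iff intro!: nth_elem_in\<close>)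
    have "(\<Prod>k<card S. A (nth_elem S k) (nth_elem S' (p k))) =
        A (nth_elem S k) (nth_elem S' (p k)) * A (nth_elem S l) (nth_elem S' (p l)) *
        (\<Prod>k\<in>{..<card S} - {k} - {l}. A (nth_elem S k) (nth_elem S' (p k)))"
      using kl by (subst prod.remove[of _ k], simp, simp, subst prod.remove[of _ l]) (auto simp: mult_ac)
    with 0 show ?thesis by simp
  qed
  then have "minor A S S' = (\<Sum>p\<in>{id}. signof p * (\<Prod>k<card S. A (nth_elem S k) (nth_elem S' (p k))))"
    unfolding minor_altdef by (intro sum.mono_neutral_right) (auto simp: finite_permutations permutes_id)
  then show ?thesis by (simp add: sign_id)
qed

lemma minor_one:
  assumes "finite S" "finite S'" "card S = card S'"
  shows "minor (\<lambda>s s'. if s = s' then 1 else 0) S S' = (if S = S' then 1 else (0::'a::comm_ring_1))"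
proof -
  have "minor (\<lambda>s s'. if s = s' then 1 else (0::'a)) S S' =
      (\<Prod>k<card S. if nth_elem S k = nth_elem S' k then 1 else 0 :: 'a)"
    by (rule minor_noncrossing) (use assms in auto)
  also have "\<dots> = (if S = S' then 1 else 0)"
  proof (cases "S = S'")
    case False
    have "\<exists>k<card S. nth_elem S k \<noteq> nth_elem S' k"
    proof (rule ccontr)
      assume "\<not> ?thesis"
      then have "nth_elem S ` {..<card S} = nth_elem S' ` {..<card S}" by auto
      then show False using nth_elem_bij[OF assms(1)] nth_elem_bij[OF assms(2)] assms False
        by (auto simp: bij_betw_def)
    qed
    then show ?thesis using False by (auto intro!: prod_zero)
  qed auto
  finally show ?thesis .
qed

section \<open>Transfer matrices of consecutive columns\<close>

definition delta :: "'i \<Rightarrow> 'i \<Rightarrow> 'a::comm_ring_1" where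
  "delta = (\<lambda>s s'. if s = s' then 1 else 0)"

text \<open>The transfer matrix across the \<open>k\<close> columns
  \<open>x, ..., x + k - 1\<close>, multiplied from left to right.\<close>

primrec prod_mat :: "'i set \<Rightarrow> (int \<Rightarrow> 'i \<Rightarrow> 'i \<Rightarrow> 'a::comm_ring_1) \<Rightarrow> int \<Rightarrow> nat \<Rightarrow> 'i \<Rightarrow> 'i \<Rightarrow> 'a" where
  "prod_mat J M x 0 = delta"
| "prod_mat J M x (Suc k) = mm J (prod_mat J M x k) (M (x + int k))"

lemma mm_one_left:
  assumes J: "finite J" "s \<in> J"
  shows "mm J delta A s s' = A s s'"
proof -
  have "mm J delta A s s' = (\<Sum>l\<in>J. if s = l then A s s' else 0)"
    unfolding mm_def delta_def by (intro sum.cong) auto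
  then show ?thesis using J by simp
qed

lemma mm_one_right:
  assumes J: "finite J" "s' \<in> J"
  shows "mm J A delta s s' = A s s'"
proof -
  have "mm J A delta s s' = (\<Sum>l\<in>J. if l = s' then A s s' else 0)"
    unfolding mm_def delta_def by (intro sum.cong) auto
  then show ?thesis using J by simp
qed

lemma mm_cong:
  "(\<And>l. l \<in> J \<Longrightarrow> A s l = A' s l) \<Longrightarrow> (\<And>l. l \<in> J \<Longrightarrow> B l s' = B' l s') \<Longrightarrow>
    mm J A B s s' = mm J A' B' s s'"
  by (simp add: mm_def)

lemma prod_mat_add:
  assumes "finite J" "s \<in> J" "s' \<in> J"
  shows "prod_mat J M x (k + l) s s' = mm J (prod_mat J M x k) (prod_mat J M (x + int k) l) s s'"
  using assms(3)
proof (induction l arbitrary: s')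
  case (Suc l)
  have "prod_mat J M x (k + Suc l) s s' = mm J (prod_mat J M x (k + l)) (M (x + int (k + l))) s s'"
    by simp
  also have "\<dots> = mm J (mm J (prod_mat J M x k) (prod_mat J M (x + int k) l)) (M (x + int (k + l))) s s'"
    by (rule mm_cong) (simp_all add: Suc.IH)
  also have "\<dots> = mm J (prod_mat J M x k) (prod_mat J M (x + int k) (Suc l)) s s'"
    by (simp add: mm_assoc add.assoc)
  finally show ?case .
qed (simp add: mm_one_right assms)

lemma prod_mat_cong:
  assumes "s \<in> J" "s' \<in> J" "\<And>t s s'. t < k \<Longrightarrow> s \<in> J \<Longrightarrow> s' \<in> J \<Longrightarrow> M (x + int t) s s' = M' (y + int t) s s'"
  shows "prod_mat J M x k s s' = prod_mat J M' y k s s'"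
  using assms(2,3)
proof (induction k arbitrary: s')
  case (Suc k)
  show ?case using Suc.prems by (auto intro!: mm_cong Suc.IH)
qed simp

text \<open>Blocks of \<open>p\<close> columns act as single columns. With one turn as the block,
  periodicity makes the product a power.\<close>

lemma prod_mat_mult:
  assumes "finite J" "s \<in> J" "s' \<in> J"
  shows "prod_mat J M x (p * k) s s' =
    prod_mat J (\<lambda>t. prod_mat J M (x + int p * t) p) 0 k s s'"
  using assms(3)
proof (induction k arbitrary: s')
  case (Suc k)
  have "prod_mat J M x (p * Suc k) s s' = prod_mat J M x (p * k + p) s s'" by (simp add: add.commute)
  also have "\<dots> = mm J (prod_mat J M x (p * k)) (prod_mat J M (x + int (p * k)) p) s s'"
    by (rule prod_mat_add) (use assms Suc.prems in auto)
  also have "\<dots> = mm J (prod_mat J (\<lambda>t. prod_mat J M (x + int p * t) p) 0 k) (prod_mat J M (x + int (p * k)) p) s s'"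
    by (rule mm_cong) (simp_all add: Suc.IH)
  finally show ?case by simp
qed simp

lemma hom_prod_mat:
  assumes "comm_ring_hom h"
  shows "h (prod_mat J M x k s s') = prod_mat J (\<lambda>x s s'. h (M x s s')) x k s s'"
proof -
  interpret comm_ring_hom h by fact
  show ?thesis
    by (induction k arbitrary: s s') (simp_all add: delta_def mm_def hom_sum hom_mult)
qed

text \<open>Iterated Cauchy-Binet: the intermediate index sets form a sequence from \<open>S\<close>
  to \<open>S'\<close>. For noncrossing factors this is the Lindstroem-Gessel-Viennot lemma, the
  sets being the positions of the paths.\<close>

lemma minor_prod_mat:
  fixes M :: "int \<Rightarrow> 'i::linorder \<Rightarrow> 'i \<Rightarrow> 'a::comm_ring_1"
  assumes J: "finite J" and S: "S \<in> ksubsets J r" and S': "S' \<in> ksubsets J r"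
  shows "minor (prod_mat J M x k) S S' =
    (\<Sum>Sq\<in>{Sq \<in> {..k} \<rightarrow>\<^sub>E ksubsets J r. Sq 0 = S \<and> Sq k = S'}.
       \<Prod>t<k. minor (M (x + int t)) (Sq t) (Sq (Suc t)))"
  using S'
proof (induction k arbitrary: S')
  case 0
  have f: "finite S" "finite S'" "card S = card S'"
    using S 0 J by (auto simp: ksubsets_def intro: finite_subset)
  have "{Sq \<in> {..0::nat} \<rightarrow>\<^sub>E ksubsets J r. Sq 0 = S \<and> Sq 0 = S'} = (if S = S' then {\<lambda>t\<in>{0}. S} else {})"
    using S by (auto simp: PiE_def extensional_def fun_eq_iff)
  then show ?case using f by (simp add: delta_def minor_one)
next
  case (Suc k)
  let ?K = "ksubsets J r"
  let ?A = "\<lambda>(k::nat) S'. {Sq \<in> {..k} \<rightarrow>\<^sub>E ?K. Sq 0 = S \<and> Sq k = S'}"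
  let ?g = "\<lambda>(k::nat) Sq. \<Prod>t<k. minor (M (x + int t)) (Sq t) (Sq (Suc t))"
  have cS: "card S = r" using S by (simp add: ksubsets_def)
  have fin: "finite (?A k R)" for k R
    by (rule finite_subset[of _ "{..k} \<rightarrow>\<^sub>E ?K"]) (auto simp: J intro!: finite_PiE)
  have "minor (prod_mat J M x (Suc k)) S S' = (\<Sum>R\<in>?K. (\<Sum>Sq\<in>?A k R. ?g k Sq) * minor (M (x + int k)) R S')"
    by (simp add: cauchy_binet[OF J cS] Suc.IH)
  also have "\<dots> = (\<Sum>(R, Sq)\<in>(SIGMA R:?K. ?A k R). ?g k Sq * minor (M (x + int k)) R S')"
    unfolding sum_distrib_right by (rule sum.Sigma) (auto simp: J fin)
  also have "\<dots> = (\<Sum>Sq\<in>?A (Suc k) S'. ?g (Suc k) Sq)"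
  proof (rule sum.reindex_bij_witness[where i = "\<lambda>Sq. (Sq k, restrict Sq {..k})" and j = "\<lambda>(R, Sq). Sq(Suc k := S')"])
    fix a assume a: "a \<in> (SIGMA R:?K. ?A k R)"
    obtain R Sq where [simp]: "a = (R, Sq)" by (cases a)
    show "(((case a of (R, Sq) \<Rightarrow> Sq(Suc k := S')) k), restrict (case a of (R, Sq) \<Rightarrow> Sq(Suc k := S')) {..k}) = a"
      using a by (auto simp: fun_eq_iff PiE_def extensional_def restrict_def)
    show "(case a of (R, Sq) \<Rightarrow> Sq(Suc k := S')) \<in> ?A (Suc k) S'"
      using a Suc.prems by (auto simp: PiE_def extensional_def Pi_def)
    have "?g k (Sq(Suc k := S')) = ?g k Sq" by (intro prod.cong) auto
    then show "?g (Suc k) (case a of (R, Sq) \<Rightarrow> Sq(Suc k := S')) = (case a of (R, Sq) \<Rightarrow> ?g k Sq * minor (M (x + int k)) R S')"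
      using a by simp
  next
    fix Sq assume Sq: "Sq \<in> ?A (Suc k) S'"
    then show "(Sq k, restrict Sq {..k}) \<in> (SIGMA R:?K. ?A k R)" by (auto simp: PiE_def Pi_def)
    show "(case (Sq k, restrict Sq {..k}) of (R, Sq) \<Rightarrow> Sq(Suc k := S')) = Sq"
      using Sq by (auto simp: fun_eq_iff PiE_def extensional_def restrict_def)
  qed
  finally show ?case .
qed

section \<open>Triangular form over an algebraically closed field\<close>

text \<open>The index \<open>p\<close> of a nonzero coordinate is supplied because it is the one to
  be eliminated when passing to the quotient by \<open>v\<close>.\<close>

lemma eigenvector_exists:
  fixes A :: "'i \<Rightarrow> 'i \<Rightarrow> 'a::alg_closed_field"
  assumes I: "finite I" "I \<noteq> {}"
  obtains v l p where "p \<in> I" "v p \<noteq> 0" "\<And>i. i \<in> I \<Longrightarrow> (\<Sum>j\<in>I. A i j * v j) = l * v i"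
proof -
  obtain f where f: "bij_betw f {..<card I} I"
    using ex_bij_betw_nat_finite[OF I(1)] by (auto simp: atLeast0LessThan)
  define n where "n = card I"
  define B where "B = Matrix.mat n n (\<lambda>(a, b). A (f a) (f b))"
  have B: "B \<in> carrier_mat n n" by (simp add: B_def)
  have "Polynomial.degree (char_poly B) = n" using degree_monic_char_poly[OF B] by simp
  then have "\<exists>l. poly (char_poly B) l = 0"
    using I by (intro alg_closed_imp_poly_has_root) (auto simp: n_def card_gt_0_iff)
  then obtain l where "eigenvalue B l" using eigenvalue_root_char_poly[OF B] by auto
  then obtain u where u: "u \<in> carrier_vec n" "u \<noteq> 0\<^sub>v n" "B *\<^sub>v u = l \<cdot>\<^sub>v u"
    using B by (auto simp: eigenvalue_def eigenvector_def)
  then obtain a where a: "a < n" "Matrix.vec_index u a \<noteq> 0"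
    by (metis carrier_vecD eq_vecI index_zero_vec)
  define g where "g = the_inv_into {..<n} f"
  have g: "g (f k) = k" if "k < n" for k
    using f that unfolding g_def n_def by (auto simp: bij_betw_def the_inv_into_f_f)
  show ?thesis
  proof (rule that[of "f a" "\<lambda>i. vec_index u (g i)" l])
    show "f a \<in> I" using f a by (auto simp: bij_betw_def n_def)
    show "vec_index u (g (f a)) \<noteq> 0" using a g by simp
    fix i assume "i \<in> I"
    then obtain k where k: "i = f k" "k < n" using f by (auto simp: bij_betw_def n_def)
    have "(\<Sum>j\<in>I. A i j * vec_index u (g j)) = (\<Sum>b<n. A i (f b) * vec_index u (g (f b)))"
      using sum.reindex_bij_betw[OF f, of "\<lambda>j. A i j * vec_index u (g j)"] by (simp add: n_def)
    also have "\<dots> = (\<Sum>b<n. B $$ (k, b) * vec_index u b)" using k by (simp add: B_def g)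
    also have "\<dots> = vec_index (B *\<^sub>v u) k" using k u(1) B
      by (simp add: Matrix.scalar_prod_def atLeast0LessThan)
    also have "\<dots> = l * vec_index u k" using u k by (simp only: u(3)) simp
    finally show "(\<Sum>j\<in>I. A i j * vec_index u (g j)) = l * vec_index u (g i)" using k g by simp
  qed
qed

text \<open>\<open>P\<close> and \<open>Q\<close> are mutually inverse changes of basis, and
  \<open>U\<close> is the matrix \<open>Q A P\<close>. The induction splits off an eigenvector
  \<open>v\<close> and passes to the quotient by its span.\<close>

lemma triangular_form:
  fixes A :: "'i \<Rightarrow> 'i \<Rightarrow> 'a::alg_closed_field"
  assumes "finite I" "card I = N"
  shows "\<exists>P Q U.
    (\<forall>k<N. \<forall>l<N. mm I Q P k l = delta k l) \<and> (\<forall>i\<in>I. \<forall>j\<in>I. mm {..<N} P Q i j = delta i j) \<and>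
    (\<forall>i\<in>I. \<forall>l<N. mm I A P i l = mm {..<N} P U i l) \<and> (\<forall>k<N. \<forall>l<k. U k l = (0::'a))"
  using assms
proof (induction N arbitrary: I A)
  case 0
  then show ?case by auto
next
  case (Suc N)
  then have "I \<noteq> {}" by auto
  then obtain v l p where p: "p \<in> I" "v p \<noteq> 0" and ev: "\<And>i. i \<in> I \<Longrightarrow> (\<Sum>j\<in>I. A i j * v j) = l * v i"
    using eigenvector_exists[OF Suc.prems(1), of A] by metis
  define I' where "I' = I - {p}"
  have I': "finite I'" "card I' = N" "p \<notin> I'" and I: "I = insert p I'"
    using Suc.prems p by (auto simp: I'_def)
  \<comment> \<open>Modulo \<open>v\<close>, the basis vector of \<open>p\<close> is the combination
    of the others with coefficients \<open>- v i / v p\<close>; so \<open>A'\<close> is the matrix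
    induced by \<open>A\<close> on the quotient, in the basis \<open>I'\<close>.\<close>
  define A' where "A' = (\<lambda>i j. A i j - v i / v p * A p j)"
  obtain P Q U where IH:
    "(\<forall>k<N. \<forall>l<N. mm I' Q P k l = delta k l) \<and> (\<forall>i\<in>I'. \<forall>j\<in>I'. mm {..<N} P Q i j = delta i j) \<and>
     (\<forall>i\<in>I'. \<forall>l<N. mm I' A' P i l = mm {..<N} P U i l) \<and> (\<forall>k<N. \<forall>l<k. U k l = (0::'a))"
    using Suc.IH[OF I'(1,2), of A'] by (elim exE)
  note QP = IH[THEN conjunct1, rule_format] and PQ = IH[THEN conjunct2, THEN conjunct1, rule_format]
    and AP = IH[THEN conjunct2, THEN conjunct2, THEN conjunct1, rule_format]
    and U0 = IH[THEN conjunct2, THEN conjunct2, THEN conjunct2, rule_format]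
  \<comment> \<open>The new basis starts with \<open>v\<close> and continues with the old one,
    extended by 0 at \<open>p\<close>. The entries of \<open>Q'\<close> at \<open>p\<close> are then
    forced: its first row must take the value 1 on \<open>v\<close>, and all later rows must
    annihilate \<open>v\<close>.\<close>
  define P' where "P' = (\<lambda>i k. case k of 0 \<Rightarrow> v i | Suc k \<Rightarrow> if i = p then 0 else P i k)"
  define Q' where "Q' = (\<lambda>k i. case k of 0 \<Rightarrow> if i = p then 1 / v p else 0
      | Suc k \<Rightarrow> if i = p then - (\<Sum>j\<in>I'. Q k j * v j) / v p else Q k i)"
  define U' where "U' = (\<lambda>k m. case k of
      0 \<Rightarrow> (case m of 0 \<Rightarrow> l | Suc m \<Rightarrow> (\<Sum>j\<in>I'. A p j * P j m) / v p)
    | Suc k \<Rightarrow> (case m of 0 \<Rightarrow> 0 | Suc m \<Rightarrow> U k m))"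
  have sumI: "(\<Sum>j\<in>I. h j) = h p + (\<Sum>j\<in>I'. h j)" for h :: "'i \<Rightarrow> 'a"
    unfolding I by (rule sum.insert[OF I'(1,3)])
  have sumI': "(\<Sum>j\<in>I'. if j = p then g j else h j) = (\<Sum>j\<in>I'. h j)"
     "(\<Sum>j\<in>I'. f j * (if j = p then g j else h j)) = (\<Sum>j\<in>I'. f j * h j)"
     "(\<Sum>j\<in>I'. (if j = p then g j else h j) * f j) = (\<Sum>j\<in>I'. h j * f j)"
     "(\<Sum>j\<in>I'. (if j = p then g j else h j) * (if j = p then g' j else h' j)) = (\<Sum>j\<in>I'. h j * h' j)" for f g h g' h' :: "'i \<Rightarrow> 'a"
    by (rule sum.cong; use I' in auto)+
  have sumN: "(\<Sum>k<Suc N. h k) = h 0 + (\<Sum>k<N. h (Suc k))" for h :: "nat \<Rightarrow> 'a"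
    by (rule sum.lessThan_Suc_shift)
  have "mm I Q' P' k m = delta k m" if "k < Suc N" "m < Suc N" for k m
    using that p QP
    by (cases k; cases m) (auto simp: mm_def delta_def sumI sumI' P'_def Q'_def)
  moreover have "mm {..<Suc N} P' Q' i j = delta i j" if "i \<in> I" "j \<in> I" for i j
  proof -
    have *: "(\<Sum>k<N. P i k * (- (\<Sum>j\<in>I'. Q k j * v j) / v p)) = - v i / v p" if "i \<in> I'" for i
    proof -
      have "(\<Sum>k<N. P i k * (- (\<Sum>j\<in>I'. Q k j * v j) / v p)) = - (\<Sum>k<N. \<Sum>j\<in>I'. P i k * Q k j * v j) / v p"
        by (simp add: sum_distrib_left sum_divide_distrib sum_negf mult_ac)
      also have "(\<Sum>k<N. \<Sum>j\<in>I'. P i k * Q k j * v j) = (\<Sum>j\<in>I'. mm {..<N} P Q i j * v j)"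
        unfolding mm_def sum_distrib_right by (rule sum.swap)
      also have "\<dots> = (\<Sum>j\<in>I'. if j = i then v j else 0)"
        using that by (intro sum.cong) (auto simp: PQ delta_def)
      also have "\<dots> = v i" using that I' by simp
      finally show ?thesis by simp
    qed
    show ?thesis
    proof (cases "j = p")
      case True
      then show ?thesis using that p *[of i] I I'
        by (auto simp: mm_def delta_def sumN P'_def Q'_def simp del: sum.lessThan_Suc)
    next
      case False
      moreover have "i \<in> I' \<Longrightarrow> i \<noteq> p" using I' by auto
      ultimately show ?thesis using that PQ[of i j] I I'
        by (auto simp: mm_def delta_def sumN P'_def Q'_def simp del: sum.lessThan_Suc)
    qed
  qed
  moreover have "mm I A P' i m = mm {..<Suc N} P' U' i m" if i: "i \<in> I" and m: "m < Suc N" for i m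
  proof (cases m)
    case 0
    then show ?thesis using ev[OF i] by (simp add: mm_def sumN P'_def U'_def mult.commute del: sum.lessThan_Suc)
  next
    case (Suc m')
    show ?thesis
    proof (cases "i = p")
      case True
      then show ?thesis using Suc p by (simp add: mm_def sumN sumI sumI' P'_def U'_def del: sum.lessThan_Suc)
    next
      case False
      then have "i \<in> I'" using i I by simp
      from AP[OF this, of m'] Suc m have
        "(\<Sum>j\<in>I'. (A i j - v i / v p * A p j) * P j m') = (\<Sum>k<N. P i k * U k m')"
        by (simp add: mm_def A'_def)
      then have "(\<Sum>j\<in>I'. A i j * P j m') = v i / v p * (\<Sum>j\<in>I'. A p j * P j m') + (\<Sum>k<N. P i k * U k m')"
        by (simp add: left_diff_distrib sum_subtractf sum_distrib_left mult.assoc diff_eq_eq add.commute)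
      then show ?thesis using Suc False by (simp add: mm_def sumN sumI sumI' P'_def U'_def del: sum.lessThan_Suc)
    qed
  qed
  moreover have "U' k m = 0" if "k < Suc N" "m < k" for k m
    using that U0 by (auto simp: U'_def split: nat.splits)
  ultimately show ?case by blast
qed


section \<open>Compound matrices of triangular matrices\<close>

lemma minor_triangular:
  fixes U :: "nat \<Rightarrow> nat \<Rightarrow> 'a::comm_ring_1"
  assumes K: "finite K" "card K = r" and L: "finite L" "card L = r"
    and U: "\<And>k l. k \<in> K \<Longrightarrow> l \<in> L \<Longrightarrow> l < k \<Longrightarrow> U k l = 0"
  shows "minor U K L = (if K = L then \<Prod>k\<in>K. U k k else if \<Sum>K < \<Sum>L then minor U K L else 0)"
proof -
  have bK: "bij_betw (nth_elem K) {..<r} K" and bL: "bij_betw (nth_elem L) {..<r} L"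
    using nth_elem_bij[OF K(1)] nth_elem_bij[OF L(1)] K L by simp_all
  have sK: "\<Sum>K = (\<Sum>k<r. nth_elem K k)" and sL: "\<Sum>L = (\<Sum>k<r. nth_elem L k)"
    using sum.reindex_bij_betw[OF bK, of "\<lambda>x. x"] sum.reindex_bij_betw[OF bL, of "\<lambda>x. x"] by simp_all
  \<comment> \<open>A nonvanishing term pairs each element of \<open>K\<close> with one of
    \<open>L\<close> that is at least as large. Comparing sums, either the sum of \<open>K\<close>
    is smaller or all pairs are equal. So the sum of the elements is a rank for which the compound
    matrix is triangular.\<close>
  have nz: "\<Sum>K < \<Sum>L \<or> (K = L \<and> p = id)"
    if p: "p permutes {..<r}" and n0: "(\<Prod>k<r. U (nth_elem K k) (nth_elem L (p k))) \<noteq> 0" for p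
  proof -
    have pr: "p k < r" if "k < r" for k using permutes_in_image[OF p, of k] that by simp
    have le: "nth_elem K k \<le> nth_elem L (p k)" if "k < r" for k
    proof (rule ccontr)
      assume "\<not> ?thesis"
      then have "U (nth_elem K k) (nth_elem L (p k)) = 0"
        by (intro U nth_elem_in) (use K L that pr in auto)
      with n0 that show False by (auto intro: prod_zero)
    qed
    have sL': "\<Sum>L = (\<Sum>k<r. nth_elem L (p k))"
      unfolding sL using sum.permute[OF p, of "nth_elem L"] by (simp add: o_def)
    show ?thesis
    proof (cases "\<forall>k<r. nth_elem K k = nth_elem L (p k)")
      case True
      have "K = nth_elem K ` {..<r}" using bK by (simp add: bij_betw_def)
      also have "\<dots> = nth_elem L ` p ` {..<r}" using True by (simp add: image_image)
      also have "\<dots> = L" using bL permutes_image[OF p] by (simp add: bij_betw_def)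
      finally have KL: "K = L" .
      have "p k = k" if "k < r" for k
        using True that KL nth_elem_eq_iff[OF L(1)] L pr by simp
      moreover have "p k = k" if "\<not> k < r" for k using p that by (auto simp: permutes_def)
      ultimately show ?thesis using KL by (auto simp: fun_eq_iff)
    next
      case False
      then obtain k where "k < r" "nth_elem K k < nth_elem L (p k)" using le by (meson nless_le)
      then show ?thesis unfolding sK sL' using le by (auto intro!: sum_strict_mono_ex1)
    qed
  qed
  show ?thesis
  proof (cases "\<Sum>K < \<Sum>L \<and> K \<noteq> L")
    case False
    have "minor U K L = (\<Sum>p\<in>{p. p permutes {..<r} \<and> K = L \<and> p = id}.
        signof p * (\<Prod>k<r. U (nth_elem K k) (nth_elem L (p k))))"
      unfolding minor_altdef K
    proof (rule sum.mono_neutral_right)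
      have "signof p * (\<Prod>k<r. U (nth_elem K k) (nth_elem L (p k))) = 0"
        if "p permutes {..<r}" "\<not> (K = L \<and> p = id)" for p
        using nz[OF that(1)] that(2) False by fastforce
      then show "\<forall>p\<in>{p. p permutes {..<r}} - {p. p permutes {..<r} \<and> K = L \<and> p = id}.
          signof p * (\<Prod>k<r. U (nth_elem K k) (nth_elem L (p k))) = 0" by blast
    qed (auto simp: finite_permutations)
    also have "\<dots> = (if K = L then \<Prod>k\<in>K. U k k else 0)"
    proof (cases "K = L")
      case True
      then have "{p. p permutes {..<r} \<and> K = L \<and> p = id} = {id}" by (auto intro: permutes_id)
      moreover have "(\<Prod>k<r. U (nth_elem K k) (nth_elem K k)) = (\<Prod>k\<in>K. U k k)"
        by (rule prod.reindex_bij_betw[OF bK])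
      ultimately show ?thesis using True by (simp add: sign_id)
    next
      case neq: False
      then have "{p. p permutes {..<r} \<and> K = L \<and> p = id} = {}" by simp
      then show ?thesis using neq by (simp only: sum.empty if_False)
    qed
    finally have "minor U K L = (if K = L then \<Prod>k\<in>K. U k k else 0)" .
    with False show ?thesis by (cases "K = L") simp_all
  qed simp
qed

section \<open>Linear recurrences\<close>

lemma recurrence_at_iff:
  assumes "Polynomial.degree P \<le> d"
  shows "recurrence_at P f k \<longleftrightarrow> (\<Sum>s\<le>d. Polynomial.coeff P s * f (k + s)) = 0"
proof -
  have "(\<Sum>s\<le>d. Polynomial.coeff P s * f (k + s)) =
      (\<Sum>s\<le>Polynomial.degree P. Polynomial.coeff P s * f (k + s))"
    by (rule sum.mono_neutral_right) (use assms in \<open>auto simp: coeff_eq_0\<close>)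
  then show ?thesis by (simp add: recurrence_at_def)
qed

lemma recurrence_at_linear:
  assumes "finite I" "\<And>i. i \<in> I \<Longrightarrow> recurrence_at P (x i) k"
  shows "recurrence_at P (\<lambda>k. \<Sum>i\<in>I. c i * x i k) k"
proof -
  have "(\<Sum>s\<le>Polynomial.degree P. Polynomial.coeff P s * (\<Sum>i\<in>I. c i * x i (k + s))) =
     (\<Sum>i\<in>I. c i * (\<Sum>s\<le>Polynomial.degree P. Polynomial.coeff P s * x i (k + s)))"
    unfolding sum_distrib_left by (subst sum.swap) (simp add: mult_ac)
  also have "\<dots> = 0" using assms by (simp add: recurrence_at_def)
  finally show ?thesis by (simp add: recurrence_at_def)
qed

text \<open>In terms of the shift \<open>E\<close> on sequences, a characteristic polynomial acts as
  \<open>P(E)\<close>, and the factor \<open>E - d\<close> is applied first.\<close>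

lemma recurrence_at_linear_factor:
  assumes "recurrence_at P (\<lambda>k. f (Suc k) - d * f k) k"
  shows "recurrence_at ([:-d, 1:] * P) f k"
proof -
  let ?n = "Polynomial.degree P"
  have deg: "Polynomial.degree ([:-d, 1:] * P) \<le> Suc ?n"
    by (rule order_trans[OF degree_mult_le]) simp
  have coeff: "Polynomial.coeff ([:-d, 1:] * P) s = (case s of 0 \<Rightarrow> 0 | Suc s \<Rightarrow> Polynomial.coeff P s) - d * Polynomial.coeff P s" for s
    by (simp add: coeff_pCons algebra_simps split: nat.splits)
  have "(\<Sum>s\<le>Suc ?n. Polynomial.coeff ([:-d, 1:] * P) s * f (k + s)) =
      (\<Sum>s\<le>Suc ?n. (case s of 0 \<Rightarrow> 0 | Suc s \<Rightarrow> Polynomial.coeff P s) * f (k + s)) -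
      d * (\<Sum>s\<le>Suc ?n. Polynomial.coeff P s * f (k + s))"
    unfolding coeff by (simp add: algebra_simps sum_subtractf sum_distrib_left del: sum.atMost_Suc)
  also have "(\<Sum>s\<le>Suc ?n. (case s of 0 \<Rightarrow> 0 | Suc s \<Rightarrow> Polynomial.coeff P s) * f (k + s)) =
      (\<Sum>s\<le>?n. Polynomial.coeff P s * f (Suc (k + s)))"
    by (subst sum.atMost_Suc_shift) simp
  also have "(\<Sum>s\<le>Suc ?n. Polynomial.coeff P s * f (k + s)) =
      (\<Sum>s\<le>?n. Polynomial.coeff P s * f (k + s))"
    by (simp add: coeff_eq_0)
  also have "(\<Sum>s\<le>?n. Polynomial.coeff P s * f (Suc (k + s))) - d * \<dots> =
      (\<Sum>s\<le>?n. Polynomial.coeff P s * (f (Suc (k + s)) - d * f (k + s)))"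
    by (simp add: algebra_simps sum_subtractf sum_distrib_left)
  also have "\<dots> = 0" using assms by (simp add: recurrence_at_def)
  finally show ?thesis using recurrence_at_iff[OF deg] by blast
qed

text \<open>With \<open>E\<close> the shift, \<open>E - D j j\<close> maps the sequence
  \<open>x j\<close> to a combination of sequences of smaller rank, and these are annihilated by the
  remaining factors.\<close>

lemma recurrence_at_triangular:
  fixes D :: "'i \<Rightarrow> 'i \<Rightarrow> 'a::comm_ring_1" and rk :: "'i \<Rightarrow> nat"
  assumes I: "finite I"
    and D: "\<And>i j. i \<in> I \<Longrightarrow> j \<in> I \<Longrightarrow> D i j \<noteq> 0 \<Longrightarrow> i = j \<or> rk i < rk j"
    and x: "\<And>j k. j \<in> I \<Longrightarrow> x j (Suc k) = (\<Sum>i\<in>I. x i k * D i j)"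
    and j: "j \<in> I"
  shows "recurrence_at (\<Prod>i\<in>I. [:- D i i, 1:]) (x j) k"
proof -
  \<comment> \<open>The product is taken over any \<open>A\<close> that contains \<open>j\<close>
    and all indices of smaller rank; the induction removes the factor of \<open>j\<close> from
    \<open>A\<close>, which would be impossible for the fixed set \<open>I\<close>.\<close>
  have "recurrence_at (\<Prod>i\<in>A. [:- D i i, 1:]) (x j) k"
    if "j \<in> A" "A \<subseteq> I" "\<And>i. i \<in> I \<Longrightarrow> rk i < rk j \<Longrightarrow> i \<in> A" for A j k
    using that
  proof (induction "rk j" arbitrary: j k A rule: less_induct)
    case less
    let ?P = "\<Prod>i\<in>A - {j}. [:- D i i, 1:]"
    let ?L = "{i \<in> I. rk i < rk j}"
    have fin: "finite A" using less.prems I finite_subset by blast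
    have "x j (Suc k) - D j j * x j k = (\<Sum>i\<in>?L. D i j * x i k)" for k
    proof -
      have "x j (Suc k) = (\<Sum>i\<in>insert j ?L. x i k * D i j)"
        unfolding x[OF subsetD[OF less.prems(2,1)]]
      proof (rule sum.mono_neutral_right)
        have "D i j = 0" if "i \<in> I - insert j ?L" for i
          using D[of i j] that less.prems by auto
        then show "\<forall>i\<in>I - insert j ?L. x i k * D i j = 0" by simp
      qed (use I less.prems in auto)
      also have "\<dots> = x j k * D j j + (\<Sum>i\<in>?L. x i k * D i j)" using I by (subst sum.insert) auto
      finally show ?thesis by (simp add: mult.commute)
    qed
    moreover have "recurrence_at ?P (x i) k" if "i \<in> ?L" for i k
      by (rule less.hyps) (use that less.prems in auto)
    then have "recurrence_at ?P (\<lambda>k. \<Sum>i\<in>?L. D i j * x i k) k"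
      using I by (intro recurrence_at_linear) auto
    ultimately have "recurrence_at ([:- D j j, 1:] * ?P) (x j) k"
      by (intro recurrence_at_linear_factor) simp
    then show ?case
      using prod.remove[OF fin less.prems(1), of "\<lambda>i. [:- D i i, 1:]"] by simp
  qed
  from this[of j I k] j show ?thesis by auto
qed

section \<open>Recurrences for the minors of matrix powers\<close>

lemma triangular_power_recurrence:
  fixes U :: "nat \<Rightarrow> nat \<Rightarrow> 'a::comm_ring_1"
  assumes U: "\<And>k l. k < N \<Longrightarrow> l < k \<Longrightarrow> U k l = 0"
    and K: "K \<in> ksubsets {..<N} r" and L: "L \<in> ksubsets {..<N} r"
  shows "recurrence_at (\<Prod>K\<in>ksubsets {..<N} r. [:- (\<Prod>k\<in>K. U k k), 1:])
    (\<lambda>k. minor (prod_mat {..<N} (\<lambda>_. U) 0 k) K L) k"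
proof -
  let ?K = "ksubsets {..<N} r"
  define F where "F L k = minor (prod_mat {..<N} (\<lambda>_. U) 0 k) K L" for L k
  define D where "D = minor U"
  have tri: "D i j = (if i = j then \<Prod>k\<in>i. U k k else if \<Sum>i < \<Sum>j then D i j else 0)"
    if ij: "i \<in> ?K" "j \<in> ?K" for i j
  proof -
    have "finite i" "card i = r" "finite j" "card j = r"
      using ij by (auto simp: ksubsets_def intro: finite_subset)
    then show ?thesis unfolding D_def
      by (rule minor_triangular) (use ij U in \<open>auto simp: ksubsets_def\<close>)
  qed
  have diag: "D i i = (\<Prod>k\<in>i. U k k)" if "i \<in> ?K" for i
    using tri[OF that that] by simp
  have "recurrence_at (\<Prod>i\<in>?K. [:- D i i, 1:]) (F L) k"
  proof (rule recurrence_at_triangular[where D = D and rk = Sum])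
    show "i = j \<or> \<Sum>i < \<Sum>j" if "i \<in> ?K" "j \<in> ?K" "D i j \<noteq> 0" for i j
      using tri[OF that(1,2)] that(3) by presburger
    have cK: "card K = r" using K by (simp add: ksubsets_def)
    show "F j (Suc k) = (\<Sum>i\<in>?K. F i k * D i j)" for j k
      unfolding F_def D_def prod_mat.simps by (rule cauchy_binet[OF _ cK]) simp
  qed (simp_all add: L)
  moreover have "(\<Prod>i\<in>?K. [:- D i i, 1:]) = (\<Prod>K\<in>?K. [:- (\<Prod>k\<in>K. U k k), 1:])"
    by (rule prod.cong) (simp_all add: diag)
  ultimately show ?thesis by (simp add: F_def[abs_def])
qed

text \<open>The numbers \<open>u k\<close> are the eigenvalues, read from the diagonal of a
  triangular form. The first claim expresses the sums of principal minors by them, and thereby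
  identifies them with the roots of the network polynomial; the second is the recurrence whose roots
  are the products of \<open>r\<close> of them. Both need the same \<open>u\<close>, hence the joint
  statement.\<close>

theorem compound_recurrence:
  fixes A :: "'i::linorder \<Rightarrow> 'i \<Rightarrow> 'a::alg_closed_field"
  assumes J: "finite J"
  shows "\<exists>u. \<forall>r.
     (\<Sum>S\<in>ksubsets J r. minor A S S) = (\<Sum>K\<in>ksubsets {..<card J} r. \<Prod>k\<in>K. u k) \<and>
     (\<forall>S\<in>ksubsets J r. \<forall>S'\<in>ksubsets J r. \<forall>k.
        recurrence_at (\<Prod>K\<in>ksubsets {..<card J} r. [:- (\<Prod>k\<in>K. u k), 1:])
          (\<lambda>k. minor (prod_mat J (\<lambda>_. A) 0 k) S S') k)"
proof -
  define N where "N = card J"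
  obtain P Q U where tri:
    "(\<forall>k<N. \<forall>l<N. mm J Q P k l = delta k l) \<and> (\<forall>i\<in>J. \<forall>j\<in>J. mm {..<N} P Q i j = delta i j) \<and>
     (\<forall>i\<in>J. \<forall>l<N. mm J A P i l = mm {..<N} P U i l) \<and> (\<forall>k<N. \<forall>l<k. U k l = (0::'a))"
    using triangular_form[OF J N_def[symmetric], of A] by (elim exE)
  note QP = tri[THEN conjunct1, rule_format] and PQ = tri[THEN conjunct2, THEN conjunct1, rule_format]
    and AP = tri[THEN conjunct2, THEN conjunct2, THEN conjunct1, rule_format]
    and U0 = tri[THEN conjunct2, THEN conjunct2, THEN conjunct2, rule_format]
  let ?N = "{..<N}"
  let ?U = "\<lambda>k. prod_mat ?N (\<lambda>_. U) 0 k"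
  let ?K = "ksubsets ?N"
  have pow: "prod_mat J (\<lambda>_. A) 0 k i j = mm ?N (mm ?N P (?U k)) Q i j"
    if "i \<in> J" "j \<in> J" for i j k
    using that(2)
  proof (induction k arbitrary: j)
    case 0
    have "mm ?N (mm ?N P delta) Q i j = mm ?N P Q i j"
      by (rule mm_cong) (simp_all add: mm_one_right)
    then show ?case using PQ[OF that(1) 0] by simp
  next
    case (Suc k)
    have A: "A l j = mm ?N (mm J A P) Q l j" if "l \<in> J" for l
    proof -
      have "mm ?N (mm J A P) Q l j = mm J A (mm ?N P Q) l j" by (simp add: mm_assoc)
      also have "\<dots> = mm J A delta l j" by (rule mm_cong) (use PQ Suc.prems in auto)
      also have "\<dots> = A l j" by (rule mm_one_right[OF J Suc.prems])
      finally show ?thesis by simp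
    qed
    have "prod_mat J (\<lambda>_. A) 0 (Suc k) i j = mm J (mm ?N (mm ?N P (?U k)) Q) (mm ?N (mm ?N P U) Q) i j"
    proof -
      have "mm ?N (mm J A P) Q l j = mm ?N (mm ?N P U) Q l j" if "l \<in> J" for l
        by (rule mm_cong) (use AP that in auto)
      then show ?thesis using Suc.IH A by (auto intro!: mm_cong)
    qed
    also have "\<dots> = mm ?N (mm ?N P (?U k)) (mm ?N (mm J Q P) (mm ?N U Q)) i j"
      by (simp only: mm_assoc)
    also have "\<dots> = mm ?N (mm ?N P (?U k)) (mm ?N U Q) i j"
    proof (rule mm_cong)
      fix l assume "l \<in> ?N"
      have "mm ?N (mm J Q P) (mm ?N U Q) l j = mm ?N delta (mm ?N U Q) l j"
        by (rule mm_cong) (use QP \<open>l \<in> ?N\<close> in auto)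
      then show "mm ?N (mm J Q P) (mm ?N U Q) l j = mm ?N U Q l j"
        using mm_one_left[of ?N l] \<open>l \<in> ?N\<close> by simp
    qed simp
    finally show ?case by (simp add: mm_assoc)
  qed
  have A1: "prod_mat J (\<lambda>_. A) 0 1 i j = A i j" if "i \<in> J" "j \<in> J" for i j
    using mm_one_left[OF J that(1)] by simp
  have cf: "finite S \<and> card S = r" if "S \<in> ksubsets J r" for S r
    using that J by (auto simp: ksubsets_def intro: finite_subset)
  have cfN: "finite S \<and> card S = r" if "S \<in> ?K r" for S r
    using that by (auto simp: ksubsets_def intro: finite_subset)
  have mpow: "minor (prod_mat J (\<lambda>_. A) 0 k) S S' =
      (\<Sum>L\<in>?K r. (\<Sum>K\<in>?K r. minor P S K * minor (?U k) K L) * minor Q L S')"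
    if "S \<in> ksubsets J r" "S' \<in> ksubsets J r" for S S' k r
  proof -
    have "minor (prod_mat J (\<lambda>_. A) 0 k) S S' = minor (mm ?N (mm ?N P (?U k)) Q) S S'"
    proof (rule minor_cong)
      have "S \<subseteq> J" "S' \<subseteq> J" using that by (simp_all add: ksubsets_def)
      then show "prod_mat J (\<lambda>_. A) 0 k s s' = mm ?N (mm ?N P (?U k)) Q s s'" if "s \<in> S" "s' \<in> S'" for s s'
        using pow that by blast
      show "finite S" "finite S'" "card S = card S'" using cf[OF that(1)] cf[OF that(2)] by simp_all
    qed
    also have "\<dots> = (\<Sum>L\<in>?K r. (\<Sum>K\<in>?K r. minor P S K * minor (?U k) K L) * minor Q L S')"
      using cf[OF that(1)] by (simp only: cauchy_binet[OF finite_lessThan])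
    finally show ?thesis .
  qed
  have Utri: "minor U K L = (if K = L then \<Prod>k\<in>K. U k k else if \<Sum>K < \<Sum>L then minor U K L else 0)"
    if "K \<in> ?K r" "L \<in> ?K r" for K L r
  proof (rule minor_triangular)
    show "finite K" "card K = r" "finite L" "card L = r" using cfN[OF that(1)] cfN[OF that(2)] by simp_all
    have "K \<subseteq> ?N" using that by (simp add: ksubsets_def)
    then show "U k l = 0" if "k \<in> K" "l < k" for k l using that U0[of k l] by auto
  qed
  have diag: "minor U K K = (\<Prod>k\<in>K. U k k)" if "K \<in> ?K r" for K r
    using Utri[OF that that] by simp
  have "(\<Sum>S\<in>ksubsets J r. minor A S S) = (\<Sum>K\<in>?K r. \<Prod>k\<in>K. U k k)" for r
  proof -
    \<comment> \<open>The cyclic invariance of the trace: summing over \<open>S\<close> first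
      recombines the minors of \<open>Q\<close> and \<open>P\<close> into a minor of
      \<open>Q P\<close>, which is the identity.\<close>
    have key: "minor (?U 1) K L * (\<Sum>S\<in>ksubsets J r. minor Q L S * minor P S K) =
        minor U K L * (if L = K then 1 else 0)" if LK: "L \<in> ?K r" "K \<in> ?K r" for L K
    proof -
      have fin: "finite L" "card L = r" "finite K" "card K = r" and sub: "L \<subseteq> ?N" "K \<subseteq> ?N"
        using cfN[OF LK(1)] cfN[OF LK(2)] LK by (simp_all add: ksubsets_def)
      have "minor (?U 1) K L = minor U K L"
      proof (rule minor_cong)
        show "?U 1 s s' = U s s'" if "s \<in> K" for s s'
          using mm_one_left[of ?N s U s'] subsetD[OF sub(2) that] by simp
      qed (use fin in simp_all)
      moreover have "(\<Sum>S\<in>ksubsets J r. minor Q L S * minor P S K) = minor (mm J Q P) L K"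
        by (rule cauchy_binet[OF J fin(2), symmetric])
      moreover have "minor (mm J Q P) L K = minor delta L K"
        by (rule minor_cong) (use fin sub QP in auto)
      moreover have "minor (delta :: nat \<Rightarrow> nat \<Rightarrow> 'a) L K = (if L = K then 1 else 0)"
        unfolding delta_def by (rule minor_one) (use fin in auto)
      ultimately show ?thesis by simp
    qed
    have "(\<Sum>S\<in>ksubsets J r. minor A S S) = (\<Sum>S\<in>ksubsets J r. minor (prod_mat J (\<lambda>_. A) 0 1) S S)"
    proof (rule sum.cong[OF refl])
      fix S assume S: "S \<in> ksubsets J r"
      then have "S \<subseteq> J" "finite S" using cf[OF S] by (simp_all add: ksubsets_def)
      then show "minor A S S = minor (prod_mat J (\<lambda>_. A) 0 1) S S"
      proof (intro minor_cong)
        show "A s s' = prod_mat J (\<lambda>_. A) 0 1 s s'" if "s \<in> S" "s' \<in> S" for s s'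
          using A1[of s s'] that \<open>S \<subseteq> J\<close> by (simp only: subset_eq)
      qed simp_all
    qed
    also have "\<dots> = (\<Sum>S\<in>ksubsets J r. \<Sum>L\<in>?K r. \<Sum>K\<in>?K r. minor P S K * minor (?U 1) K L * minor Q L S)"
    proof (rule sum.cong[OF refl])
      fix S assume "S \<in> ksubsets J r"
      from mpow[OF this this, of 1]
      show "minor (prod_mat J (\<lambda>_. A) 0 1) S S =
          (\<Sum>L\<in>?K r. \<Sum>K\<in>?K r. minor P S K * minor (?U 1) K L * minor Q L S)"
        by (simp only: sum_distrib_right)
    qed
    also have "\<dots> = (\<Sum>L\<in>?K r. \<Sum>S\<in>ksubsets J r. \<Sum>K\<in>?K r. minor P S K * minor (?U 1) K L * minor Q L S)"
      by (rule sum.swap)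
    also have "\<dots> = (\<Sum>L\<in>?K r. \<Sum>K\<in>?K r. \<Sum>S\<in>ksubsets J r. minor P S K * minor (?U 1) K L * minor Q L S)"
      by (rule sum.cong[OF refl], rule sum.swap)
    also have "\<dots> = (\<Sum>L\<in>?K r. \<Sum>K\<in>?K r. minor (?U 1) K L * (\<Sum>S\<in>ksubsets J r. minor Q L S * minor P S K))"
      by (rule sum.cong[OF refl], rule sum.cong[OF refl]) (simp add: sum_distrib_left mult_ac del: prod_mat.simps One_nat_def)
    also have "\<dots> = (\<Sum>L\<in>?K r. \<Sum>K\<in>?K r. minor U K L * (if L = K then 1 else 0))"
      by (rule sum.cong[OF refl], rule sum.cong[OF refl], rule key)
    also have "\<dots> = (\<Sum>L\<in>?K r. minor U L L)"
    proof (rule sum.cong)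
      fix L assume "L \<in> ?K r"
      then have "minor U L L = (\<Sum>K\<in>?K r. if L = K then minor U K L else 0)" by simp
      also have "\<dots> = (\<Sum>K\<in>?K r. minor U K L * (if L = K then 1 else 0))"
        by (rule sum.cong) simp_all
      finally show "(\<Sum>K\<in>?K r. minor U K L * (if L = K then 1 else 0)) = minor U L L" by simp
    qed simp
    also have "\<dots> = (\<Sum>K\<in>?K r. \<Prod>k\<in>K. U k k)"
      by (rule sum.cong[OF refl], rule diag)
    finally show ?thesis .
  qed
  moreover have "recurrence_at (\<Prod>K\<in>?K r. [:- (\<Prod>k\<in>K. U k k), 1:])
          (\<lambda>k. minor (prod_mat J (\<lambda>_. A) 0 k) S S') k"
    if S: "S \<in> ksubsets J r" "S' \<in> ksubsets J r" for S S' k r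
  proof -
    have U': "recurrence_at (\<Prod>K\<in>?K r. [:- (\<Prod>k\<in>K. U k k), 1:]) (\<lambda>k. minor (?U k) K L) k"
      if "K \<in> ?K r" "L \<in> ?K r" for K L k
      by (rule triangular_power_recurrence) (use that U0 in simp_all)
    have "recurrence_at (\<Prod>K\<in>?K r. [:- (\<Prod>k\<in>K. U k k), 1:])
        (\<lambda>k. \<Sum>L\<in>?K r. minor Q L S' * (\<Sum>K\<in>?K r. minor P S K * minor (?U k) K L)) k"
      by (intro recurrence_at_linear U') auto
    then show ?thesis unfolding mpow[OF S] by (simp only: mult.commute[of _ "minor Q _ S'"])
  qed
  ultimately show ?thesis unfolding N_def[symmetric]
    by (intro exI[of _ "\<lambda>k. U k k"] allI conjI ballI) simp_all
qed

section \<open>The column matrices\<close>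

text \<open>
  \<open>col_mat u v E x s s'\<close> weighs the step from height \<open>s\<close> in column \<open>x - 1\<close> to height \<open>s'\<close> in column \<open>x\<close>.
  If \<open>x + s\<close> is odd, then \<open>(x - 1, s)\<close> is not a vertex of the network and the step is the second
  half of a horizontal edge, whose weight is counted here. \<open>v\<close> plays the role of \<open>1 / u\<close>.
\<close>

definition col_mat ::
    "(int \<Rightarrow> int \<Rightarrow> 'a::comm_ring_1) \<Rightarrow> (int \<Rightarrow> int \<Rightarrow> 'a) \<Rightarrow> (int \<Rightarrow> int \<Rightarrow> bool) \<Rightarrow> int \<Rightarrow> int \<Rightarrow> int \<Rightarrow> 'a" where
  "col_mat u v E x s s' =
     (if odd (x + s) then
        if s' = s then u (x + 1) (s + 1) * u (x + 1) s * (v x s * v x (s + 1)) else 0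
      else if s' = s then 1
      else if s' = s + 1 \<and> E x s' then u (x + 1) (s' + 1) * v x s'
      else if s' = s - 1 \<and> E x s then u (x + 1) s' * v x (s' + 1)
      else 0)"

text \<open>What remains of a nonzero entry of a column matrix when weights and the predicate
  \<open>E\<close> are forgotten.\<close>

definition path_step :: "int \<Rightarrow> int \<Rightarrow> int \<Rightarrow> bool" where
  "path_step x s s' \<longleftrightarrow> (if odd (x + s) then s' = s else \<bar>s' - s\<bar> \<le> 1)"

text \<open>Steps change the height by at most one, so the only conceivable crossing exchanges
  adjacent heights \<open>s\<close> and \<open>s + 1\<close>. One of them has an odd sum with
  \<open>x\<close> and must go straight.\<close>

lemma path_step_noncrossing:
  assumes st: "path_step x s t" "path_step x s' t'" and "s < s'" "t \<noteq> t'"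
  shows "t < t'"
proof (rule ccontr)
  assume "\<not> t < t'"
  moreover have "\<bar>t - s\<bar> \<le> 1" "\<bar>t' - s'\<bar> \<le> 1" using st by (auto simp: path_step_def split: if_splits)
  ultimately have "t = s + 1" "t' = s" "s' = s + 1" using assms(3,4) by linarith+
  then show False using st by (auto simp: path_step_def split: if_splits)
qed

lemma col_mat_nonzero: "col_mat u v E x s s' \<noteq> 0 \<Longrightarrow> path_step x s s'"
  by (auto simp: col_mat_def path_step_def split: if_splits)

lemma col_mat_noncrossing:
  assumes "s < s'" "t' < t"
  shows "col_mat u v E x s t * col_mat u v E x s' t' = 0"
proof (rule ccontr)
  assume "\<not> ?thesis"
  then have "col_mat u v E x s t \<noteq> 0" "col_mat u v E x s' t' \<noteq> 0" by auto
  then have "path_step x s t" "path_step x s' t'" using col_mat_nonzero by fast+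
  from path_step_noncrossing[OF this assms(1)] assms(2) show False by simp
qed

lemma minor_col_mat:
  assumes "finite S" "finite S'" "card S = card S'"
  shows "minor (col_mat u v E x) S S' = (\<Prod>k<card S. col_mat u v E x (nth_elem S k) (nth_elem S' k))"
  by (rule minor_noncrossing) (use assms col_mat_noncrossing in \<open>simp_all\<close>)

definition strip_mat :: "int \<Rightarrow> int \<Rightarrow> int \<Rightarrow> int \<Rightarrow> int \<Rightarrow> laurent" where
  "strip_mat n m = col_mat (w n m) (w_inv n m) (\<lambda>x y. 0 < y \<and> y < m)"

lemma w_pow_periodic: "w_pow n m (i + 2 * n * k) j e = w_pow n m i j e"
  by (simp add: w_pow_def)

lemma strip_mat_periodic: "strip_mat n m (x + 2 * n * k) = strip_mat n m x"
proof -
  have *: "x + 2 * n * k + 1 = (x + 1) + 2 * n * k" by simp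
  have "odd (x + 2 * n * k + s) = odd (x + s)" for s by simp
  then show ?thesis unfolding strip_mat_def col_mat_def fun_eq_iff * w_pow_periodic by simp
qed

section \<open>Closed paths and simple cycles\<close>

text \<open>A path has a height in every column, also where a horizontal edge skips a vertex, so
  disjoint paths can be compared column by column. The period is one turn, so winding number 1 is
  built in; that all simple cycles are of this kind is shown in
  \<open>simple_cycle_is_path_cycle\<close>.\<close>

definition closed_paths :: "int \<Rightarrow> int \<Rightarrow> (int \<Rightarrow> int) set" where
  "closed_paths n m = {y. (\<forall>x. 0 \<le> y x \<and> y x < m) \<and> (\<forall>x. path_step x (y (x - 1)) (y x)) \<and>
     (\<forall>x. y (x + 2 * n) = y x)}"

text \<open>The closed path \<open>y\<close> is at height \<open>y x\<close> in column \<open>x\<close>, and visits the vertex \<open>(x, y x)\<close> if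
  \<open>x + y x\<close> is odd. In this case \<open>in_edge y x\<close> is the edge by which it arrives there.\<close>

definition in_edge :: "(int \<Rightarrow> int) \<Rightarrow> int \<Rightarrow> edge" where
  "in_edge y x = (if y (x - 1) = y x then (x - 2, y x) else (x - 1, y (x - 1)), (x, y x))"

definition path_cycle :: "int \<Rightarrow> (int \<Rightarrow> int) \<Rightarrow> edge set" where
  "path_cycle n y = (\<lambda>x. edge_proj n (in_edge y x)) ` {x. odd (x + y x)}"

section \<open>Passing between the strip and the cylinder\<close>

lemma periodic_shift:
  assumes "\<And>x. y (x + 2 * n) = y (x::int)"
  shows "y (x + 2 * n * k) = y x"
proof (induction k rule: int_induct[where k = 0])
  case (step1 k)
  then show ?case using assms[of "x + 2 * n * k"] by (simp add: algebra_simps)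
next
  case (step2 k)
  then show ?case using assms[of "x + 2 * n * (k - 1)"] by (simp add: algebra_simps)
qed simp

lemma periodic_mod:
  assumes "\<And>x. y (x + 2 * n) = y (x::int)"
  shows "y (x mod (2 * n)) = y x"
proof -
  have "y (x mod (2 * n) + 2 * n * (x div (2 * n))) = y (x mod (2 * n))"
    by (rule periodic_shift) (rule assms)
  then show ?thesis by (simp only: mod_mult_div_eq)
qed

lemma edge_proj_shift:
  assumes "n \<ge> 1"
  shows "edge_proj n ((a + 2 * n * k, b), (a' + 2 * n * k, b')) = edge_proj n ((a, b), (a', b'))"
  using assms by (simp add: edge_proj_def shift_def Let_def algebra_simps)

lemma edge_proj_eq:
  "edge_proj n ((a, b), (a', b')) = ((a mod (2 * n), b), (a' - 2 * n * (a div (2 * n)), b'))"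
  by (simp add: edge_proj_def shift_def Let_def minus_div_mult_eq_mod[symmetric] minus_mult_div_eq_mod)

lemma vert_proj_snd_edge_proj: "vert_proj n (snd (edge_proj n (u, v))) = vert_proj n v"
proof -
  have "(a - 2 * n * k) mod (2 * n) = a mod (2 * n)" for a k :: int
    using mod_mult_self2[of a "2 * n" "- k"] by simp
  then show ?thesis by (cases u; cases v) (simp add: edge_proj_eq vert_proj_def)
qed

lemma fst_edge_proj: "fst (edge_proj n (u, v)) = vert_proj n u"
  by (cases u; cases v) (simp add: edge_proj_eq vert_proj_def)

lemma edge_wt_edge_proj: "edge_wt n m (edge_proj n e) = edge_wt n m e"
proof -
  obtain a b a' b' where e: "e = ((a, b), (a', b'))" by (metis surj_pair)
  define k where "k = - (a div (2 * n))"
  have e': "edge_proj n e = ((a + 2 * n * k, b), (a' + 2 * n * k, b'))"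
    unfolding e k_def by (simp add: edge_proj_def shift_def Let_def)
  have *: "a' + 2 * n * k + 1 = (a' + 1) + 2 * n * k" by simp
  show ?thesis unfolding e' unfolding e edge_wt_def prod.case * w_pow_periodic by simp
qed

lemma cover_verts_iff: "(i, j) \<in> cover_verts m \<longleftrightarrow> odd (i + j) \<and> 0 \<le> j \<and> j < m"
proof -
  have "rect i j (i + 1) (j + 1) \<subseteq> strip m \<longleftrightarrow> 0 \<le> j \<and> j < m"
  proof
    assume *: "rect i j (i + 1) (j + 1) \<subseteq> strip m"
    have "(real_of_int i, real_of_int j) \<in> rect i j (i + 1) (j + 1)"
      "(real_of_int i, real_of_int (j + 1)) \<in> rect i j (i + 1) (j + 1)" by (simp_all add: rect_def)
    with * have "(real_of_int i, real_of_int j) \<in> strip m" "(real_of_int i, real_of_int (j + 1)) \<in> strip m" by blast+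
    then have "real_of_int 0 \<le> real_of_int j" "real_of_int (j + 1) \<le> real_of_int m" by (simp_all add: strip_def)
    then show "0 \<le> j \<and> j < m" by (simp only: of_int_le_iff) simp
  next
    assume "0 \<le> j \<and> j < m"
    then have "real_of_int 0 \<le> real_of_int j" "real_of_int (j + 1) \<le> real_of_int m" by (simp_all only: of_int_le_iff) simp_all
    then show "rect i j (i + 1) (j + 1) \<subseteq> strip m" by (auto simp: rect_def strip_def)
  qed
  then show ?thesis by (simp add: cover_verts_def)
qed

lemma cover_edges_iff:
  "((a, b), (a', b')) \<in> cover_edges m \<longleftrightarrow>
     odd (a + b) \<and> 0 \<le> b \<and> b < m \<and> 0 \<le> b' \<and> b' < m \<and>
     (a' = a + 1 \<and> \<bar>b' - b\<bar> = 1 \<or> a' = a + 2 \<and> b' = b)"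
proof -
  have "\<bar>b' - b\<bar> = 1 \<longleftrightarrow> b' = b + 1 \<or> b' = b - 1" by auto
  then show ?thesis by (auto simp: cover_edges_def cover_verts_iff)
qed

section \<open>The vertices and edges of a closed path\<close>

context
  fixes n m :: int and y :: "int \<Rightarrow> int"
  assumes n: "n \<ge> 1" and y: "y \<in> closed_paths n m"
begin

lemma path_props:
  "0 \<le> y x" "y x < m" "path_step x (y (x - 1)) (y x)" "y (x + 2 * n) = y x"
  using y by (auto simp: closed_paths_def)

lemma path_step_Suc: "path_step (x + 1) (y x) (y (x + 1))"
  using path_props(3)[of "x + 1"] by simp

lemma unvisited_next: "even (x + y x) \<Longrightarrow> y (x + 1) = y x \<and> odd (x + 1 + y (x + 1))"
  using path_step_Suc[of x] by (auto simp: path_step_def split: if_splits)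

lemma unvisited_prev:
  assumes x: "even (x + y x)"
  shows "y (x - 1) = y x"
proof -
  have "y (x - 1) = y x \<or> y (x - 1) = y x + 1 \<or> y (x - 1) = y x - 1"
    using path_props(3)[of x] by (auto simp: path_step_def split: if_splits)
  then show ?thesis
    using path_props(3)[of x] x by (elim disjE) (auto simp: path_step_def split: if_splits)
qed

text \<open>A straight step out of a vertex is the first half of a horizontal edge, and parity
  forces the second half.\<close>

lemma visited_straight:
  assumes "odd (x + y x)" "y (x + 1) = y x"
  shows "y (x + 2) = y x" "odd (x + 2 + y (x + 2))" "in_edge y (x + 2) = ((x, y x), (x + 2, y (x + 2)))"
proof -
  have "even (x + 1 + y (x + 1))" using assms by simp
  then have "y (x + 1 + 1) = y (x + 1) \<and> odd (x + 1 + 1 + y (x + 1 + 1))" by (rule unvisited_next)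
  moreover have e: "x + 1 + 1 = x + 2" by simp
  ultimately have *: "y (x + 2) = y (x + 1)" "odd (x + 2 + y (x + 2))" unfolding e by blast+
  show "y (x + 2) = y x" using *(1) assms(2) by (rule trans)
  show "odd (x + 2 + y (x + 2))" by (rule *(2))
  show "in_edge y (x + 2) = ((x, y x), (x + 2, y (x + 2)))"
    using \<open>y (x + 2) = y x\<close> assms(2) by (simp add: in_edge_def add.commute[of 1])
qed

lemma visited_turn:
  assumes "odd (x + y x)" "y (x + 1) \<noteq> y x"
  shows "\<bar>y (x + 1) - y x\<bar> = 1" "odd (x + 1 + y (x + 1))" "in_edge y (x + 1) = ((x, y x), (x + 1, y (x + 1)))"
proof -
  have "y (x + 1) = y x + 1 \<or> y (x + 1) = y x - 1"
    using path_step_Suc[of x] assms by (auto simp: path_step_def split: if_splits)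
  then show "\<bar>y (x + 1) - y x\<bar> = 1" "odd (x + 1 + y (x + 1))" using assms(1) by auto
  show "in_edge y (x + 1) = ((x, y x), (x + 1, y (x + 1)))" using assms(2) by (simp add: in_edge_def)
qed

lemma in_edge_start:
  assumes "odd (x + y x)"
  shows "\<exists>x'. fst (in_edge y x) = (x', y x') \<and> odd (x' + y x')"
proof (cases "y (x - 1) = y x")
  case True
  then have "even (x - 1 + y (x - 1))" using assms by simp
  then have "y (x - 2) = y x" using unvisited_prev[of "x - 1"] True by simp
  then show ?thesis using True assms by (intro exI[of _ "x - 2"]) (simp add: in_edge_def)
next
  case False
  then have "odd (x - 1 + y (x - 1))"
    using path_props(3)[of x] assms unfolding path_step_def by (auto split: if_splits)
  then show ?thesis using False by (intro exI[of _ "x - 1"]) (simp add: in_edge_def)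
qed

lemma in_edge_cover:
  assumes "odd (x + y x)"
  shows "in_edge y x \<in> cover_edges m"
proof -
  obtain x' where x': "fst (in_edge y x) = (x', y x')" "odd (x' + y x')" using in_edge_start[OF assms] by blast
  have "x' = x - 2 \<and> y x' = y x \<or> x' = x - 1 \<and> \<bar>y x - y x'\<bar> = 1"
    using x' path_props(3)[of x] unfolding in_edge_def path_step_def by (auto split: if_splits)
  moreover have "in_edge y x = ((x', y x'), (x, y x))" using x' by (simp add: in_edge_def split: if_splits)
  ultimately show ?thesis using path_props(1,2)[of x] path_props(1,2)[of x'] x'(2) by (auto simp: cover_edges_iff)
qed

lemma in_edge_shift: "edge_proj n (in_edge y (x + 2 * n * k)) = edge_proj n (in_edge y x)"
proof -
  have p: "y (x + 2 * n * k) = y x" "y (x + 2 * n * k - 1) = y (x - 1)" for x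
    using periodic_shift[of y n, OF path_props(4)] periodic_shift[of y n "x - 1", OF path_props(4)]
    by (auto simp: algebra_simps)
  have *: "x + 2 * n * k - a = (x - a) + 2 * n * k" for a by simp
  show ?thesis
  proof (cases "y (x - 1) = y x")
    case True
    then have "in_edge y (x + 2 * n * k) = ((x - 2 + 2 * n * k, y x), (x + 2 * n * k, y x))"
      "in_edge y x = ((x - 2, y x), (x, y x))" by (simp_all add: in_edge_def p)
    then show ?thesis by (simp only: edge_proj_shift[OF n])
  next
    case False
    then have "in_edge y (x + 2 * n * k) = ((x - 1 + 2 * n * k, y (x - 1)), (x + 2 * n * k, y x))"
      "in_edge y x = ((x - 1, y (x - 1)), (x, y x))" by (simp_all add: in_edge_def p)
    then show ?thesis by (simp only: edge_proj_shift[OF n])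
  qed
qed

text \<open>The window starts at an arbitrary column because the weight is computed from column 0
  and the traversal begins just after a visited column.\<close>

lemma path_cycle_window:
  "path_cycle n y = (\<lambda>x. edge_proj n (in_edge y x)) ` {x \<in> {a..<a + 2 * n}. odd (x + y x)}"
proof -
  have "\<exists>z\<in>{z \<in> {a..<a + 2 * n}. odd (z + y z)}. edge_proj n (in_edge y x) = edge_proj n (in_edge y z)"
    if x: "odd (x + y x)" for x
  proof -
    define q where "q = (x - a) div (2 * n)"
    define z where "z = a + (x - a) mod (2 * n)"
    have xz: "x = z + 2 * n * q"
      using mult_div_mod_eq[of "2 * n" "x - a"] unfolding q_def z_def by linarith
    have "y x = y z" unfolding xz by (rule periodic_shift[of y n, OF path_props(4)])
    then have "odd (z + y z)" using x xz by simp
    moreover have "z \<in> {a..<a + 2 * n}" using n by (simp add: z_def)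
    ultimately show ?thesis using in_edge_shift[of z q] xz by blast
  qed
  then have "path_cycle n y \<subseteq> (\<lambda>x. edge_proj n (in_edge y x)) ` {x \<in> {a..<a + 2 * n}. odd (x + y x)}"
    unfolding path_cycle_def by (intro image_subsetI) (simp only: mem_Collect_eq image_iff)
  moreover have "(\<lambda>x. edge_proj n (in_edge y x)) ` {x \<in> {a..<a + 2 * n}. odd (x + y x)} \<subseteq> path_cycle n y"
    unfolding path_cycle_def by (rule image_mono) blast
  ultimately show ?thesis by (rule equalityI)
qed

lemma cycle_verts_path_cycle:
  "cycle_verts (path_cycle n y) = (\<lambda>x. vert_proj n (x, y x)) ` {x. odd (x + y x)}"
proof
  show "cycle_verts (path_cycle n y) \<subseteq> (\<lambda>x. vert_proj n (x, y x)) ` {x. odd (x + y x)}"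
  proof
    fix p assume "p \<in> cycle_verts (path_cycle n y)"
    then obtain x where x: "odd (x + y x)" "p = fst (edge_proj n (in_edge y x))"
      unfolding cycle_verts_def path_cycle_def image_image by blast
    obtain x' where x': "fst (in_edge y x) = (x', y x')" "odd (x' + y x')" using in_edge_start[OF x(1)] by blast
    have "p = vert_proj n (fst (in_edge y x))"
      using x(2) by (cases "in_edge y x") (simp add: fst_edge_proj)
    then have "p = vert_proj n (x', y x')" using x'(1) by simp
    then show "p \<in> (\<lambda>x. vert_proj n (x, y x)) ` {x. odd (x + y x)}"
      using x'(2) by blast
  qed
  show "(\<lambda>x. vert_proj n (x, y x)) ` {x. odd (x + y x)} \<subseteq> cycle_verts (path_cycle n y)"
  proof (rule image_subsetI)
    fix x assume "x \<in> {x. odd (x + y x)}"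
    then have x: "odd (x + y x)" by simp
    have "\<exists>z. odd (z + y z) \<and> in_edge y z = ((x, y x), (z, y z))"
    proof (cases "y (x + 1) = y x")
      case True
      then show ?thesis using visited_straight(2,3)[OF x] by (intro exI[of _ "x + 2"] conjI)
    next
      case False
      then show ?thesis using visited_turn(2,3)[OF x] by (intro exI[of _ "x + 1"] conjI)
    qed
    then obtain z where "odd (z + y z)" "in_edge y z = ((x, y x), (z, y z))" by blast
    then have "edge_proj n ((x, y x), (z, y z)) \<in> path_cycle n y"
      unfolding path_cycle_def by (intro image_eqI[of _ _ z]) simp_all
    then show "vert_proj n (x, y x) \<in> cycle_verts (path_cycle n y)"
      unfolding cycle_verts_def by (intro image_eqI[of _ _ "edge_proj n ((x, y x), (z, y z))"]) (simp_all add: fst_edge_proj)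
  qed
qed

text \<open>A visited column carries the weight of the edge arriving there; an unvisited one lies in
  the middle of a horizontal edge and carries 1.\<close>

lemma cycle_wt_path_cycle:
  "cycle_wt n m (path_cycle n y) = (\<Prod>x\<in>{0..<2 * n}. strip_mat n m x (y (x - 1)) (y x))"
proof -
  let ?V = "{x \<in> {0..<2 * n}. odd (x + y x)}"
  have inj: "inj_on (\<lambda>x. edge_proj n (in_edge y x)) ?V"
  proof (rule inj_onI)
    fix x x' assume x: "x \<in> ?V" "x' \<in> ?V" and eq: "edge_proj n (in_edge y x) = edge_proj n (in_edge y x')"
    have "vert_proj n (x, y x) = vert_proj n (x', y x')"
      using eq vert_proj_snd_edge_proj[of n "fst (in_edge y x)" "(x, y x)"]
        vert_proj_snd_edge_proj[of n "fst (in_edge y x')" "(x', y x')"]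
      by (simp add: in_edge_def)
    then show "x = x'" using x by (simp add: vert_proj_def)
  qed
  have wt: "edge_wt n m (in_edge y x) = strip_mat n m x (y (x - 1)) (y x)" if "odd (x + y x)" for x
  proof (cases "y (x - 1) = y x")
    case True
    then show ?thesis using that by (simp add: in_edge_def edge_wt_def strip_mat_def col_mat_def)
  next
    case False
    have "even (x + y (x - 1))" "y x = y (x - 1) + 1 \<or> y x = y (x - 1) - 1"
      using False path_props(3)[of x] by (auto simp: path_step_def split: if_splits)
    then show ?thesis
      using False path_props(1,2)[of x] path_props(1,2)[of "x - 1"]
      by (auto simp: in_edge_def edge_wt_def strip_mat_def col_mat_def)
  qed
  have one: "strip_mat n m x (y (x - 1)) (y x) = 1" if "even (x + y x)" for x
    using unvisited_prev[OF that] that by (simp add: strip_mat_def col_mat_def)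
  have 1: "cycle_wt n m (path_cycle n y) = (\<Prod>x\<in>?V. edge_wt n m (edge_proj n (in_edge y x)))"
    unfolding cycle_wt_def path_cycle_window[of 0, unfolded add_0_left] by (rule prod.reindex[OF inj, unfolded o_def])
  have 2: "(\<Prod>x\<in>?V. edge_wt n m (edge_proj n (in_edge y x))) =
      (\<Prod>x\<in>?V. strip_mat n m x (y (x - 1)) (y x))"
    by (rule prod.cong) (simp_all add: edge_wt_edge_proj wt)
  have 3: "(\<Prod>x\<in>?V. strip_mat n m x (y (x - 1)) (y x)) =
      (\<Prod>x\<in>{0..<2 * n}. strip_mat n m x (y (x - 1)) (y x))"
    by (rule prod.mono_neutral_left) (use one in auto)
  show ?thesis unfolding 1 2 3 ..
qed

end

section \<open>Going once around a closed path\<close>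

context
  fixes n m :: int and y :: "int \<Rightarrow> int"
  assumes n: "n \<ge> 1" and y: "y \<in> closed_paths n m"
begin

definition next_col :: "int \<Rightarrow> int" where
  "next_col x = (if y (x + 1) = y x then x + 2 else x + 1)"

lemma next_col_visited:
  assumes "odd (x + y x)"
  shows "odd (next_col x + y (next_col x))" "in_edge y (next_col x) = ((x, y x), (next_col x, y (next_col x)))"
proof -
  show "odd (next_col x + y (next_col x))"
    using visited_straight(2)[OF n y assms] visited_turn(2)[OF n y assms] unfolding next_col_def by presburger
  show "in_edge y (next_col x) = ((x, y x), (next_col x, y (next_col x)))"
  proof (cases "y (x + 1) = y x")
    case True
    then have "next_col x = x + 2" by (simp add: next_col_def)
    then show ?thesis using visited_straight(3)[OF n y assms True] by (simp only:)
  next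
    case False
    then have "next_col x = x + 1" by (simp add: next_col_def)
    then show ?thesis using visited_turn(3)[OF n y assms False] by (simp only:)
  qed
qed

lemma next_col_bounds: "x < next_col x" "next_col x \<le> x + 2"
  by (simp_all add: next_col_def)

lemma next_col_least:
  assumes "odd (x + y x)" "x < z" "z < next_col x"
  shows "even (z + y z)"
proof -
  have "z = x + 1" "y (x + 1) = y x" using assms by (auto simp: next_col_def split: if_splits)
  then show ?thesis using assms(1) by simp
qed

text \<open>Iterating \<open>next_col\<close> from a visited column skips no visited column. By
  periodicity, one of those reached is the starting column shifted by one turn; its index is
  \<open>p\<close>.\<close>

lemma path_traversal:
  obtains g p where "\<And>k. odd (g k + y (g k))" "strict_mono g" "0 < p" "g p = g 0 + 2 * n"
    "\<And>k. in_edge y (g (Suc k)) = ((g k, y (g k)), (g (Suc k), y (g (Suc k))))"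
    "\<And>x. odd (x + y x) \<Longrightarrow> g 0 \<le> x \<Longrightarrow> \<exists>k. x = g k"
proof -
  obtain x0 where x0: "odd (x0 + y x0)" using unvisited_next[OF n y, of 0] by blast
  define g where "g k = (next_col ^^ k) x0" for k
  have g_Suc: "g (Suc k) = next_col (g k)" for k by (simp add: g_def)
  have vis: "odd (g k + y (g k))" for k
  proof (induction k)
    case 0
    then show ?case using x0 by (simp add: g_def)
  next
    case (Suc k)
    then show ?case unfolding g_Suc by (rule next_col_visited(1))
  qed
  have mono: "strict_mono g"
    using next_col_bounds(1) by (intro strict_monoI_Suc) (simp add: g_Suc)
  have all: "\<exists>k. x = g k" if x: "odd (x + y x)" "g 0 \<le> x" for x
  proof -
    have "\<exists>k. x = g k \<or> (\<exists>k. x = g k)" if "x < g k" for k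
      using that
    proof (induction k)
      case (Suc k)
      consider "x < g k" | "x = g k" | "g k < x" by linarith
      then show ?case
      proof cases
        case 3
        then have "even (x + y x)" using next_col_least[OF vis[of k], of x] Suc.prems by (simp only: g_Suc)
        then show ?thesis using x by simp
      qed (use Suc.IH in blast)+
    qed (use x in simp)
    moreover have "g 0 + int k \<le> g k" for k
    proof (induction k)
      case (Suc k)
      then show ?case using next_col_bounds(1)[of "g k"] by (simp add: g_Suc)
    qed simp
    then have "x < g (nat (x - g 0 + 1))"
      by (rule order.strict_trans2[rotated]) (use x(2) in simp)
    ultimately show ?thesis by blast
  qed
  have per: "y (g 0 + 2 * n) = y (g 0)" by (rule path_props(4)[OF n y])
  have "odd (g 0 + 2 * n + y (g 0 + 2 * n))" unfolding per using vis[of 0] by simp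
  then obtain p where p: "g 0 + 2 * n = g p" using all n by fastforce
  have "p \<noteq> 0" using p n by (intro notI) simp
  show thesis
  proof (rule that[of g p])
    show "in_edge y (g (Suc k)) = ((g k, y (g k)), (g (Suc k), y (g (Suc k))))" for k
      unfolding g_Suc by (rule next_col_visited(2)[OF vis])
  qed (use vis mono all p \<open>p \<noteq> 0\<close> in simp_all)
qed

lemma path_cycle_properties:
  "\<exists>es p. is_cycle n m es \<and> set es = path_cycle n y \<and> is_lift n m p es \<and> last p = shift n 1 (hd p)"
proof -
  obtain g p where vis: "\<And>k. odd (g k + y (g k))" and mono: "strict_mono g" and p: "0 < p" "g p = g 0 + 2 * n"
    and edge: "\<And>k. in_edge y (g (Suc k)) = ((g k, y (g k)), (g (Suc k), y (g (Suc k))))"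
    and all: "\<And>x. odd (x + y x) \<Longrightarrow> g 0 \<le> x \<Longrightarrow> \<exists>k. x = g k"
    using path_traversal by metis
  have per: "y (g 0 + 2 * n) = y (g 0)" by (rule path_props(4)[OF n y])
  define v where "v k = (g k, y (g k))" for k
  define e where "e k = edge_proj n (in_edge y (g (Suc k)))" for k
  define es where "es = map e [0..<p]"
  define vs where "vs = map v [0..<Suc p]"
  have e: "e k = edge_proj n (v k, v (Suc k))" for k unfolding e_def v_def edge ..
  have len: "length es = p" "\<And>k. k < p \<Longrightarrow> es ! k = e k" by (simp_all add: es_def)
  have bnd: "g 0 \<le> g k \<and> g k < g 0 + 2 * n" if "k < p" for k
    using strict_mono_less_eq[OF mono, of 0 k] strict_mono_less[OF mono, of k p] that p by simp
  have fst_e: "fst (e k) = vert_proj n (v k)" for k unfolding e by (rule fst_edge_proj)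
  have set_es: "set es = path_cycle n y"
  proof -
    have "path_cycle n y = (\<lambda>x. edge_proj n (in_edge y x)) ` {x \<in> {g 0 + 1..<g 0 + 1 + 2 * n}. odd (x + y x)}"
      by (rule path_cycle_window[OF n y])
    moreover have "{x \<in> {g 0 + 1..<g 0 + 1 + 2 * n}. odd (x + y x)} = (\<lambda>k. g (Suc k)) ` {..<p}"
    proof (intro equalityI subsetI)
      fix x assume x: "x \<in> {x \<in> {g 0 + 1..<g 0 + 1 + 2 * n}. odd (x + y x)}"
      then obtain k where k: "x = g k" using all[of x] by auto
      have "g 0 < g k" "g k \<le> g p" using x k p by auto
      then have "0 < k" "k \<le> p" using strict_mono_less[OF mono] strict_mono_less_eq[OF mono] by blast+
      then show "x \<in> (\<lambda>k. g (Suc k)) ` {..<p}" using k by (intro image_eqI[of _ _ "k - 1"]) auto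
    next
      fix x assume "x \<in> (\<lambda>k. g (Suc k)) ` {..<p}"
      then obtain k where k: "x = g (Suc k)" "k < p" by auto
      then have "g 0 < x" "x \<le> g p" using strict_mono_less[OF mono] strict_mono_less_eq[OF mono] by simp_all
      then show "x \<in> {x \<in> {g 0 + 1..<g 0 + 1 + 2 * n}. odd (x + y x)}" using vis k p by simp
    qed
    ultimately show ?thesis by (simp add: es_def e_def image_image atLeast0LessThan)
  qed
  have "is_cycle n m es"
    unfolding is_cycle_def
  proof (intro conjI allI impI)
    show "es \<noteq> []" using p by (simp add: es_def)
    show "set es \<subseteq> net_edges n m"
      unfolding set_es path_cycle_def net_edges_def using in_edge_cover[OF n y] by blast
    have inj: "inj_on (\<lambda>k. fst (e k)) {..<p}"
    proof (rule inj_onI)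
      fix k l assume kl: "k \<in> {..<p}" "l \<in> {..<p}" and eq: "fst (e k) = fst (e l)"
      have "g k mod (2 * n) = g l mod (2 * n)" using eq by (simp add: fst_e vert_proj_def v_def)
      then have "2 * n dvd g k - g l" by (simp only: mod_eq_dvd_iff)
      moreover have "\<bar>g k - g l\<bar> < 2 * n" using bnd[of k] bnd[of l] kl by auto
      ultimately have "g k = g l" using dvd_imp_le_int[of "g k - g l" "2 * n"] n by fastforce
      then show "k = l" using strict_mono_eq[OF mono] by blast
    qed
    then show "distinct (map fst es)"
      by (simp add: es_def distinct_map atLeast0LessThan comp_def)
    fix k assume "k < length es"
    then have k: "k < p" using len by simp
    have "vert_proj n (snd (e k)) = vert_proj n (v (Suc k))"
      unfolding e by (rule vert_proj_snd_edge_proj)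
    also have "\<dots> = fst (e (Suc k mod p))"
    proof (cases "Suc k = p")
      case True
      then show ?thesis unfolding fst_e using p per by (simp add: v_def vert_proj_def)
    next
      case False
      then show ?thesis using k by (simp add: fst_e)
    qed
    finally show "vert_proj n (snd (es ! k)) = fst (es ! (Suc k mod length es))" using k p by (simp add: len)
  qed
  moreover have "is_lift n m vs es"
    unfolding is_lift_def
  proof (intro conjI allI impI)
    show "length vs = Suc (length es)" by (simp add: vs_def es_def)
    fix k assume "k < length es"
    then have k: "k < p" using len by simp
    then have vk: "vs ! k = v k" "vs ! Suc k = v (Suc k)" by (simp_all add: vs_def del: upt_Suc)
    show "(vs ! k, vs ! Suc k) \<in> cover_edges m"
      unfolding vk v_def edge[symmetric] by (rule in_edge_cover[OF n y vis])
    show "edge_proj n (vs ! k, vs ! Suc k) = es ! k" unfolding vk len(2)[OF k] e ..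
  qed
  moreover have "last vs = shift n 1 (hd vs)"
  proof -
    have "last vs = v p" by (simp add: vs_def)
    moreover have "hd vs = v 0" by (simp add: vs_def hd_conv_nth del: upt_Suc)
    ultimately show ?thesis using p(2) per by (simp add: v_def shift_def)
  qed
  ultimately show ?thesis using set_es by blast
qed

end

text \<open>Projection preserves the horizontal length of an edge and a simple cycle repeats no
  edge, so the displacement of a lift depends only on the edge set. This gives the uniqueness
  required by the definite description in \<open>wind\<close>.\<close>

lemma lift_displacement:
  assumes n: "n \<ge> 1" and cyc: "is_cycle n m es" and lift: "is_lift n m p es" and last: "last p = shift n l (hd p)"
  shows "2 * n * l = (\<Sum>e\<in>set es. fst (snd e) - fst (fst e))"
proof -
  have len: "length p = Suc (length es)" using lift by (simp add: is_lift_def)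
  have d: "fst (snd (es ! k)) - fst (fst (es ! k)) = fst (p ! Suc k) - fst (p ! k)" if "k < length es" for k
  proof -
    have "es ! k = edge_proj n (p ! k, p ! Suc k)" using lift that by (simp add: is_lift_def)
    then show ?thesis by (cases "p ! k"; cases "p ! Suc k") (simp add: edge_proj_def shift_def Let_def)
  qed
  have "distinct es" using cyc by (simp add: is_cycle_def distinct_map)
  then have "(\<Sum>e\<in>set es. fst (snd e) - fst (fst e)) = (\<Sum>k<length es. fst (snd (es ! k)) - fst (fst (es ! k)))"
    by (simp add: sum.distinct_set_conv_list sum_list_sum_nth atLeast0LessThan)
  also have "\<dots> = (\<Sum>k<length es. fst (p ! Suc k) - fst (p ! k))"
    by (rule sum.cong) (simp_all add: d)
  also have "\<dots> = fst (p ! length es) - fst (p ! 0)" by (rule sum_lessThan_telescope)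
  also have "\<dots> = fst (last p) - fst (hd p)"
    using len by (simp add: last_conv_nth hd_conv_nth flip: length_0_conv)
  also have "\<dots> = 2 * n * l" unfolding last by (cases "hd p") (simp add: shift_def)
  finally show ?thesis by simp
qed

lemma path_cycle_simple:
  assumes "n \<ge> 1" "y \<in> closed_paths n m"
  shows "path_cycle n y \<in> simple_cycles n m" "wind n m (path_cycle n y) = 1"
proof -
  obtain es p where es: "is_cycle n m es" "set es = path_cycle n y" "is_lift n m p es" "last p = shift n 1 (hd p)"
    using path_cycle_properties[OF assms] by blast
  show "path_cycle n y \<in> simple_cycles n m"
    unfolding simple_cycles_def using es(1,2) by blast
  show "wind n m (path_cycle n y) = 1"
    unfolding wind_def
  proof (rule the_equality)
    show "\<exists>es p. is_cycle n m es \<and> set es = path_cycle n y \<and> is_lift n m p es \<and> last p = shift n 1 (hd p)"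
      using es by blast
    fix l assume "\<exists>es p. is_cycle n m es \<and> set es = path_cycle n y \<and> is_lift n m p es \<and> last p = shift n l (hd p)"
    then obtain es' p' where es': "is_cycle n m es'" "set es' = path_cycle n y" "is_lift n m p' es'" "last p' = shift n l (hd p')"
      by blast
    have "2 * n * l = 2 * n * 1"
      using lift_displacement[OF assms(1) es(1,3,4)] lift_displacement[OF assms(1) es'(1,3,4)] es(2) es'(2) by simp
    then show "l = 1" using assms(1) by simp
  qed
qed

text \<open>Two closed paths of equal height in an unvisited column both go straight to the same
  vertex of the next column. Hence sharing a height anywhere amounts to sharing a vertex.\<close>

lemma path_cycle_disjoint_iff:
  assumes n: "n \<ge> 1" and y: "y \<in> closed_paths n m" and z: "z \<in> closed_paths n m"
  shows "cycle_verts (path_cycle n y) \<inter> cycle_verts (path_cycle n z) = {} \<longleftrightarrow> (\<forall>x. y x \<noteq> z x)"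
proof
  assume disj: "cycle_verts (path_cycle n y) \<inter> cycle_verts (path_cycle n z) = {}"
  show "\<forall>x. y x \<noteq> z x"
  proof (intro allI notI)
    fix x assume eq: "y x = z x"
    have no: False if "odd (x + y x)" "y x = z x" for x
    proof -
      have "vert_proj n (x, y x) \<in> cycle_verts (path_cycle n y)"
        unfolding cycle_verts_path_cycle[OF n y] using that(1) by (intro image_eqI[of _ _ x]) simp_all
      moreover have "vert_proj n (x, y x) \<in> cycle_verts (path_cycle n z)"
        unfolding cycle_verts_path_cycle[OF n z] using that by (intro image_eqI[of _ _ x]) simp_all
      ultimately have "vert_proj n (x, y x) \<in> cycle_verts (path_cycle n y) \<inter> cycle_verts (path_cycle n z)"
        by (rule IntI)
      then show False unfolding disj by (rule emptyE)
    qed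
    show False
    proof (cases "odd (x + y x)")
      case True
      then show ?thesis using no eq by blast
    next
      case False
      then have 1: "y (x + 1) = y x" "odd (x + 1 + y (x + 1))" using unvisited_next[OF n y, of x] by blast+
      have 2: "z (x + 1) = z x" using unvisited_next[OF n z, of x] False eq by (simp only:) blast
      show ?thesis by (rule no[OF 1(2)]) (simp only: 1(1) 2 eq)
    qed
  qed
next
  assume neq: "\<forall>x. y x \<noteq> z x"
  show "cycle_verts (path_cycle n y) \<inter> cycle_verts (path_cycle n z) = {}"
  proof (rule ccontr)
    assume "\<not> ?thesis"
    then obtain q where q: "q \<in> cycle_verts (path_cycle n y)" "q \<in> cycle_verts (path_cycle n z)" by blast
    obtain x where x: "q = vert_proj n (x, y x)"
      using q(1) unfolding cycle_verts_path_cycle[OF n y] by (elim imageE)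
    obtain x' where "q = vert_proj n (x', z x')"
      using q(2) unfolding cycle_verts_path_cycle[OF n z] by (elim imageE)
    with x have "vert_proj n (x, y x) = vert_proj n (x', z x')" by simp
    then have "x mod (2 * n) = x' mod (2 * n)" "y x = z x'" by (simp_all add: vert_proj_def)
    moreover have "y (x mod (2 * n)) = y x" by (rule periodic_mod) (rule path_props(4)[OF n y])
    moreover have "z (x' mod (2 * n)) = z x'" by (rule periodic_mod) (rule path_props(4)[OF n z])
    ultimately have "y (x mod (2 * n)) = z (x mod (2 * n))" by simp
    then show False using neq by blast
  qed
qed

text \<open>The vertices of the cycle determine the heights in visited columns, and an unvisited
  column has the height of the visited column before it.\<close>

lemma inj_on_path_cycle:
  assumes n: "n \<ge> 1"
  shows "inj_on (path_cycle n) (closed_paths n m)"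
proof (rule inj_onI)
  fix y z assume y: "y \<in> closed_paths n m" and z: "z \<in> closed_paths n m" and eq: "path_cycle n y = path_cycle n z"
  have agree: "y x = z x" if x: "odd (x + y x)" and y: "y \<in> closed_paths n m" and z: "z \<in> closed_paths n m"
    and eq: "path_cycle n y = path_cycle n z" for x y z
  proof -
    have "vert_proj n (x, y x) \<in> cycle_verts (path_cycle n z)"
      unfolding eq[symmetric] cycle_verts_path_cycle[OF n y] using x by blast
    then obtain x' where "vert_proj n (x, y x) = vert_proj n (x', z x')"
      unfolding cycle_verts_path_cycle[OF n z] by blast
    then have "x mod (2 * n) = x' mod (2 * n)" "y x = z x'" by (simp_all add: vert_proj_def)
    moreover have "z (x mod (2 * n)) = z x" "z (x' mod (2 * n)) = z x'"
      using periodic_mod[of z n, OF path_props(4)[OF n z]] by blast+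
    ultimately show ?thesis by simp
  qed
  show "y = z"
  proof
    fix x
    consider "odd (x + y x)" | "odd (x + z x)" | "even (x + y x)" "even (x + z x)" by blast
    then show "y x = z x"
    proof cases
      case 3
      have "y (x - 1) = y x" "z (x - 1) = z x" using unvisited_prev[OF n y 3(1)] unvisited_prev[OF n z 3(2)] by blast+
      moreover have "odd (x - 1 + y (x - 1))" using 3 calculation by simp
      then have "y (x - 1) = z (x - 1)" by (rule agree[OF _ y z eq])
      ultimately show ?thesis by simp
    qed (use agree[of x y z] agree[of x z y] y z eq in simp_all)
  qed
qed

section \<open>Simple cycles wind once\<close>

lemma path_step_refl: "path_step x s s"
  by (simp add: path_step_def)

lemma path_step_shift: "path_step (x + 2 * n) s t = path_step x s t" "path_step (x + 2 * n * k) s t = path_step x s t"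
  by (simp_all add: path_step_def)

text \<open>Turns a walk through the vertices \<open>(g k, r k)\<close> of the strip into a height
  function. A column skipped by a horizontal edge receives the height of that edge. Nothing is said
  about columns left of \<open>g 0\<close>.\<close>

lemma staircase_interpolation:
  fixes g r :: "nat \<Rightarrow> int"
  assumes bnd: "\<And>k. 0 \<le> r k \<and> r k < m" and odd: "\<And>k. odd (g k + r k)"
    and move: "\<And>k. g (Suc k) = g k + 1 \<and> \<bar>r (Suc k) - r k\<bar> = 1 \<or> g (Suc k) = g k + 2 \<and> r (Suc k) = r k"
  obtains c :: "int \<Rightarrow> int" where "\<And>k x. g k \<le> x \<Longrightarrow> x < g (Suc k) \<Longrightarrow> c x = r k"
    "\<And>x. g 0 \<le> x \<Longrightarrow> 0 \<le> c x \<and> c x < m" "\<And>x. g 0 \<le> x \<Longrightarrow> path_step (x + 1) (c x) (c (x + 1))"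
    "\<And>x. g 0 \<le> x \<Longrightarrow> odd (x + c x) \<Longrightarrow> \<exists>k. x = g k" "strict_mono g"
    "\<And>x. g 0 \<le> x \<Longrightarrow> \<exists>k. g k \<le> x \<and> x < g (Suc k)"
proof -
  have lt: "g k < g (Suc k)" for k using move[of k] by linarith
  have mono: "strict_mono g" by (rule strict_monoI_Suc) (rule lt)
  define c where "c x = r (LEAST k. x < g (Suc k))" for x
  have c: "c x = r k" if "g k \<le> x" "x < g (Suc k)" for k x
  proof -
    have "(LEAST k. x < g (Suc k)) = k"
    proof (rule Least_equality)
      fix l assume "x < g (Suc l)"
      then have "g k < g (Suc l)" using that by simp
      then show "k \<le> l" using strict_mono_less[OF mono] by simp
    qed (rule that)
    then show ?thesis by (simp add: c_def)
  qed
  have grow: "g 0 + int k \<le> g k" for k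
  proof (induction k)
    case (Suc k)
    then show ?case using lt[of k] by simp
  qed simp
  have ex: "\<exists>k. g k \<le> x \<and> x < g (Suc k)" if "g 0 \<le> x" for x
  proof -
    have "x < g (Suc (nat (x - g 0)))" using grow[of "Suc (nat (x - g 0))"] that by simp
    then have 1: "x < g (Suc (LEAST k. x < g (Suc k)))" by (rule LeastI)
    have "g (LEAST k. x < g (Suc k)) \<le> x"
    proof (cases "LEAST k. x < g (Suc k)")
      case 0
      then show ?thesis using that by simp
    next
      case (Suc l)
      then have "\<not> x < g (Suc l)" by (intro not_less_Least) simp
      then show ?thesis using Suc by simp
    qed
    with 1 show ?thesis by blast
  qed
  show thesis
  proof (rule that[of c])
    fix x assume x: "g 0 \<le> x"
    obtain k where k: "g k \<le> x" "x < g (Suc k)" using ex[OF x] by blast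
    have cx: "c x = r k" by (rule c[OF k])
    show "0 \<le> c x \<and> c x < m" unfolding cx by (rule bnd)
    show "path_step (x + 1) (c x) (c (x + 1))"
    proof (cases "x + 1 < g (Suc k)")
      case True
      then have "c (x + 1) = r k" using k by (intro c) simp_all
      then show ?thesis unfolding cx by (simp only: path_step_refl)
    next
      case False
      then have x1: "x + 1 = g (Suc k)" using k by simp
      have c1: "c (x + 1) = r (Suc k)" by (rule c) (use x1 lt[of "Suc k"] in simp_all)
      from move[of k] show ?thesis
      proof
        assume "g (Suc k) = g k + 1 \<and> \<bar>r (Suc k) - r k\<bar> = 1"
        moreover have "even (x + 1 + r k)" using odd[of k] x1 calculation by simp
        ultimately show ?thesis unfolding cx c1 path_step_def by simp
      qed (simp add: cx c1 path_step_refl)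
    qed
    show "\<exists>k. x = g k" if "odd (x + c x)"
    proof -
      have "x = g k \<or> x = g k + 1" using k move[of k] by linarith
      moreover have "x \<noteq> g k + 1" using that odd[of k] unfolding cx by auto
      ultimately show ?thesis by blast
    qed
  qed (use c mono ex in blast)+
qed

lemma net_edges_cover:
  assumes n: "n \<ge> 1" and e: "e \<in> net_edges n m"
  shows "e \<in> cover_edges m" "0 \<le> fst (fst e)" "fst (fst e) < 2 * n"
proof -
  obtain a b a' b' where ab: "((a, b), (a', b')) \<in> cover_edges m" "e = edge_proj n ((a, b), (a', b'))"
    using e unfolding net_edges_def by (metis imageE surj_pair)
  have eq: "e = ((a mod (2 * n), b), (a' - 2 * n * (a div (2 * n)), b'))" using ab(2) by (simp only: edge_proj_eq)
  have "odd (a + b)" using ab(1) unfolding cover_edges_iff by blast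
  then have "odd (a mod (2 * n) + b)" by (simp add: dvd_mod_iff)
  moreover have "a' - 2 * n * (a div (2 * n)) - a mod (2 * n) = a' - a"
    using minus_mult_div_eq_mod[of a "2 * n"] by linarith
  ultimately show "e \<in> cover_edges m"
    using ab(1) unfolding eq cover_edges_iff by linarith
  show "0 \<le> fst (fst e)" "fst (fst e) < 2 * n" unfolding eq using n by simp_all
qed

text \<open>Suppose that the lift closes up only after more than one turn. It cannot meet its
  translate by one turn, as the cycle would repeat a vertex. By noncrossing it then stays on one
  side of this translate, so its height moves in the same direction with every turn and never
  returns to its start.\<close>

lemma simple_cycle_is_path_cycle:
  assumes n: "n \<ge> 1" and cyc: "is_cycle n m es"
  shows "\<exists>y\<in>closed_paths n m. set es = path_cycle n y"
proof -
  define L where "L = length es"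
  define e where "e k = es ! (k mod L)" for k
  have L: "L > 0" using cyc by (simp add: is_cycle_def L_def)
  have e_in: "e k \<in> net_edges n m" for k
  proof -
    have "e k \<in> set es" unfolding e_def by (rule nth_mem) (use L in \<open>simp add: L_def\<close>)
    then show ?thesis using cyc by (auto simp: is_cycle_def)
  qed
  have e_next: "vert_proj n (snd (e k)) = fst (e (Suc k))" for k
  proof -
    have "vert_proj n (snd (es ! (k mod L))) = fst (es ! (Suc (k mod L) mod L))"
      using cyc L by (simp add: is_cycle_def L_def)
    then show ?thesis by (simp add: e_def mod_Suc_eq)
  qed
  have e_per: "e (k + L) = e k" for k by (simp add: e_def)
  have e_inj: "k mod L = k' mod L" if "fst (e k) = fst (e k')" for k k'
  proof -
    have "distinct (map fst es)" using cyc by (simp add: is_cycle_def)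
    then have "inj_on (\<lambda>i. map fst es ! i) {..<L}" by (intro inj_on_nth) (simp_all add: L_def)
    moreover have "map fst es ! (k mod L) = map fst es ! (k' mod L)"
      using that L by (simp add: e_def L_def)
    ultimately show ?thesis using L by (auto dest: inj_onD)
  qed
  \<comment> \<open>The lift is unrolled from the first edge: \<open>g k\<close> accumulates the
    horizontal lengths and \<open>r k\<close> is the row. Since \<open>e\<close> is extended
    periodically, the lift continues forever to the right.\<close>
  define dx where "dx e = fst (snd e) - fst (fst e)" for e :: edge
  define g where "g k = fst (fst (e 0)) + (\<Sum>j<k. dx (e j))" for k
  define r where "r k = snd (fst (e k))" for k
  have g_Suc: "g (Suc k) = g k + dx (e k)" for k by (simp add: g_def)
  have r_Suc: "r (Suc k) = snd (snd (e k))" for k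
    using e_next[of k] by (cases "snd (e k)") (simp add: r_def vert_proj_def flip: e_next)
  have g_mod: "g k mod (2 * n) = fst (fst (e k))" for k
  proof (induction k)
    case 0
    then show ?case using net_edges_cover(2,3)[OF n e_in[of 0]] by (simp add: g_def)
  next
    case (Suc k)
    have "g (Suc k) mod (2 * n) = (g k mod (2 * n) + dx (e k)) mod (2 * n)" by (simp add: g_Suc mod_add_left_eq)
    also have "\<dots> = fst (snd (e k)) mod (2 * n)" unfolding Suc dx_def by simp
    also have "\<dots> = fst (fst (e (Suc k)))" unfolding e_next[symmetric] by (cases "snd (e k)") (simp add: vert_proj_def)
    finally show ?case .
  qed
  have vp: "vert_proj n (g k, r k) = fst (e k)" for k
    by (cases "fst (e k)") (simp add: vert_proj_def g_mod r_def)
  have e_lift: "edge_proj n ((g k, r k), (g (Suc k), r (Suc k))) = e k" for k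
  proof -
    have "g (Suc k) - 2 * n * (g k div (2 * n)) = fst (snd (e k))"
      using minus_mult_div_eq_mod[of "g k" "2 * n"] g_mod[of k] by (simp add: g_Suc dx_def)
    then show ?thesis unfolding edge_proj_eq g_mod r_Suc unfolding r_def by simp
  qed
  have cov: "odd (fst (fst (e k)) + r k) \<and> 0 \<le> r k \<and> r k < m \<and>
      (dx (e k) = 1 \<and> \<bar>r (Suc k) - r k\<bar> = 1 \<or> dx (e k) = 2 \<and> r (Suc k) = r k)" for k
  proof -
    have "((fst (fst (e k)), r k), (fst (snd (e k)), r (Suc k))) \<in> cover_edges m"
      using net_edges_cover(1)[OF n e_in[of k]] unfolding r_Suc unfolding r_def by simp
    then show ?thesis unfolding cover_edges_iff dx_def by linarith
  qed
  have godd: "odd (g k + r k)" for k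
  proof -
    have "g k = fst (fst (e k)) + 2 * n * (g k div (2 * n))" using g_mod[of k] mod_mult_div_eq[of "g k" "2 * n"] by simp
    then have "odd (g k + r k) \<longleftrightarrow> odd (fst (fst (e k)) + r k)" by (metis dvd_triv_left even_add even_mult_iff)
    then show ?thesis using cov by blast
  qed
  have rbnd: "0 \<le> r k \<and> r k < m" for k using cov by blast
  have move: "g (Suc k) = g k + 1 \<and> \<bar>r (Suc k) - r k\<bar> = 1 \<or> g (Suc k) = g k + 2 \<and> r (Suc k) = r k" for k
    using cov[of k] unfolding g_Suc by linarith
  obtain c where c: "\<And>k x. g k \<le> x \<Longrightarrow> x < g (Suc k) \<Longrightarrow> c x = r k"
    and cbnd: "\<And>x. g 0 \<le> x \<Longrightarrow> 0 \<le> c x \<and> c x < m"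
    and cstep: "\<And>x. g 0 \<le> x \<Longrightarrow> path_step (x + 1) (c x) (c (x + 1))"
    and cvis: "\<And>x. g 0 \<le> x \<Longrightarrow> odd (x + c x) \<Longrightarrow> \<exists>k. x = g k" and mono: "strict_mono g"
    and cex: "\<And>x. g 0 \<le> x \<Longrightarrow> \<exists>k. g k \<le> x \<and> x < g (Suc k)"
    by (rule staircase_interpolation[of r m g, OF rbnd godd move]) (rule that, assumption+)
  have cg: "c (g k) = r k" for k by (rule c) (use strict_mono_less[OF mono] in simp_all)
  define D where "D = g L - g 0"
  have gL: "g (k + L) = g k + D" for k
  proof (induction k)
    case (Suc k)
    then show ?case using g_Suc[of "k + L"] g_Suc[of k] by (simp add: e_per)
  qed (simp add: D_def)
  have gqL: "g (k + q * L) = g k + int q * D" for k q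
  proof (induction q)
    case (Suc q)
    have "g (k + Suc q * L) = g (k + q * L + L)" by (simp add: algebra_simps)
    then show ?case using gL[of "k + q * L"] Suc by (simp add: algebra_simps)
  qed simp
  have rL: "r (k + L) = r k" for k by (simp add: r_def e_per)
  have "D > 0" using strict_mono_less[OF mono, of 0 L] L by (simp add: D_def)
  have "2 * n dvd D"
  proof -
    have "g L mod (2 * n) = g 0 mod (2 * n)" using e_per[of 0] by (simp add: g_mod)
    then show ?thesis unfolding D_def by (simp only: mod_eq_dvd_iff)
  qed
  then obtain l' where l': "D = 2 * n * l'" by (elim dvdE)
  have "l' > 0" using \<open>D > 0\<close> n unfolding l' by (simp add: zero_less_mult_iff)
  then obtain l where l: "D = 2 * n * int l" "l > 0" using l' by (metis zero_less_imp_eq_int)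
  have ge0: "g 0 \<le> g k" for k using strict_mono_less_eq[OF mono] by simp
  have DL: "D = 2 * n"
  proof (cases "\<exists>x\<ge>g 0. c (x + 2 * n) = c x")
    case True
    then obtain x0 where x0: "g 0 \<le> x0" "c (x0 + 2 * n) = c x0" by blast
    \<comment> \<open>If lift and translate meet in an unvisited column, both go straight and meet
      at a vertex in the next one.\<close>
    have "\<exists>x\<ge>g 0. c (x + 2 * n) = c x \<and> odd (x + c x)"
    proof (cases "odd (x0 + c x0)")
      case False
      then have o: "odd (x0 + 1 + c x0)" by simp
      have 1: "c (x0 + 1) = c x0" using cstep[OF x0(1)] o by (simp add: path_step_def)
      have "path_step (x0 + 2 * n + 1) (c (x0 + 2 * n)) (c (x0 + 2 * n + 1))" using x0 n by (intro cstep) simp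
      moreover have "odd (x0 + 2 * n + 1 + c (x0 + 2 * n))" unfolding x0(2) using o by simp
      ultimately have "c (x0 + 2 * n + 1) = c (x0 + 2 * n)" by (simp add: path_step_def)
      moreover have "x0 + 2 * n + 1 = x0 + 1 + 2 * n" by simp
      ultimately have 2: "c (x0 + 1 + 2 * n) = c (x0 + 2 * n)" by (simp only:)
      show ?thesis
        by (rule exI[of _ "x0 + 1"]) (use x0(1) o in \<open>simp only: 1 2 x0(2)\<close>, simp)
    qed (use x0 in blast)
    then obtain x where x: "g 0 \<le> x" "c (x + 2 * n) = c x" "odd (x + c x)" by blast
    obtain k where k: "x = g k" using cvis[OF x(1,3)] by blast
    have "odd (x + 2 * n + c (x + 2 * n))" unfolding x(2) using x(3) by simp
    then obtain k' where k': "x + 2 * n = g k'" using cvis[of "x + 2 * n"] x(1) n by auto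
    have "r k = r k'" using x(2) k k' cg by simp
    moreover have "g k' mod (2 * n) = g k mod (2 * n)" by (simp flip: k k')
    ultimately have "vert_proj n (g k, r k) = vert_proj n (g k', r k')" by (simp add: vert_proj_def)
    then have "k mod L = k' mod L" unfolding vp by (rule e_inj)
    moreover have "k < k'" using strict_mono_less[OF mono, of k k'] k k' n by simp
    ultimately have "L dvd k' - k" by (metis less_imp_le_nat mod_eq_dvd_iff_nat)
    then obtain q where "k' - k = L * q" by (elim dvdE)
    then have "k' = k + q * L" using \<open>k < k'\<close> by (simp add: mult.commute)
    then have "2 * n = int q * D" using gqL[of k q] k k' by simp
    then have "2 * n * (int q * int l) = 2 * n * 1" unfolding l by (simp add: mult_ac)
    then have "int q * int l = 1" using n by simp
    then have "l = 1" by (metis of_nat_1 of_nat_eq_iff of_nat_mult nat_mult_eq_1_iff)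
    then show ?thesis using l by simp
  next
    case False
    define d where "d x = c (x + 2 * n) - c x" for x
    have d0: "d x \<noteq> 0" if "g 0 \<le> x" for x using False that by (simp add: d_def)
    have sgn_Suc: "sgn (d (x + 1)) = sgn (d x)" if x: "g 0 \<le> x" for x
    proof -
      have s1: "path_step (x + 1) (c x) (c (x + 1))" by (rule cstep[OF x])
      have "path_step (x + 2 * n + 1) (c (x + 2 * n)) (c (x + 2 * n + 1))" using x n by (intro cstep) simp
      moreover have "x + 2 * n + 1 = x + 1 + 2 * n" by simp
      ultimately have s2: "path_step (x + 1) (c (x + 2 * n)) (c (x + 1 + 2 * n))"
        by (simp only: path_step_shift)
      have ne: "c (x + 1 + 2 * n) \<noteq> c (x + 1)" using d0[of "x + 1"] x by (simp add: d_def)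
      consider "c x < c (x + 2 * n)" | "c (x + 2 * n) < c x" using d0[OF x] unfolding d_def by linarith
      then show ?thesis
      proof cases
        case 1
        then have "c (x + 1) < c (x + 1 + 2 * n)" using path_step_noncrossing[OF s1 s2 1] ne by simp
        then show ?thesis using 1 unfolding d_def by (simp only: sgn_if) simp
      next
        case 2
        then have "c (x + 1 + 2 * n) < c (x + 1)" using path_step_noncrossing[OF s2 s1 2] ne by simp
        then show ?thesis using 2 unfolding d_def by (simp only: sgn_if) simp
      qed
    qed
    have sgn_add: "sgn (d (g 0 + int t)) = sgn (d (g 0))" for t
    proof (induction t)
      case (Suc t)
      then show ?case using sgn_Suc[of "g 0 + int t"] by (simp add: add_ac)
    qed simp
    have "sgn (d (g 0 + 2 * n * int q)) = sgn (d (g 0))" for q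
      using sgn_add[of "nat (2 * n * int q)"] n by simp
    \<comment> \<open>The height changes over the successive turns all have the sign of the first
      one, hence so has their sum.\<close>
    then have ind: "sgn (c (g 0 + 2 * n * int (Suc q)) - c (g 0)) = sgn (d (g 0))" for q
    proof (induction q)
      case 0
      then show ?case by (simp add: d_def)
    next
      case (Suc q)
      have "sgn (a + b) = s" if "sgn a = s" "sgn b = s" for a b s :: int
        using that by (auto simp: sgn_if split: if_splits)
      from this[OF Suc.IH[OF Suc.prems] Suc.prems[of "Suc q"]] show ?case
        unfolding d_def by (simp add: algebra_simps)
    qed
    have "c (g 0 + 2 * n * int l) = c (g 0)"
      using cg[of L] cg[of 0] rL[of 0] unfolding l(1)[symmetric] D_def by simp
    then have "sgn (d (g 0)) = 0" using ind[of "l - 1"] l(2) by simp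
    then show ?thesis using d0[of "g 0"] by (simp add: sgn_eq_0_iff)
  qed
  have cper: "c (x + 2 * n) = c x" if x: "g 0 \<le> x" for x
  proof -
    from cex[OF x] obtain k where k: "g k \<le> x" "x < g (Suc k)" by blast
    have "c (x + 2 * n) = r (k + L)" by (rule c) (use k gL[of k] gL[of "Suc k"] DL in simp_all)
    then show ?thesis using c[OF k] rL by simp
  qed
  \<comment> \<open>\<open>c\<close> is controlled only from column \<open>g 0\<close> on, so one
    turn of it is continued periodically in both directions.\<close>
  define y where "y x = c (g 0 + (x - g 0) mod (2 * n))" for x
  have yc: "y x = c x" if x: "g 0 \<le> x" for x
  proof -
    have "c (z + 2 * n * int q) = c z" if "g 0 \<le> z" for z q
    proof (induction q)
      case (Suc q)
      have "c (z + 2 * n * int q + 2 * n) = c (z + 2 * n * int q)"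
      proof (rule cper)
        have "0 \<le> 2 * n * int q" using n by simp
        then show "g 0 \<le> z + 2 * n * int q" using that by linarith
      qed
      then show ?case using Suc by (simp add: algebra_simps)
    qed simp
    from this[of "g 0 + (x - g 0) mod (2 * n)" "nat ((x - g 0) div (2 * n))"]
    have "c (g 0 + (x - g 0) mod (2 * n) + 2 * n * ((x - g 0) div (2 * n))) = y x"
      using x n by (simp add: y_def pos_imp_zdiv_nonneg_iff)
    moreover have "g 0 + (x - g 0) mod (2 * n) + 2 * n * ((x - g 0) div (2 * n)) = x"
      using mod_mult_div_eq[of "x - g 0" "2 * n"] by linarith
    ultimately show ?thesis by (simp only:)
  qed
  have yper: "y (x + 2 * n) = y x" for x
  proof -
    have "x + 2 * n - g 0 = x - g 0 + 2 * n" by simp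
    then show ?thesis unfolding y_def by (simp only: mod_add_self2)
  qed
  have far: "\<exists>q. g 0 < x + 2 * n * q" for x
  proof -
    have "(g 0 - x + 1) * 1 \<le> \<bar>g 0 - x + 1\<bar> * (2 * n)" using n by (intro mult_mono) simp_all
    then show ?thesis by (intro exI[of _ "\<bar>g 0 - x + 1\<bar>"]) (simp add: mult.commute)
  qed
  have ycl: "y \<in> closed_paths n m"
    unfolding closed_paths_def mem_Collect_eq
  proof (intro conjI allI)
    fix x
    show "0 \<le> y x" "y x < m" using cbnd[of "g 0 + (x - g 0) mod (2 * n)"] n by (simp_all add: y_def)
    show "y (x + 2 * n) = y x" by (rule yper)
    obtain q where q: "g 0 < x + 2 * n * q" using far by blast
    have "path_step (x - 1 + 2 * n * q + 1) (c (x - 1 + 2 * n * q)) (c (x - 1 + 2 * n * q + 1))"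
      using q by (intro cstep) simp
    moreover have "x - 1 + 2 * n * q + 1 = x + 2 * n * q" by simp
    moreover have "c (x - 1 + 2 * n * q) = y (x - 1)"
      using yc[of "x - 1 + 2 * n * q"] periodic_shift[of y n "x - 1" q, OF yper] q by simp
    moreover have "c (x + 2 * n * q) = y x"
      using yc[of "x + 2 * n * q"] periodic_shift[of y n x q, OF yper] q by simp
    ultimately show "path_step x (y (x - 1)) (y x)" by (simp only: path_step_shift)
  qed
  have in_e: "edge_proj n (in_edge y (g (Suc k))) = e k" for k
  proof -
    have 1: "y (g (Suc k)) = r (Suc k)" using yc[OF ge0] cg by simp
    from move[of k] have "in_edge y (g (Suc k)) = ((g k, r k), (g (Suc k), r (Suc k)))"
    proof
      assume a: "g (Suc k) = g k + 1 \<and> \<bar>r (Suc k) - r k\<bar> = 1"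
      then have "y (g (Suc k) - 1) = r k" using yc[OF ge0[of k]] cg[of k] by simp
      then show ?thesis using a 1 by (auto simp: in_edge_def)
    next
      assume a: "g (Suc k) = g k + 2 \<and> r (Suc k) = r k"
      then have "c (g (Suc k) - 1) = r k" by (intro c) simp_all
      moreover have "g 0 \<le> g (Suc k) - 1" using ge0[of k] a by simp
      ultimately have "y (g (Suc k) - 1) = r k" using yc by simp
      then show ?thesis using a 1 by (simp add: in_edge_def)
    qed
    then show ?thesis using e_lift by simp
  qed
  have "set es = path_cycle n y"
  proof (intro equalityI subsetI)
    fix a assume "a \<in> set es"
    then obtain k where "k < L" "a = es ! k" by (auto simp: in_set_conv_nth L_def)
    then have "a = e k" by (simp add: e_def)
    then have "a = edge_proj n (in_edge y (g (Suc k)))" by (simp only: in_e)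
    moreover have "odd (g (Suc k) + y (g (Suc k)))" using godd[of "Suc k"] yc[OF ge0] cg by simp
    ultimately show "a \<in> path_cycle n y" unfolding path_cycle_def by blast
  next
    fix a assume "a \<in> path_cycle n y"
    then obtain x where x: "odd (x + y x)" "a = edge_proj n (in_edge y x)" unfolding path_cycle_def by blast
    obtain q where q: "g 0 < x + 2 * n * q" using far by blast
    have ys: "y (x + 2 * n * q) = y x" by (rule periodic_shift) (rule yper)
    have "odd (x + 2 * n * q + c (x + 2 * n * q))"
      using x(1) ys yc[of "x + 2 * n * q"] q by simp
    then obtain k where k: "x + 2 * n * q = g k" using cvis[of "x + 2 * n * q"] q by auto
    then have "k \<noteq> 0" using q by (intro notI) simp
    then obtain k' where "k = Suc k'" using not0_implies_Suc by blast
    then have "a = e k'"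
      using in_edge_shift[OF n ycl, of x q] in_e[of k'] x(2) k by simp
    then show "a \<in> set es" unfolding e_def using L by (simp add: L_def)
  qed
  then show ?thesis using ycl by blast
qed

lemma simple_cycles_eq: "n \<ge> 1 \<Longrightarrow> simple_cycles n m = path_cycle n ` closed_paths n m"
  using simple_cycle_is_path_cycle path_cycle_simple(1) unfolding simple_cycles_def by fast

section \<open>Collections of disjoint closed paths\<close>

text \<open>Paths have to differ in height in all columns, visited or not, because this is the form
  in which noncrossing applies.\<close>

definition disjoint_paths :: "int \<Rightarrow> int \<Rightarrow> nat \<Rightarrow> (int \<Rightarrow> int) set set" where
  "disjoint_paths n m r = {Y. Y \<subseteq> closed_paths n m \<and> finite Y \<and> card Y = r \<and>
     pairwise (\<lambda>y z. \<forall>x. y x \<noteq> z x) Y}"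

lemma r_cycles_eq:
  assumes n: "n \<ge> 1"
  shows "r_cycles n m r = (\<lambda>Y. path_cycle n ` Y) ` disjoint_paths n m r"
proof (intro equalityI subsetI)
  fix S assume "S \<in> r_cycles n m r"
  then have S: "S \<subseteq> path_cycle n ` closed_paths n m" "finite S" "card S = r"
    "pairwise (\<lambda>C D. cycle_verts C \<inter> cycle_verts D = {}) S"
    by (simp_all add: r_cycles_def simple_cycles_eq[OF n])
  define Y where "Y = {y \<in> closed_paths n m. path_cycle n y \<in> S}"
  have SY: "S = path_cycle n ` Y" using S(1) by (auto simp: Y_def)
  have inj: "inj_on (path_cycle n) Y"
    by (rule inj_on_subset[OF inj_on_path_cycle[OF n, of m]]) (simp add: Y_def)
  have "pairwise (\<lambda>y z. \<forall>x. y x \<noteq> z x) Y"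
  proof (rule pairwiseI)
    fix y z assume yz: "y \<in> Y" "z \<in> Y" "y \<noteq> z"
    then have "path_cycle n y \<noteq> path_cycle n z" using inj by (simp add: inj_on_eq_iff)
    moreover have "path_cycle n y \<in> S" "path_cycle n z \<in> S" using yz by (simp_all add: Y_def)
    ultimately have "cycle_verts (path_cycle n y) \<inter> cycle_verts (path_cycle n z) = {}"
      using S(4) by (simp add: pairwise_def)
    moreover have "y \<in> closed_paths n m" "z \<in> closed_paths n m" using yz by (simp_all add: Y_def)
    ultimately show "\<forall>x. y x \<noteq> z x" using path_cycle_disjoint_iff[OF n] by blast
  qed
  moreover have "finite Y" using S(2) inj unfolding SY by (rule finite_imageD)
  moreover have "card Y = r" using S(3) card_image[OF inj] unfolding SY by simp
  ultimately have "Y \<in> disjoint_paths n m r" by (simp add: disjoint_paths_def Y_def)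
  then show "S \<in> (\<lambda>Y. path_cycle n ` Y) ` disjoint_paths n m r" using SY by blast
next
  fix S assume "S \<in> (\<lambda>Y. path_cycle n ` Y) ` disjoint_paths n m r"
  then obtain Y where Y: "S = path_cycle n ` Y" "Y \<subseteq> closed_paths n m" "finite Y" "card Y = r"
    "pairwise (\<lambda>y z. \<forall>x. y x \<noteq> z x) Y" by (auto simp: disjoint_paths_def)
  have inj: "inj_on (path_cycle n) Y" by (rule inj_on_subset[OF inj_on_path_cycle[OF n] Y(2)])
  have "pairwise (\<lambda>C D. cycle_verts C \<inter> cycle_verts D = {}) S"
  proof (rule pairwiseI)
    fix C D assume "C \<in> S" "D \<in> S" "C \<noteq> D"
    then obtain y z where yz: "C = path_cycle n y" "D = path_cycle n z" "y \<in> Y" "z \<in> Y" "y \<noteq> z" using Y(1) by blast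
    then have "\<forall>x. y x \<noteq> z x" using Y(5) by (simp add: pairwise_def)
    then show "cycle_verts C \<inter> cycle_verts D = {}"
      using path_cycle_disjoint_iff[OF n, of y m z] yz Y(2) by blast
  qed
  moreover have "S \<subseteq> simple_cycles n m" using Y(1,2) by (simp add: simple_cycles_eq[OF n] image_mono)
  ultimately show "S \<in> r_cycles n m r" using Y card_image[OF inj] by (simp add: r_cycles_def)
qed

lemma inj_on_image_path_cycle:
  assumes "n \<ge> 1"
  shows "inj_on (\<lambda>Y. path_cycle n ` Y) (disjoint_paths n m r)"
  by (rule inj_on_subset[OF inj_on_image_Pow[OF inj_on_path_cycle[OF assms]]]) (auto simp: disjoint_paths_def)

lemma r_cycle_path_cycles:
  assumes n: "n \<ge> 1" and Y: "Y \<in> disjoint_paths n m r"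
  shows "r_cycle_wind n m (path_cycle n ` Y) = int r"
    "r_cycle_wt n m (path_cycle n ` Y) = (\<Prod>y\<in>Y. \<Prod>x\<in>{0..<2 * n}. strip_mat n m x (y (x - 1)) (y x))"
proof -
  have Y': "Y \<subseteq> closed_paths n m" "card Y = r" using Y by (simp_all add: disjoint_paths_def)
  have inj: "inj_on (path_cycle n) Y" by (rule inj_on_subset[OF inj_on_path_cycle[OF n] Y'(1)])
  have "r_cycle_wind n m (path_cycle n ` Y) = (\<Sum>y\<in>Y. wind n m (path_cycle n y))"
    unfolding r_cycle_wind_def by (rule sum.reindex[OF inj, unfolded o_def])
  also have "\<dots> = (\<Sum>y\<in>Y. 1)"
    by (rule sum.cong[OF refl]) (use path_cycle_simple(2)[OF n] Y'(1) in blast)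
  finally show "r_cycle_wind n m (path_cycle n ` Y) = int r" using Y'(2) by simp
  have 1: "r_cycle_wt n m (path_cycle n ` Y) = (\<Prod>y\<in>Y. cycle_wt n m (path_cycle n y))"
    unfolding r_cycle_wt_def by (rule prod.reindex[OF inj, unfolded o_def])
  show "r_cycle_wt n m (path_cycle n ` Y) = (\<Prod>y\<in>Y. \<Prod>x\<in>{0..<2 * n}. strip_mat n m x (y (x - 1)) (y x))"
    unfolding 1 by (rule prod.cong[OF refl], rule cycle_wt_path_cycle[OF n]) (use Y'(1) in blast)
qed

text \<open>Noncrossing propagates the order of the paths in column \<open>- 1\<close> to all later
  columns, so the \<open>k\<close>-th path is everywhere at the \<open>k\<close>-th smallest height.
  Column \<open>- 1\<close> is the one from which the matrix of column 0 departs.\<close>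

lemma disjoint_paths_sorted:
  assumes Y: "Y \<in> disjoint_paths n m r"
  shows "\<exists>ys. bij_betw ys {..<r} Y \<and> (\<forall>t::nat. card ((\<lambda>y. y (int t - 1)) ` Y) = r \<and>
    (\<forall>k<r. nth_elem ((\<lambda>y. y (int t - 1)) ` Y) k = ys k (int t - 1)))"
proof -
  have Y': "Y \<subseteq> closed_paths n m" "finite Y" "card Y = r" using Y by (simp_all add: disjoint_paths_def)
  have neq: "y x \<noteq> z x" if "y \<in> Y" "z \<in> Y" "y \<noteq> z" for y z x
    using Y that by (simp add: disjoint_paths_def pairwise_def)
  define ev where "ev t = (\<lambda>y::int \<Rightarrow> int. y (int t - 1))" for t
  have inj: "inj_on (ev t) Y" for t
    unfolding ev_def by (rule inj_onI) (use neq in blast)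
  have mono: "ev t y < ev t z" if "y \<in> Y" "z \<in> Y" "ev 0 y < ev 0 z" for y z t
  proof (induction t)
    case (Suc t)
    have "path_step (int t) (y (int t - 1)) (y (int t))" "path_step (int t) (z (int t - 1)) (z (int t))"
      using that Y'(1) by (auto simp: closed_paths_def)
    moreover have "y \<noteq> z" using that by auto
    then have "y (int t) \<noteq> z (int t)" using neq that by blast
    ultimately show ?case using path_step_noncrossing Suc by (simp add: ev_def)
  qed (rule that(3))
  define ys where "ys k = inv_into Y (ev 0) (nth_elem (ev 0 ` Y) k)" for k
  have c: "card (ev t ` Y) = r" for t using card_image[OF inj] Y'(3) by simp
  have b0: "bij_betw (inv_into Y (ev 0)) (ev 0 ` Y) Y"
    by (rule bij_betw_inv_into) (simp add: bij_betw_def inj)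
  have bn: "bij_betw (nth_elem (ev 0 ` Y)) {..<r} (ev 0 ` Y)"
    using nth_elem_bij[of "ev 0 ` Y"] Y'(2) c[of 0] by simp
  have "bij_betw ys {..<r} Y"
    using bij_betw_trans[OF bn b0] by (simp add: ys_def[abs_def] o_def)
  moreover have "nth_elem (ev t ` Y) k = ev t (ys k)" if k: "k < r" for t k
  proof -
    define f where "f s = ev t (inv_into Y (ev 0) s)" for s
    have "bij_betw (ev t) Y (ev t ` Y)" by (simp add: bij_betw_def inj)
    then have "bij_betw f (ev 0 ` Y) (ev t ` Y)"
      using bij_betw_trans[OF b0] by (simp add: f_def[abs_def] o_def)
    moreover have "strict_mono_on (ev 0 ` Y) f"
    proof (rule strict_mono_onI)
      fix s s' assume s: "s \<in> ev 0 ` Y" "s' \<in> ev 0 ` Y" "s < s'"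
      then obtain y z where "y \<in> Y" "z \<in> Y" "s = ev 0 y" "s' = ev 0 z" by blast
      then show "f s < f s'" using mono s(3) inj[of 0] by (simp add: f_def)
    qed
    ultimately have "f (nth_elem (ev 0 ` Y) k) = nth_elem (ev t ` Y) k"
      using Y'(2) k c[of 0] by (intro strict_mono_on_nth_elem) simp_all
    then show ?thesis by (simp add: f_def ys_def)
  qed
  ultimately show ?thesis using c unfolding ev_def by blast
qed

text \<open>By Cauchy-Binet, a principal minor of one turn is a sum over sequences of states that
  return to their start. Such a sequence with nonzero weight is a system of disjoint closed paths,
  because paths that keep their order close up individually.\<close>

lemma sum_disjoint_paths:
  assumes n: "n \<ge> 1"
  shows "(\<Sum>Y\<in>disjoint_paths n m r. \<Prod>y\<in>Y. \<Prod>x\<in>{0..<2 * n}. strip_mat n m x (y (x - 1)) (y x)) =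
    (\<Sum>S\<in>ksubsets {0..<m} r. minor (prod_mat {0..<m} (strip_mat n m) 0 (nat (2 * n))) S S)"
    (is "sum ?wt _ = _")
proof -
  define N where "N = nat (2 * n)"
  have N: "int N = 2 * n" "0 < N" using n by (simp_all add: N_def)
  let ?J = "{0..<m}"
  let ?K = "ksubsets ?J r"
  define G where "G Sq = (\<Prod>t<N. minor (strip_mat n m (int t)) (Sq t) (Sq (Suc t)))" for Sq :: "nat \<Rightarrow> int set"
  define SQ where "SQ = {Sq \<in> {..N} \<rightarrow>\<^sub>E ?K. Sq 0 = Sq N}"
  \<comment> \<open>The sequences that trace paths; for all others some factor of \<open>G\<close>
    vanishes.\<close>
  define SQ' where "SQ' = {Sq \<in> SQ. \<forall>t<N. \<forall>k<r. path_step (int t) (nth_elem (Sq t) k) (nth_elem (Sq (Suc t)) k)}"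
  have finK: "finite ?K" by simp
  have K: "finite S" "card S = r" "S \<subseteq> ?J" if "S \<in> ?K" for S
    using that ksubsets_finite[of ?J S r] by (simp_all add: ksubsets_def)
  have finSQ: "finite SQ"
    unfolding SQ_def by (rule finite_subset[OF _ finite_PiE[of "{..N}" "\<lambda>_. ?K"]]) (use finK in auto)
  have SQK: "Sq t \<in> ?K" if "Sq \<in> SQ" "t \<le> N" for Sq t using that by (auto simp: SQ_def)
  have G: "G Sq = (\<Prod>t<N. \<Prod>k<r. strip_mat n m (int t) (nth_elem (Sq t) k) (nth_elem (Sq (Suc t)) k))"
    if Sq: "Sq \<in> SQ" for Sq
    unfolding G_def
  proof (rule prod.cong[OF refl])
    fix t assume "t \<in> {..<N}"
    then have "Sq t \<in> ?K" "Sq (Suc t) \<in> ?K" using SQK[OF Sq] by simp_all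
    then have "finite (Sq t)" "finite (Sq (Suc t))" "card (Sq t) = card (Sq (Suc t))" "card (Sq t) = r"
      using K by simp_all
    then show "minor (strip_mat n m (int t)) (Sq t) (Sq (Suc t)) =
        (\<Prod>k<r. strip_mat n m (int t) (nth_elem (Sq t) k) (nth_elem (Sq (Suc t)) k))"
      unfolding strip_mat_def using minor_col_mat[of "Sq t" "Sq (Suc t)"] by simp
  qed
  have 1: "(\<Sum>S\<in>?K. minor (prod_mat ?J (strip_mat n m) 0 N) S S) = (\<Sum>S\<in>?K. \<Sum>Sq\<in>{Sq \<in> SQ. Sq 0 = S}. G Sq)"
  proof (rule sum.cong[OF refl])
    fix S assume S: "S \<in> ?K"
    have "minor (prod_mat ?J (strip_mat n m) 0 N) S S =
      (\<Sum>Sq\<in>{Sq \<in> {..N} \<rightarrow>\<^sub>E ?K. Sq 0 = S \<and> Sq N = S}.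
       \<Prod>t<N. minor (strip_mat n m (0 + int t)) (Sq t) (Sq (Suc t)))"
      by (rule minor_prod_mat[OF _ S S]) simp
    moreover have "{Sq \<in> {..N} \<rightarrow>\<^sub>E ?K. Sq 0 = S \<and> Sq N = S} = {Sq \<in> SQ. Sq 0 = S}"
      unfolding SQ_def by blast
    ultimately show "minor (prod_mat ?J (strip_mat n m) 0 N) S S = (\<Sum>Sq\<in>{Sq \<in> SQ. Sq 0 = S}. G Sq)"
      unfolding G_def by simp
  qed
  have 2: "(\<Sum>S\<in>?K. \<Sum>Sq\<in>{Sq \<in> SQ. Sq 0 = S}. G Sq) = sum G SQ"
    by (rule sum.group[OF finSQ finK]) (use SQK in blast)
  have 3: "sum G SQ = sum G SQ'"
  proof (rule sum.mono_neutral_right[OF finSQ])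
    show "SQ' \<subseteq> SQ" by (simp add: SQ'_def)
    show "\<forall>Sq\<in>SQ - SQ'. G Sq = 0"
    proof
      fix Sq assume "Sq \<in> SQ - SQ'"
      then obtain t k where Sq: "Sq \<in> SQ" and tk: "t < N" "k < r"
        "\<not> path_step (int t) (nth_elem (Sq t) k) (nth_elem (Sq (Suc t)) k)" by (auto simp: SQ'_def)
      then have "strip_mat n m (int t) (nth_elem (Sq t) k) (nth_elem (Sq (Suc t)) k) = 0"
        unfolding strip_mat_def using col_mat_nonzero by blast
      then have "(\<Prod>k<r. strip_mat n m (int t) (nth_elem (Sq t) k) (nth_elem (Sq (Suc t)) k)) = 0"
        using tk(2) by (intro prod_zero) auto
      then show "G Sq = 0" unfolding G[OF Sq] using tk(1) by (intro prod_zero) auto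
    qed
  qed
  \<comment> \<open>State \<open>t\<close> lists the heights in column \<open>t - 1\<close>, because
    the matrix of column \<open>x\<close> leads from column \<open>x - 1\<close> to column
    \<open>x\<close>. The shift by one in \<open>z\<close> undoes this.\<close>
  define F where "F Y = restrict (\<lambda>t. (\<lambda>y. y (int t - 1)) ` Y) {..N}" for Y :: "(int \<Rightarrow> int) set"
  define z where "z Sq k x = nth_elem (Sq (nat ((x + 1) mod (2 * n)))) k" for Sq :: "nat \<Rightarrow> int set" and k x
  have 4: "sum ?wt (disjoint_paths n m r) = sum G SQ'"
  proof (rule sum.reindex_bij_witness[where j = F and i = "\<lambda>Sq. z Sq ` {..<r}"])
    fix Y assume Y: "Y \<in> disjoint_paths n m r"
    then have Y': "Y \<subseteq> closed_paths n m" by (simp add: disjoint_paths_def)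
    obtain ys where ys: "bij_betw ys {..<r} Y" and cY: "\<And>t. card ((\<lambda>y. y (int t - 1)) ` Y) = r"
      and nY: "\<And>t k. k < r \<Longrightarrow> nth_elem ((\<lambda>y. y (int t - 1)) ` Y) k = ys k (int t - 1)"
      using disjoint_paths_sorted[OF Y] by metis
    have ysY: "ys k \<in> closed_paths n m" if "k < r" for k
      using ys Y' that by (auto simp: bij_betw_def)
    have zys: "z (F Y) k = ys k" if k: "k < r" for k
    proof
      fix x
      have b: "0 \<le> (x + 1) mod (2 * n)" "(x + 1) mod (2 * n) < 2 * n" using n by simp_all
      then have "nat ((x + 1) mod (2 * n)) \<le> N" using N by linarith
      then have "z (F Y) k x = ys k ((x + 1) mod (2 * n) - 1)"
        using nY[OF k, of "nat ((x + 1) mod (2 * n))"] b(1) by (simp add: z_def F_def)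
      also have "\<dots> = ys k (x + 1 - 1)"
      proof (rule periodic_mod[of "\<lambda>x. ys k (x - 1)" n])
        fix x show "ys k (x + 2 * n - 1) = ys k (x - 1)"
          using path_props(4)[OF n ysY[OF k], of "x - 1"] by (simp add: algebra_simps)
      qed
      finally show "z (F Y) k x = ys k x" by simp
    qed
    have "z (F Y) ` {..<r} = ys ` {..<r}" by (rule image_cong) (simp_all add: zys)
    then show "z (F Y) ` {..<r} = Y" using ys by (simp add: bij_betw_def)
    have FK: "F Y \<in> {..N} \<rightarrow>\<^sub>E ?K"
    proof -
      have "(\<lambda>y. y (int t - 1)) ` Y \<in> ?K" for t
        using cY[of t] Y' unfolding ksubsets_def closed_paths_def by auto
      then show ?thesis unfolding F_def by (rule restrict_PiE_iff[THEN iffD2, rule_format])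
    qed
    have F0N: "F Y 0 = F Y N"
    proof -
      have "(\<lambda>y. y (int 0 - 1)) ` Y = (\<lambda>y. y (int N - 1)) ` Y"
      proof (rule image_cong[OF refl])
        fix y assume "y \<in> Y"
        then show "y (int 0 - 1) = y (int N - 1)"
          using path_props(4)[OF n, of y m "- 1"] Y' N by (simp add: subset_eq algebra_simps)
      qed
      then show ?thesis by (simp add: F_def)
    qed
    have nF: "nth_elem (F Y t) k = ys k (int t - 1)" if "k < r" "t \<le> N" for t k
      using nY[OF that(1)] that(2) by (simp add: F_def)
    have FSQ: "F Y \<in> SQ" using FK F0N by (simp add: SQ_def)
    have "path_step (int t) (nth_elem (F Y t) k) (nth_elem (F Y (Suc t)) k)" if "t < N" "k < r" for t k
      using path_props(3)[OF n ysY[OF that(2)], of "int t"] nF[OF that(2), of t] nF[OF that(2), of "Suc t"] that(1) by simp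
    then show "F Y \<in> SQ'" using FSQ by (simp add: SQ'_def)
    have "G (F Y) = (\<Prod>t<N. \<Prod>k<r. strip_mat n m (int t) (ys k (int t - 1)) (ys k (int t)))"
      unfolding G[OF FSQ] by (rule prod.cong[OF refl], rule prod.cong[OF refl]) (simp add: nF)
    also have "\<dots> = (\<Prod>k<r. \<Prod>t<N. strip_mat n m (int t) (ys k (int t - 1)) (ys k (int t)))"
      by (rule prod.swap)
    also have "\<dots> = (\<Prod>y\<in>Y. \<Prod>t<N. strip_mat n m (int t) (y (int t - 1)) (y (int t)))"
      by (rule prod.reindex_bij_betw[OF ys])
    also have "\<dots> = ?wt Y"
    proof (rule prod.cong[OF refl])
      fix y
      have b: "bij_betw int {..<N} {0..<2 * n}"
        using bij_betw_imageI[of int "{..<N}"] image_int_atLeastLessThan[of 0 N] N by (simp add: lessThan_atLeast0)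
      show "(\<Prod>t<N. strip_mat n m (int t) (y (int t - 1)) (y (int t))) = (\<Prod>x\<in>{0..<2 * n}. strip_mat n m x (y (x - 1)) (y x))"
        by (rule prod.reindex_bij_betw[OF b])
    qed
    finally show "G (F Y) = ?wt Y" .
  next
    fix Sq assume "Sq \<in> SQ'"
    then have Sq: "Sq \<in> SQ" and st: "\<And>t k. t < N \<Longrightarrow> k < r \<Longrightarrow> path_step (int t) (nth_elem (Sq t) k) (nth_elem (Sq (Suc t)) k)"
      by (simp_all add: SQ'_def)
    have S0N: "Sq 0 = Sq N" using Sq by (simp add: SQ_def)
    have SK: "finite (Sq t)" "card (Sq t) = r" "Sq t \<subseteq> ?J" if "t \<le> N" for t
      using K[OF SQK[OF Sq that]] by blast+
    have tN: "nat (x mod (2 * n)) < N" for x using n N by (simp add: nat_less_iff)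
    have zlt: "z Sq k x < z Sq l x" if "k < l" "l < r" for k l x
    proof -
      have "nat ((x + 1) mod (2 * n)) \<le> N" using tN less_imp_le by blast
      from SK[OF this] that show ?thesis unfolding z_def by (simp add: nth_elem_less_iff)
    qed
    have zcl: "z Sq k \<in> closed_paths n m" if k: "k < r" for k
      unfolding closed_paths_def mem_Collect_eq
    proof (intro conjI allI)
      fix x
      have "nat ((x + 1) mod (2 * n)) \<le> N" using tN less_imp_le by blast
      from SK[OF this] have "z Sq k x \<in> ?J" unfolding z_def using nth_elem_in k by blast
      then show "0 \<le> z Sq k x" "z Sq k x < m" by simp_all
      have "x + 2 * n + 1 = x + 1 + 2 * n" by simp
      then show "z Sq k (x + 2 * n) = z Sq k x" unfolding z_def by (simp only: mod_add_self2)
      define t where "t = nat (x mod (2 * n))"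
      have t: "int t = x mod (2 * n)" "t < N" using n tN by (simp_all add: t_def)
      \<comment> \<open>The last column of a turn wraps around, which is where
        \<open>Sq 0 = Sq N\<close> enters.\<close>
      have "Sq (nat ((x + 1) mod (2 * n))) = Sq (Suc t)"
      proof (cases "Suc t = N")
        case True
        then have "x mod (2 * n) + 1 = 2 * n" using t(1) N(1) by linarith
        then have "(x + 1) mod (2 * n) = 0" by (metis mod_add_left_eq mod_self)
        then show ?thesis using True S0N by simp
      next
        case False
        then have lt: "x mod (2 * n) + 1 < 2 * n" using t N(1) by linarith
        have "(x + 1) mod (2 * n) = (x mod (2 * n) + 1) mod (2 * n)" by (simp only: mod_add_left_eq)
        also have "\<dots> = x mod (2 * n) + 1" using lt n by (intro mod_pos_pos_trivial) simp_all
        finally have "nat ((x + 1) mod (2 * n)) = Suc t" using t(1) by linarith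
        then show ?thesis by simp
      qed
      then have "path_step (int t) (z Sq k (x - 1)) (z Sq k x)" using st[OF t(2) k] by (simp add: z_def t_def)
      moreover have "x = int t + 2 * n * (x div (2 * n))" unfolding t(1) by simp
      ultimately show "path_step x (z Sq k (x - 1)) (z Sq k x)" by (metis path_step_shift(2))
    qed
    have zinj: "inj_on (z Sq) {..<r}"
    proof (rule inj_onI)
      fix k l assume "k \<in> {..<r}" "l \<in> {..<r}" "z Sq k = z Sq l"
      then show "k = l" using zlt[of k l 0] zlt[of l k 0] by (cases k l rule: linorder_cases) simp_all
    qed
    have zne: "z Sq k x \<noteq> z Sq l x" if "k < r" "l < r" "k \<noteq> l" for k l x
      using zlt[of k l x] zlt[of l k x] that by (cases k l rule: linorder_cases) simp_all
    have "pairwise (\<lambda>y z. \<forall>x. y x \<noteq> z x) (z Sq ` {..<r})"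
      unfolding pairwise_image using zne by (auto intro!: pairwiseI)
    then show "z Sq ` {..<r} \<in> disjoint_paths n m r"
      using zcl card_image[OF zinj] by (auto simp: disjoint_paths_def)
    show "F (z Sq ` {..<r}) = Sq"
    proof
      fix t
      show "F (z Sq ` {..<r}) t = Sq t"
      proof (cases "t \<le> N")
        case True
        have e: "Sq (nat (int t mod (2 * n))) = Sq t"
        proof (cases "t = N")
          case True
          then show ?thesis using S0N by (simp add: N(1))
        next
          case False
          then have "int t mod (2 * n) = int t" using \<open>t \<le> N\<close> N(1) by (intro mod_pos_pos_trivial) linarith+
          then show ?thesis by simp
        qed
        have "F (z Sq ` {..<r}) t = (\<lambda>k. nth_elem (Sq (nat (int t mod (2 * n)))) k) ` {..<r}"
          using True by (simp add: F_def image_image z_def)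
        also have "\<dots> = nth_elem (Sq t) ` {..<card (Sq t)}" unfolding e using SK(2)[OF True] by simp
        also have "\<dots> = Sq t" using nth_elem_bij[OF SK(1)[OF True]] by (simp add: bij_betw_def)
        finally show ?thesis .
      next
        case False
        then show ?thesis using Sq by (auto simp: F_def SQ_def PiE_def extensional_def)
      qed
    qed
  qed
  show ?thesis unfolding 4 N_def[symmetric] using 1 2 3 by simp
qed

section \<open>The network polynomial as a characteristic polynomial\<close>

lemma emb_hom: "comm_ring_hom emb"
  by unfold_locales (simp_all add: emb_def flip: to_ac_add to_ac_mult to_ac_0 to_ac_1 One_fract_def Zero_fract_def)

definition turn_mat :: "int \<Rightarrow> int \<Rightarrow> int \<Rightarrow> int \<Rightarrow> laurent" where
  "turn_mat n m = prod_mat {0..<m} (strip_mat n m) 0 (nat (2 * n))"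

text \<open>The trace of the \<open>r\<close>-th compound matrix, that is, the \<open>r\<close>-th
  elementary symmetric function of the eigenvalues of \<open>turn_mat\<close>.\<close>

definition trace_minors :: "int \<Rightarrow> int \<Rightarrow> nat \<Rightarrow> laurent" where
  "trace_minors n m r = (\<Sum>S\<in>ksubsets {0..<m} r. minor (turn_mat n m) S S)"

lemma disjoint_paths_card:
  assumes "Y \<in> disjoint_paths n m r"
  shows "r \<le> nat m"
proof -
  have Y: "Y \<subseteq> closed_paths n m" "card Y = r" "finite Y" using assms by (simp_all add: disjoint_paths_def)
  have "inj_on (\<lambda>y. y 0) Y"
    using assms by (intro inj_onI) (auto simp: disjoint_paths_def pairwise_def)
  then have "card Y = card ((\<lambda>y. y 0) ` Y)" by (simp add: card_image)
  also have "\<dots> \<le> card {0..<m}"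
    by (rule card_mono) (use Y(1) in \<open>auto simp: closed_paths_def\<close>)
  finally show ?thesis using Y(2) by simp
qed

text \<open>Constant heights are closed paths. Hence all \<open>r\<close> up to \<open>m\<close>
  occur, and the maximal winding number is \<open>m\<close>.\<close>

lemma disjoint_paths_nonempty:
  assumes "r \<le> nat m"
  shows "disjoint_paths n m r \<noteq> {}"
proof -
  define Y where "Y = (\<lambda>j (x::int). j) ` {0..<int r}"
  have inj: "inj_on (\<lambda>j (x::int). j) {0..<int r}" by (rule inj_onI) (simp add: fun_eq_iff)
  have "Y \<subseteq> closed_paths n m" using assms by (auto simp: Y_def closed_paths_def path_step_refl)
  moreover have "card Y = r" using card_image[OF inj] by (simp add: Y_def)
  moreover have "pairwise (\<lambda>y z. \<forall>x. y x \<noteq> z x) Y" by (auto simp: Y_def pairwise_def)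
  ultimately have "Y \<in> disjoint_paths n m r" by (simp add: disjoint_paths_def Y_def)
  then show ?thesis by blast
qed

lemma r_cycles_nonempty_iff:
  assumes "n \<ge> 1"
  shows "r_cycles n m r \<noteq> {} \<longleftrightarrow> r \<le> nat m"
  unfolding r_cycles_eq[OF assms] using disjoint_paths_card disjoint_paths_nonempty by blast

lemma r_cycle_wind_eq:
  assumes "n \<ge> 1" "S \<in> r_cycles n m r"
  shows "r_cycle_wind n m S = int r"
  using assms(2) unfolding r_cycles_eq[OF assms(1)] using r_cycle_path_cycles(1)[OF assms(1)] by blast

lemma max_wind_eq:
  assumes n: "n \<ge> 1" and m: "m \<ge> 0"
  shows "max_wind n m = m"
proof -
  have "(\<Union>r. r_cycle_wind n m ` r_cycles n m r) = int ` {..nat m}"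
  proof (intro equalityI subsetI)
    fix x assume "x \<in> (\<Union>r. r_cycle_wind n m ` r_cycles n m r)"
    then obtain r S where S: "S \<in> r_cycles n m r" "x = r_cycle_wind n m S" by blast
    then have "r \<le> nat m" using r_cycles_nonempty_iff[OF n] by blast
    then show "x \<in> int ` {..nat m}" using r_cycle_wind_eq[OF n S(1)] S(2) by simp
  next
    fix x assume "x \<in> int ` {..nat m}"
    then obtain r where r: "x = int r" "r \<le> nat m" by auto
    then have "r_cycles n m r \<noteq> {}" using r_cycles_nonempty_iff[OF n] by simp
    then obtain S where "S \<in> r_cycles n m r" by blast
    then have "S \<in> r_cycles n m r" "x = r_cycle_wind n m S" using r_cycle_wind_eq[OF n] r(1) by simp_all
    then show "x \<in> (\<Union>r. r_cycle_wind n m ` r_cycles n m r)" by (intro UN_I[OF UNIV_I] image_eqI)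
  qed
  moreover have "Max (int ` {..nat m}) = m"
  proof (rule Max_eqI)
    show "y \<le> m" if "y \<in> int ` {..nat m}" for y using that m by auto
    show "m \<in> int ` {..nat m}" by (rule image_eqI[of _ _ "nat m"]) (simp_all add: m)
  qed simp
  ultimately show ?thesis by (simp add: max_wind_def)
qed

lemma sum_r_cycle_wt:
  assumes n: "n \<ge> 1"
  shows "(\<Sum>S\<in>r_cycles n m r. r_cycle_wt n m S) = trace_minors n m r"
proof -
  have "(\<Sum>S\<in>r_cycles n m r. r_cycle_wt n m S) = (\<Sum>Y\<in>disjoint_paths n m r. r_cycle_wt n m (path_cycle n ` Y))"
    unfolding r_cycles_eq[OF n] by (rule sum.reindex[OF inj_on_image_path_cycle[OF n], unfolded o_def])
  moreover have "\<dots> = (\<Sum>Y\<in>disjoint_paths n m r. \<Prod>y\<in>Y. \<Prod>x\<in>{0..<2 * n}. strip_mat n m x (y (x - 1)) (y x))"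
    by (rule sum.cong[OF refl], rule r_cycle_path_cycles(2)[OF n])
  ultimately show ?thesis unfolding trace_minors_def turn_mat_def sum_disjoint_paths[OF n] by (rule trans)
qed

lemma monom_sum: "(\<Sum>i\<in>A. Polynomial.monom (f i) k) = Polynomial.monom (\<Sum>i\<in>A. f i) k"
  by (induction A rule: infinite_finite_induct) (simp_all add: add_monom)

lemma Q_net_eq:
  assumes n: "n \<ge> 1" and m: "m \<ge> 0"
  shows "Q_net n m = (\<Sum>r\<le>nat m. Polynomial.monom ((- 1) ^ (nat m - r) * trace_minors n m r) (nat m - r))"
proof -
  have "{r. r_cycles n m r \<noteq> {}} = {..nat m}" using r_cycles_nonempty_iff[OF n] by auto
  then have 1: "Q_net n m = (\<Sum>r\<le>nat m. (- 1) ^ (nat m - r) * (\<Sum>S\<in>r_cycles n m r.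
      Polynomial.monom (r_cycle_wt n m S) (nat (m - r_cycle_wind n m S))))"
    unfolding Q_net_def max_wind_eq[OF n m] by (simp only:)
  have 2: "(\<Sum>S\<in>r_cycles n m r. Polynomial.monom (r_cycle_wt n m S) (nat (m - r_cycle_wind n m S))) =
      Polynomial.monom (trace_minors n m r) (nat m - r)" for r
  proof -
    have "nat (m - int r) = nat m - r" by (simp add: nat_diff_distrib')
    then have "(\<Sum>S\<in>r_cycles n m r. Polynomial.monom (r_cycle_wt n m S) (nat (m - r_cycle_wind n m S))) =
        (\<Sum>S\<in>r_cycles n m r. Polynomial.monom (r_cycle_wt n m S) (nat m - r))"
      by (intro sum.cong refl) (simp add: r_cycle_wind_eq[OF n])
    then show ?thesis by (simp add: monom_sum sum_r_cycle_wt[OF n])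
  qed
  have 3: "(- 1) ^ k * Polynomial.monom a k = Polynomial.monom ((- 1) ^ k * a) k" for a :: laurent and k
    by (cases "even k") (simp_all add: minus_monom)
  show ?thesis unfolding 1 2 3 ..
qed

text \<open>Vieta's formulas, arranged by \<open>r\<close> in order to be compared with
  \<open>Q_net_eq\<close>.\<close>

lemma prod_linear_factors:
  fixes u :: "nat \<Rightarrow> 'a::comm_ring_1"
  shows "(\<Prod>k<N. [:- u k, 1:]) =
    (\<Sum>r\<le>N. Polynomial.monom ((- 1) ^ r * (\<Sum>K\<in>ksubsets {..<N} r. \<Prod>k\<in>K. u k)) (N - r))"
proof -
  have "(\<Prod>k<N. [:- u k, 1:]) = (\<Prod>k<N. [:- u k:] + Polynomial.monom 1 1)"
    by (simp add: monom_altdef)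
  also have "\<dots> = (\<Sum>K\<in>Pow {..<N}. (\<Prod>k\<in>K. [:- u k:]) * (\<Prod>k\<in>{..<N} - K. Polynomial.monom 1 1))"
    by (rule prod_add) simp
  also have "\<dots> = (\<Sum>K\<in>Pow {..<N}. Polynomial.monom ((- 1) ^ card K * (\<Prod>k\<in>K. u k)) (N - card K))"
  proof (rule sum.cong[OF refl])
    fix K assume "K \<in> Pow {..<N}"
    then have K: "K \<subseteq> {..<N}" "finite K" using finite_subset by auto
    have "(\<Prod>k\<in>K. [:- u k:]) = [:(\<Prod>k\<in>K. - u k):]"
      using K(2) by (induction K) (simp_all add: one_pCons)
    moreover have "(\<Prod>k\<in>K. - u k) = (- 1) ^ card K * (\<Prod>k\<in>K. u k)" by (rule prod_uminus)
    moreover have "(\<Prod>k\<in>{..<N} - K. Polynomial.monom (1::'a) 1) = Polynomial.monom 1 (N - card K)"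
      using K by (simp add: monom_power card_Diff_subset)
    ultimately show "(\<Prod>k\<in>K. [:- u k:]) * (\<Prod>k\<in>{..<N} - K. Polynomial.monom 1 1) =
      Polynomial.monom ((- 1) ^ card K * (\<Prod>k\<in>K. u k)) (N - card K)" by (simp add: smult_monom)
  qed
  also have "\<dots> = (\<Sum>r\<le>N. \<Sum>K\<in>{K \<in> Pow {..<N}. card K = r}. Polynomial.monom ((- 1) ^ card K * (\<Prod>k\<in>K. u k)) (N - card K))"
    by (rule sum.group[symmetric]) (auto dest: card_mono[rotated])
  also have "\<dots> = (\<Sum>r\<le>N. Polynomial.monom ((- 1) ^ r * (\<Sum>K\<in>ksubsets {..<N} r. \<Prod>k\<in>K. u k)) (N - r))"
  proof (rule sum.cong[OF refl])
    fix r
    have "{K \<in> Pow {..<N}. card K = r} = ksubsets {..<N} r" by (auto simp: ksubsets_def)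
    moreover have "(\<Sum>K\<in>ksubsets {..<N} r. Polynomial.monom ((- 1) ^ card K * (\<Prod>k\<in>K. u k)) (N - card K)) =
        (\<Sum>K\<in>ksubsets {..<N} r. Polynomial.monom ((- 1) ^ r * (\<Prod>k\<in>K. u k)) (N - r))"
      by (rule sum.cong) (simp_all add: ksubsets_def)
    ultimately show "(\<Sum>K\<in>{K \<in> Pow {..<N}. card K = r}. Polynomial.monom ((- 1) ^ card K * (\<Prod>k\<in>K. u k)) (N - card K)) =
      Polynomial.monom ((- 1) ^ r * (\<Sum>K\<in>ksubsets {..<N} r. \<Prod>k\<in>K. u k)) (N - r)"
      by (simp add: monom_sum sum_distrib_left)
  qed
  finally show ?thesis .
qed

text \<open>\<open>root_list\<close> chooses an unknown order of the roots, so it is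
  \<open>u\<close> up to a permutation; a product over all \<open>r\<close>-subsets does not depend
  on the order.\<close>

lemma elem_sym_poly_roots:
  fixes u :: "nat \<Rightarrow> 'a::alg_closed_field"
  assumes P: "proots P = mset (map u [0..<N])"
  shows "elem_sym_poly r P = (\<Prod>K\<in>ksubsets {..<N} r. [:- (\<Prod>k\<in>K. u k), 1:])"
proof -
  define gs where "gs = root_list P"
  have "\<exists>gs. mset gs = proots P" by (rule ex_mset)
  then have gs: "mset gs = mset (map u [0..<N])" unfolding gs_def root_list_def P[symmetric] by (rule someI_ex)
  obtain p where p: "p permutes {..<length (map u [0..<N])}" "permute_list p (map u [0..<N]) = gs"
    using mset_eq_permutation[OF gs] by blast
  have len: "length gs = N" using mset_eq_length[OF gs] by simp
  have pN: "p permutes {..<N}" using p(1) by simp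
  have nth: "gs ! k = u (p k)" if "k < N" for k
    using permute_list_nth[OF p(1), of k] p(2) that permutes_in_image[OF pN, of k] by simp
  have inj: "inj_on p A" for A using permutes_inj[OF pN] by (rule inj_on_subset) simp
  have "elem_sym_poly r P = (\<Prod>K\<in>ksubsets {..<N} r. [:- (\<Prod>k\<in>K. gs ! k), 1:])"
    unfolding elem_sym_poly_def gs_def[symmetric] len ksubsets_def ..
  also have "\<dots> = (\<Prod>K\<in>ksubsets {..<N} r. [:- (\<Prod>k\<in>p ` K. u k), 1:])"
  proof (rule prod.cong[OF refl])
    fix K assume "K \<in> ksubsets {..<N} r"
    then have K: "K \<subseteq> {..<N}" by (simp add: ksubsets_def)
    have "(\<Prod>k\<in>p ` K. u k) = (\<Prod>k\<in>K. u (p k))" by (rule prod.reindex[OF inj, unfolded o_def])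
    also have "\<dots> = (\<Prod>k\<in>K. gs ! k)" by (rule prod.cong[OF refl]) (use K nth in auto)
    finally show "[:- (\<Prod>k\<in>K. gs ! k), 1:] = [:- (\<Prod>k\<in>p ` K. u k), 1:]" by simp
  qed
  also have "\<dots> = (\<Prod>K\<in>ksubsets {..<N} r. [:- (\<Prod>k\<in>K. u k), 1:])"
  proof (rule prod.reindex_bij_betw)
    show "bij_betw (\<lambda>K. p ` K) (ksubsets {..<N} r) (ksubsets {..<N} r)"
    proof (rule bij_betw_byWitness[where f' = "\<lambda>K. inv_into UNIV p ` K"])
      show "\<forall>K\<in>ksubsets {..<N} r. inv_into UNIV p ` p ` K = K"
        using permutes_inverses(2)[OF pN] by (simp add: image_image)
      show "\<forall>K\<in>ksubsets {..<N} r. p ` inv_into UNIV p ` K = K"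
        using permutes_inverses(1)[OF pN] by (simp add: image_image)
      show "(\<lambda>K. p ` K) ` ksubsets {..<N} r \<subseteq> ksubsets {..<N} r"
        using permutes_image[OF pN] card_image[OF inj] by (auto simp: ksubsets_def)
      have pi: "inv_into UNIV p permutes {..<N}" by (rule permutes_inv[OF pN])
      have "inj_on (inv_into UNIV p) A" for A using permutes_inj[OF pi] by (rule inj_on_subset) simp
      then show "(\<lambda>K. inv_into UNIV p ` K) ` ksubsets {..<N} r \<subseteq> ksubsets {..<N} r"
        using permutes_image[OF pi] card_image[of "inv_into UNIV p"] unfolding ksubsets_def
        by (intro image_subsetI) (simp, metis image_mono)
    qed
  qed
  finally show ?thesis .
qed

theorem turn_mat_recurrence:
  assumes n: "n \<ge> 1" and m: "m \<ge> 0" and S: "S \<in> ksubsets {0..<m} r" "S' \<in> ksubsets {0..<m} r"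
  shows "recurrence_at (Q_net_e n m r) (\<lambda>k. emb (minor (prod_mat {0..<m} (\<lambda>_. turn_mat n m) 0 k) S S')) k"
proof -
  interpret comm_ring_hom emb by (rule emb_hom)
  let ?J = "{0..<m}"
  let ?A = "\<lambda>s s'. emb (turn_mat n m s s')"
  have N: "card ?J = nat m" by simp
  obtain u where u: "\<forall>r. (\<Sum>S\<in>ksubsets ?J r. minor ?A S S) = (\<Sum>K\<in>ksubsets {..<nat m} r. \<Prod>k\<in>K. u k) \<and>
     (\<forall>S\<in>ksubsets ?J r. \<forall>S'\<in>ksubsets ?J r. \<forall>k.
        recurrence_at (\<Prod>K\<in>ksubsets {..<nat m} r. [:- (\<Prod>k\<in>K. u k), 1:])
          (\<lambda>k. minor (prod_mat ?J (\<lambda>_. ?A) 0 k) S S') k)"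
    using compound_recurrence[of ?J ?A, OF finite_atLeastLessThan_int, unfolded N] by (elim exE)
  note u1 = u[THEN spec, THEN conjunct1] and u2 = u[THEN spec, THEN conjunct2, rule_format]
  have W: "emb (trace_minors n m r) = (\<Sum>K\<in>ksubsets {..<nat m} r. \<Prod>k\<in>K. u k)" for r
    unfolding trace_minors_def hom_sum hom_minor[OF emb_hom] by (rule u1)
  \<comment> \<open>The sign of the \<open>r\<close>-cycles differs from the sign in Vieta's
    formulas by the factor \<open>(- 1) ^ nat m\<close>, which is independent of \<open>r\<close>
    and leaves the roots unchanged.\<close>
  have "map_poly emb (Q_net n m) = Polynomial.smult ((- 1) ^ nat m) (\<Prod>k<nat m. [:- u k, 1:])"
  proof -
    have s: "(- 1 :: ratfun_closure) ^ (nat m - r) = (- 1) ^ nat m * (- 1) ^ r" if "r \<le> nat m" for r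
      using that by (metis (no_types, lifting) le_add_diff_inverse2 left_minus_one_mult_self mult.commute power_add)
    have "map_poly emb (Q_net n m) = (\<Sum>r\<le>nat m. map_poly emb (Polynomial.monom ((- 1) ^ (nat m - r) * trace_minors n m r) (nat m - r)))"
      unfolding Q_net_eq[OF n m]
      by (rule poly_eqI) (auto simp: coeff_map_poly coeff_sum hom_sum intro!: sum.cong)
    also have "\<dots> = (\<Sum>r\<le>nat m. Polynomial.monom ((- 1) ^ (nat m - r) * (\<Sum>K\<in>ksubsets {..<nat m} r. \<Prod>k\<in>K. u k)) (nat m - r))"
      by (rule sum.cong[OF refl]) (simp add: map_poly_monom hom_mult hom_power hom_uminus W)
    also have "\<dots> = (\<Sum>r\<le>nat m. Polynomial.smult ((- 1) ^ nat m) (Polynomial.monom ((- 1) ^ r * (\<Sum>K\<in>ksubsets {..<nat m} r. \<Prod>k\<in>K. u k)) (nat m - r)))"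
      by (rule sum.cong[OF refl]) (simp add: smult_monom s mult.assoc)
    finally show ?thesis unfolding prod_linear_factors smult_sum2 .
  qed
  then have "proots (map_poly emb (Q_net n m)) = proots (\<Prod>k<nat m. [:- u k, 1:])" by simp
  also have "\<dots> = (\<Sum>k<nat m. proots [:- u k, 1:])" by (rule proots_prod) simp
  also have "\<dots> = mset (map u [0..<nat m])"
  proof -
    have "(\<Sum>k<N. proots [:- u k, 1:]) = mset (map u [0..<N])" for N
      by (induction N) simp_all
    then show ?thesis .
  qed
  finally have "elem_sym_poly r (map_poly emb (Q_net n m)) = (\<Prod>K\<in>ksubsets {..<nat m} r. [:- (\<Prod>k\<in>K. u k), 1:])"
    by (rule elem_sym_poly_roots)
  moreover have "emb (minor (prod_mat ?J (\<lambda>_. turn_mat n m) 0 k) S S') = minor (prod_mat ?J (\<lambda>_. ?A) 0 k) S S'" for k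
  proof -
    have "emb (minor (prod_mat ?J (\<lambda>_. turn_mat n m) 0 k) S S') =
        minor (\<lambda>s s'. emb (prod_mat ?J (\<lambda>_. turn_mat n m) 0 k s s')) S S'" by (rule hom_minor[OF emb_hom])
    then show ?thesis unfolding hom_prod_mat[OF emb_hom] .
  qed
  ultimately show ?thesis unfolding Q_net_e_def using u2[OF S] by simp
qed

section \<open>Domino tilings as sets of lattice positions\<close>

text \<open>A horizontal domino is indexed by its right cell and a vertical one by its upper cell.
  The index is also a lattice point, the midpoint of the lower or left long side, and its first
  coordinate is the vertical line that a horizontal domino crosses.\<close>

definition hdom :: "int \<Rightarrow> int \<Rightarrow> (real \<times> real) set" where
  "hdom x y = rect (x - 1) y (x + 1) (y + 1)"

definition vdom :: "int \<Rightarrow> int \<Rightarrow> (real \<times> real) set" where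
  "vdom x y = rect x (y - 1) (x + 1) (y + 1)"

definition region :: "(int \<times> int) set \<Rightarrow> (real \<times> real) set" where
  "region C = (\<Union>(a, b)\<in>C. unit_square a b)"

definition tiles :: "(int \<times> int) set \<times> (int \<times> int) set \<Rightarrow> (real \<times> real) set set" where
  "tiles = (\<lambda>(H, V). (\<lambda>(x, y). hdom x y) ` H \<union> (\<lambda>(x, y). vdom x y) ` V)"

text \<open>The four summands stand for the domino on the cell extending to the left, right, below
  or above. That their sum is 1 expresses covering and disjointness at once.\<close>

definition discrete_tilings :: "(int \<times> int) set \<Rightarrow> ((int \<times> int) set \<times> (int \<times> int) set) set" where
  "discrete_tilings C = {(H, V).
     (\<forall>x y. (x, y) \<in> H \<longrightarrow> (x - 1, y) \<in> C \<and> (x, y) \<in> C) \<and>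
     (\<forall>x y. (x, y) \<in> V \<longrightarrow> (x, y - 1) \<in> C \<and> (x, y) \<in> C) \<and>
     (\<forall>x y. (x, y) \<in> C \<longrightarrow> of_bool ((x, y) \<in> H) + of_bool ((x + 1, y) \<in> H) +
        of_bool ((x, y) \<in> V) + of_bool ((x, y + 1) \<in> V) = (1::nat))}"

lemma mem_rect: "(px, py) \<in> rect a b a' b' \<longleftrightarrow>
    of_int a \<le> px \<and> px \<le> of_int a' \<and> of_int b \<le> py \<and> py \<le> of_int b'"
  by (auto simp: rect_def)

lemma interior_rect: "interior (rect a b a' b') = {of_int a<..<of_int a'} \<times> {of_int b<..<of_int b'}"
  by (simp add: rect_def interior_Times interior_atLeastAtMost_real)

lemma rect_eq_iff:
  assumes "a < a'" "b < b'"
  shows "rect a b a' b' = rect c d c' d' \<longleftrightarrow> a = c \<and> b = d \<and> a' = c' \<and> b' = d'"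
  using assms by (auto simp: rect_def times_eq_iff Icc_eq_Icc)

lemma rect_int_overlap:
  assumes "interior (rect a b a' b') \<inter> interior (rect c d c' d') \<noteq> {}"
  shows "a < c'" "c < a'" "b < d'" "d < b'" "a < a'" "c < c'" "b < b'" "d < d'"
proof -
  obtain px py where "of_int a < px" "px < of_int a'" "of_int b < py" "py < of_int b'"
    "of_int c < px" "px < of_int c'" "of_int d < py" "(py::real) < of_int d'" "(px::real) < of_int c'"
    using assms unfolding interior_rect by auto
  then have "real_of_int a < of_int c'" "real_of_int c < of_int a'" "real_of_int b < of_int d'" "real_of_int d < of_int b'"
    "real_of_int a < of_int a'" "real_of_int c < of_int c'" "real_of_int b < of_int b'" "real_of_int d < of_int d'" by linarith+
  then show "a < c'" "c < a'" "b < d'" "d < b'" "a < a'" "c < c'" "b < b'" "d < d'" by (simp_all only: of_int_less_iff)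
qed

lemma dominoes_eq: "dominoes = (\<lambda>(x, y). hdom x y) ` UNIV \<union> (\<lambda>(x, y). vdom x y) ` UNIV"
proof -
  have 1: "rect a b (a + 2) (b + 1) = hdom (a + 1) b" "rect a b (a + 1) (b + 2) = vdom a (b + 1)" for a b
    by (simp_all add: hdom_def vdom_def add.commute)
  have 2: "hdom a b = rect (a - 1) b (a - 1 + 2) (b + 1)" "vdom a b = rect a (b - 1) (a + 1) (b - 1 + 2)" for a b
    by (simp_all add: hdom_def vdom_def add.commute)
  have "{rect a b (a + 2) (b + 1) | a b. True} = (\<lambda>(x, y). hdom x y) ` UNIV"
  proof (intro equalityI subsetI)
    fix D assume "D \<in> {rect a b (a + 2) (b + 1) | a b. True}"
    then obtain a b where "D = hdom (a + 1) b" unfolding 1 by blast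
    then show "D \<in> (\<lambda>(x, y). hdom x y) ` UNIV" by (intro image_eqI[of _ _ "(a + 1, b)"]) simp_all
  next
    fix D assume "D \<in> (\<lambda>(x, y). hdom x y) ` UNIV"
    then obtain a b where "D = hdom a b" by auto
    then show "D \<in> {rect a b (a + 2) (b + 1) | a b. True}" unfolding 2(1) by blast
  qed
  moreover have "{rect a b (a + 1) (b + 2) | a b. True} = (\<lambda>(x, y). vdom x y) ` UNIV"
  proof (intro equalityI subsetI)
    fix D assume "D \<in> {rect a b (a + 1) (b + 2) | a b. True}"
    then obtain a b where "D = vdom a (b + 1)" unfolding 1 by blast
    then show "D \<in> (\<lambda>(x, y). vdom x y) ` UNIV" by (intro image_eqI[of _ _ "(a, b + 1)"]) simp_all
  next
    fix D assume "D \<in> (\<lambda>(x, y). vdom x y) ` UNIV"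
    then obtain a b where "D = vdom a b" by auto
    then show "D \<in> {rect a b (a + 1) (b + 2) | a b. True}" unfolding 2(2) by blast
  qed
  ultimately show ?thesis unfolding dominoes_def by (simp only:)
qed

lemma dom_eq_iff [simp]:
  "hdom x y = hdom x' y' \<longleftrightarrow> x = x' \<and> y = y'" "vdom x y = vdom x' y' \<longleftrightarrow> x = x' \<and> y = y'"
  "hdom x y \<noteq> vdom x' y'" "vdom x' y' \<noteq> hdom x y"
  by (auto simp: hdom_def vdom_def rect_eq_iff)

lemma mem_tiles [simp]:
  "hdom x y \<in> tiles (H, V) \<longleftrightarrow> (x, y) \<in> H" "vdom x y \<in> tiles (H, V) \<longleftrightarrow> (x, y) \<in> V"
  by (auto simp: tiles_def)

lemma tilesE:
  assumes "D \<in> tiles (H, V)"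
  obtains x y where "D = hdom x y" "(x, y) \<in> H" | x y where "D = vdom x y" "(x, y) \<in> V"
  using assms by (auto simp: tiles_def)

lemma region_cell:
  assumes "(px, py) \<in> region C" "of_int a < px" "px < of_int a + 1" "of_int b < py" "py < of_int b + 1"
  shows "(a, b) \<in> C"
proof -
  obtain c d where cd: "(c, d) \<in> C" "(px, py) \<in> unit_square c d" using assms(1) by (auto simp: region_def)
  then have "real_of_int c < of_int (a + 1)" "real_of_int a < of_int (c + 1)"
    "real_of_int d < of_int (b + 1)" "real_of_int b < of_int (d + 1)"
    using assms by (simp_all add: mem_rect)
  then have "c = a" "d = b" by (simp_all only: of_int_less_iff)
  then show ?thesis using cd by simp
qed

lemma unit_square_subset_region: "unit_square a b \<subseteq> region C \<longleftrightarrow> (a, b) \<in> C"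
proof
  assume "unit_square a b \<subseteq> region C"
  moreover have "(real_of_int a + 1/2, real_of_int b + 1/2) \<in> unit_square a b" by (simp add: mem_rect)
  ultimately have "(real_of_int a + 1/2, real_of_int b + 1/2) \<in> region C" by blast
  then show "(a, b) \<in> C" by (rule region_cell) simp_all
qed (auto simp: region_def)

lemma hdom_split: "hdom x y = unit_square (x - 1) y \<union> unit_square x y"
  by (auto simp: hdom_def mem_rect set_eq_iff)

lemma vdom_split: "vdom x y = unit_square x (y - 1) \<union> unit_square x y"
  by (auto simp: vdom_def mem_rect set_eq_iff)

lemma hdom_subset_region: "hdom x y \<subseteq> region C \<longleftrightarrow> (x - 1, y) \<in> C \<and> (x, y) \<in> C"
  unfolding hdom_split Un_subset_iff unit_square_subset_region ..

lemma vdom_subset_region: "vdom x y \<subseteq> region C \<longleftrightarrow> (x, y - 1) \<in> C \<and> (x, y) \<in> C"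
  unfolding vdom_split Un_subset_iff unit_square_subset_region ..

lemma unit_square_subset_dom:
  "unit_square a b \<subseteq> hdom a b" "unit_square a b \<subseteq> hdom (a + 1) b"
  "unit_square a b \<subseteq> vdom a b" "unit_square a b \<subseteq> vdom a (b + 1)"
  by (auto simp: hdom_def vdom_def mem_rect)

lemma tile_through_cell:
  assumes D: "D = hdom x y \<or> D = vdom x y" and c: "(of_int a + 1/2, of_int b + 1/2) \<in> D"
  shows "D \<in> {hdom a b, hdom (a + 1) b, vdom a b, vdom a (b + 1)}"
  using D
proof
  assume D: "D = hdom x y"
  have "real_of_int (x - 1) < of_int (a + 1)" "real_of_int a < of_int (x + 1)"
    "real_of_int y < of_int (b + 1)" "real_of_int b < of_int (y + 1)"
    using c unfolding D hdom_def mem_rect by simp_all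
  then have "x = a \<or> x = a + 1" "y = b" by (simp_all only: of_int_less_iff) linarith+
  then show ?thesis using D by auto
next
  assume D: "D = vdom x y"
  have "real_of_int x < of_int (a + 1)" "real_of_int a < of_int (x + 1)"
    "real_of_int (y - 1) < of_int (b + 1)" "real_of_int b < of_int (y + 1)"
    using c unfolding D vdom_def mem_rect by simp_all
  then have "x = a" "y = b \<or> y = b + 1" by (simp_all only: of_int_less_iff) linarith+
  then show ?thesis using D by auto
qed

lemma cell_center_interior:
  "D \<in> {hdom a b, hdom (a + 1) b, vdom a b, vdom a (b + 1)} \<Longrightarrow> (of_int a + 1/2, of_int b + 1/2) \<in> interior D"
  by (auto simp: hdom_def vdom_def interior_rect)

text \<open>Rectangles with integer corners whose interiors meet share a whole cell; its lower left
  corner is the coordinatewise maximum of their lower left corners.\<close>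

lemma overlap_cell:
  assumes D: "D = hdom x y \<or> D = vdom x y" and E: "E = hdom x' y' \<or> E = vdom x' y'"
    and ne: "interior D \<inter> interior E \<noteq> {}"
  obtains a b where "D \<in> {hdom a b, hdom (a + 1) b, vdom a b, vdom a (b + 1)}"
    "E \<in> {hdom a b, hdom (a + 1) b, vdom a b, vdom a (b + 1)}"
proof -
  have rD: "\<exists>a b a' b'. D = rect a b a' b' \<and> (\<forall>p q. a \<le> p \<and> p < a' \<and> b \<le> q \<and> q < b' \<longrightarrow>
      D \<in> {hdom p q, hdom (p + 1) q, vdom p q, vdom p (q + 1)})"
    if "D = hdom x y \<or> D = vdom x y" for D x y
    using that
  proof
    assume D: "D = hdom x y"
    show ?thesis
      by (rule exI[of _ "x - 1"], rule exI[of _ y], rule exI[of _ "x + 1"], rule exI[of _ "y + 1"])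
        (auto simp: D hdom_def[symmetric])
  next
    assume D: "D = vdom x y"
    show ?thesis
      by (rule exI[of _ x], rule exI[of _ "y - 1"], rule exI[of _ "x + 1"], rule exI[of _ "y + 1"])
        (auto simp: D vdom_def[symmetric])
  qed
  obtain a b a' b' where 1: "D = rect a b a' b'"
    "\<And>p q. a \<le> p \<and> p < a' \<and> b \<le> q \<and> q < b' \<Longrightarrow> D \<in> {hdom p q, hdom (p + 1) q, vdom p q, vdom p (q + 1)}"
    using rD[OF D] by auto
  obtain c d c' d' where 2: "E = rect c d c' d'"
    "\<And>p q. c \<le> p \<and> p < c' \<and> d \<le> q \<and> q < d' \<Longrightarrow> E \<in> {hdom p q, hdom (p + 1) q, vdom p q, vdom p (q + 1)}"
    using rD[OF E] by auto
  note ov = rect_int_overlap[OF ne[unfolded 1(1) 2(1)]]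
  show thesis
    by (rule that[of "max a c" "max b d"]; (rule 1(2) | rule 2(2))) (use ov in auto)
qed

text \<open>Cell centres decide everything: a domino containing the centre of a cell is one of the
  four on that cell and contains the centre in its interior, so two different tiles at the same
  centre would overlap.\<close>

lemma discrete_tiling_iff:
  "(H, V) \<in> discrete_tilings C \<longleftrightarrow> domino_tiling (region C) (tiles (H, V))"
proof
  assume HV: "(H, V) \<in> discrete_tilings C"
  then have H: "\<And>x y. (x, y) \<in> H \<Longrightarrow> (x - 1, y) \<in> C \<and> (x, y) \<in> C"
    and V: "\<And>x y. (x, y) \<in> V \<Longrightarrow> (x, y - 1) \<in> C \<and> (x, y) \<in> C"
    and one: "\<And>x y. (x, y) \<in> C \<Longrightarrow> of_bool ((x, y) \<in> H) + of_bool ((x + 1, y) \<in> H) +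
        of_bool ((x, y) \<in> V) + of_bool ((x, y + 1) \<in> V) = (1::nat)"
    unfolding discrete_tilings_def by blast+
  show "domino_tiling (region C) (tiles (H, V))"
    unfolding domino_tiling_def
  proof (intro conjI)
    show "tiles (H, V) \<subseteq> dominoes" unfolding dominoes_eq tiles_def by auto
    have sub: "D \<subseteq> region C" if "D \<in> tiles (H, V)" for D
      using that by (elim tilesE) (simp_all add: hdom_subset_region vdom_subset_region H V)
    have "unit_square a b \<subseteq> \<Union>(tiles (H, V))" if "(a, b) \<in> C" for a b
    proof -
      have "(a, b) \<in> H \<or> (a + 1, b) \<in> H \<or> (a, b) \<in> V \<or> (a, b + 1) \<in> V"
        using one[OF that] by (auto simp: of_bool_def split: if_splits)
      then have "\<exists>D\<in>tiles (H, V). unit_square a b \<subseteq> D"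
      proof (elim disjE)
        assume "(a, b) \<in> H"
        then show ?thesis by (intro bexI[of _ "hdom a b"]) (simp_all add: unit_square_subset_dom)
      next
        assume "(a + 1, b) \<in> H"
        then show ?thesis by (intro bexI[of _ "hdom (a + 1) b"]) (simp_all add: unit_square_subset_dom)
      next
        assume "(a, b) \<in> V"
        then show ?thesis by (intro bexI[of _ "vdom a b"]) (simp_all add: unit_square_subset_dom)
      next
        assume "(a, b + 1) \<in> V"
        then show ?thesis by (intro bexI[of _ "vdom a (b + 1)"]) (simp_all add: unit_square_subset_dom)
      qed
      then show ?thesis by blast
    qed
    then have "region C \<subseteq> \<Union>(tiles (H, V))" unfolding region_def by blast
    then show "\<Union>(tiles (H, V)) = region C" using sub by blast
    show "pairwise (\<lambda>D E. interior D \<inter> interior E = {}) (tiles (H, V))"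
    proof (rule pairwiseI)
      fix D E assume D: "D \<in> tiles (H, V)" and E: "E \<in> tiles (H, V)" and "D \<noteq> E"
      obtain x y where Dx: "D = hdom x y \<or> D = vdom x y" using D by (elim tilesE) blast+
      obtain x' y' where Ex: "E = hdom x' y' \<or> E = vdom x' y'" using E by (elim tilesE) blast+
      show "interior D \<inter> interior E = {}"
      proof (rule ccontr)
        assume "interior D \<inter> interior E \<noteq> {}"
        then obtain a b where ab: "D \<in> {hdom a b, hdom (a + 1) b, vdom a b, vdom a (b + 1)}"
          "E \<in> {hdom a b, hdom (a + 1) b, vdom a b, vdom a (b + 1)}"
          using overlap_cell[OF Dx Ex] by metis
        have "(of_int a + 1/2, of_int b + 1/2) \<in> D"
          using cell_center_interior[OF ab(1)] interior_subset by blast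
        then have "(of_int a + 1/2, of_int b + 1/2) \<in> region C" using sub[OF D] by blast
        then have "(a, b) \<in> C" by (rule region_cell) simp_all
        from one[OF this] show False
          using ab D E \<open>D \<noteq> E\<close> by (auto simp: of_bool_def split: if_splits)
      qed
    qed
  qed
next
  assume "domino_tiling (region C) (tiles (H, V))"
  then have U: "\<Union>(tiles (H, V)) = region C"
    and dis: "\<And>D E. D \<in> tiles (H, V) \<Longrightarrow> E \<in> tiles (H, V) \<Longrightarrow> D \<noteq> E \<Longrightarrow> interior D \<inter> interior E = {}"
    by (auto simp: domino_tiling_def pairwise_def)
  have "(x - 1, y) \<in> C \<and> (x, y) \<in> C" if "(x, y) \<in> H" for x y
  proof -
    have "hdom x y \<subseteq> region C" using that unfolding U[symmetric] by (intro Union_upper) simp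
    then show ?thesis by (simp add: hdom_subset_region)
  qed
  moreover have "(x, y - 1) \<in> C \<and> (x, y) \<in> C" if "(x, y) \<in> V" for x y
  proof -
    have "vdom x y \<subseteq> region C" using that unfolding U[symmetric] by (intro Union_upper) simp
    then show ?thesis by (simp add: vdom_subset_region)
  qed
  moreover have "of_bool ((a, b) \<in> H) + of_bool ((a + 1, b) \<in> H) +
        of_bool ((a, b) \<in> V) + of_bool ((a, b + 1) \<in> V) = (1::nat)" if ab: "(a, b) \<in> C" for a b
  proof -
    let ?N = "{hdom a b, hdom (a + 1) b, vdom a b, vdom a (b + 1)}"
    have "(of_int a + 1/2, of_int b + 1/2) \<in> unit_square a b" by (simp add: mem_rect)
    then have "(of_int a + 1/2, of_int b + 1/2) \<in> \<Union>(tiles (H, V))"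
      unfolding U using ab unit_square_subset_region by blast
    then obtain D where D: "D \<in> tiles (H, V)" "(of_int a + 1/2, of_int b + 1/2) \<in> D" by blast
    obtain x y where "D = hdom x y \<or> D = vdom x y" using D(1) by (elim tilesE) blast+
    then have DN: "D \<in> ?N" using tile_through_cell D(2) by blast
    have uniq: "E = D" if "E \<in> ?N" "E \<in> tiles (H, V)" for E
    proof (rule ccontr)
      assume "E \<noteq> D"
      then have "interior E \<inter> interior D = {}" using dis that(2) D(1) by blast
      then show False using cell_center_interior[OF that(1)] cell_center_interior[OF DN] by blast
    qed
    have h: "(a, b) \<in> H \<longleftrightarrow> hdom a b = D" "(a + 1, b) \<in> H \<longleftrightarrow> hdom (a + 1) b = D"
      "(a, b) \<in> V \<longleftrightarrow> vdom a b = D" "(a, b + 1) \<in> V \<longleftrightarrow> vdom a (b + 1) = D"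
      using uniq[of "hdom a b"] uniq[of "hdom (a + 1) b"] uniq[of "vdom a b"] uniq[of "vdom a (b + 1)"] D(1) by auto
    show ?thesis unfolding h using DN by (elim insertE) simp_all
  qed
  ultimately show "(H, V) \<in> discrete_tilings C" unfolding discrete_tilings_def by blast
qed

lemma bij_betw_tiles:
  "bij_betw tiles (discrete_tilings C) {T. domino_tiling (region C) T}"
proof (rule bij_betw_byWitness[where f' = "\<lambda>T. ({(x, y). hdom x y \<in> T}, {(x, y). vdom x y \<in> T})"])
  show "\<forall>HV\<in>discrete_tilings C. ({(x, y). hdom x y \<in> tiles HV}, {(x, y). vdom x y \<in> tiles HV}) = HV"
    by auto
  have inv: "tiles ({(x, y). hdom x y \<in> T}, {(x, y). vdom x y \<in> T}) = T" if "domino_tiling (region C) T" for T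
  proof -
    have "T \<subseteq> dominoes" using that by (simp add: domino_tiling_def)
    then show ?thesis unfolding tiles_def dominoes_eq by auto
  qed
  then show "\<forall>T\<in>{T. domino_tiling (region C) T}. tiles ({(x, y). hdom x y \<in> T}, {(x, y). vdom x y \<in> T}) = T"
    by blast
  show "tiles ` discrete_tilings C \<subseteq> {T. domino_tiling (region C) T}"
    using discrete_tiling_iff by auto
  show "(\<lambda>T. ({(x, y). hdom x y \<in> T}, {(x, y). vdom x y \<in> T})) ` {T. domino_tiling (region C) T} \<subseteq> discrete_tilings C"
    using inv by (auto simp: discrete_tiling_iff)
qed

section \<open>Interior lattice points and the weight of a tiling\<close>

definition inner_points :: "(int \<times> int) set \<Rightarrow> (int \<times> int) set" where
  "inner_points C = {(a, b). (a, b) \<in> C \<and> (a - 1, b) \<in> C \<and> (a, b - 1) \<in> C \<and> (a - 1, b - 1) \<in> C}"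

text \<open>A small step from an interior point into each of the four quadrants ends in the
  interiors of the four cells around it.\<close>

lemma interior_region_iff: "(of_int a, of_int b) \<in> interior (region C) \<longleftrightarrow> (a, b) \<in> inner_points C"
proof
  assume ab: "(real_of_int a, real_of_int b) \<in> interior (region C)"
  obtain A B where AB: "open A" "open B" "(real_of_int a, real_of_int b) \<in> A \<times> B" "A \<times> B \<subseteq> interior (region C)"
    using open_prod_elim[OF open_interior ab] by metis
  obtain d where d: "d > 0" "ball (real_of_int a) d \<subseteq> A" using AB(1,3) openE by blast
  obtain e where e: "e > 0" "ball (real_of_int b) e \<subseteq> B" using AB(2,3) openE by blast
  define t where "t = min 1 (min d e) / 2"
  have t: "0 < t" "t < 1" "t < d" "t < e" using d e by (auto simp: t_def)
  have "{a - t, a + t} \<subseteq> A" "{b - t, b + t} \<subseteq> B"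
    using t d(2) e(2) by (auto simp: dist_real_def subset_eq)
  then have in_reg: "{a - t, a + t} \<times> {b - t, b + t} \<subseteq> region C" using AB(4) interior_subset by blast
  have "(a, b) \<in> C" by (rule region_cell[of "a + t" "b + t"]) (use in_reg t in auto)
  moreover have "(a - 1, b) \<in> C" by (rule region_cell[of "a - t" "b + t"]) (use in_reg t in auto)
  moreover have "(a, b - 1) \<in> C" by (rule region_cell[of "a + t" "b - t"]) (use in_reg t in auto)
  moreover have "(a - 1, b - 1) \<in> C" by (rule region_cell[of "a - t" "b - t"]) (use in_reg t in auto)
  ultimately show "(a, b) \<in> inner_points C" by (simp add: inner_points_def)
next
  assume ab: "(a, b) \<in> inner_points C"
  have "{real_of_int (a - 1)<..<of_int (a + 1)} \<times> {real_of_int (b - 1)<..<of_int (b + 1)} \<subseteq> region C"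
  proof clarify
    fix p q assume pq: "p \<in> {real_of_int (a - 1)<..<of_int (a + 1)}" "q \<in> {real_of_int (b - 1)<..<of_int (b + 1)}"
    define a' where "a' = (if p \<ge> of_int a then a else a - 1)"
    define b' where "b' = (if q \<ge> of_int b then b else b - 1)"
    have "(a', b') \<in> C" using ab by (simp add: a'_def b'_def inner_points_def)
    moreover have "(p, q) \<in> unit_square a' b'" using pq by (auto simp: mem_rect a'_def b'_def)
    ultimately show "(p, q) \<in> region C" unfolding region_def by blast
  qed
  then show "(real_of_int a, real_of_int b) \<in> interior (region C)"
    by (rule interiorI[rotated 2]) (auto intro: open_Times)
qed

text \<open>The number of dominoes that have the point as midpoint of a long side. Unlike the number
  of dominoes at the point, it splits into contributions of the two adjacent columns.\<close>

definition midpoint_count :: "(int \<times> int) set \<times> (int \<times> int) set \<Rightarrow> int \<Rightarrow> int \<Rightarrow> nat" where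
  "midpoint_count = (\<lambda>(H, V) a b. of_bool ((a, b) \<in> H) + of_bool ((a, b - 1) \<in> H) +
     of_bool ((a, b) \<in> V) + of_bool ((a - 1, b) \<in> V))"

text \<open>The four cells around the point are covered once each. A domino at the point covers two
  of them if the point is the midpoint of one of its long sides, and one otherwise; so the four
  covering equations add up to the claim.\<close>

lemma card_tiles_at_point:
  assumes HV: "(H, V) \<in> discrete_tilings C" and ab: "(a, b) \<in> inner_points C"
  shows "card {D \<in> tiles (H, V). (of_int a, of_int b) \<in> D} + midpoint_count (H, V) a b = 4"
proof -
  \<comment> \<open>The positions of the six horizontal and the six vertical dominoes that contain
    the point.\<close>
  define A where "A = {a - 1, a, a + 1} \<times> {b - 1, b}"
  define B where "B = {a - 1, a} \<times> {b - 1, b, b + 1}"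
  have hA: "(of_int a, of_int b) \<in> hdom x y \<longleftrightarrow> (x, y) \<in> A" for x y
  proof -
    have "(real_of_int a, real_of_int b) \<in> hdom x y \<longleftrightarrow> x - 1 \<le> a \<and> a \<le> x + 1 \<and> y \<le> b \<and> b \<le> y + 1"
      unfolding hdom_def mem_rect by (simp only: of_int_le_iff)
    moreover have "x - 1 \<le> a \<and> a \<le> x + 1 \<longleftrightarrow> x = a - 1 \<or> x = a \<or> x = a + 1"
      "y \<le> b \<and> b \<le> y + 1 \<longleftrightarrow> y = b - 1 \<or> y = b" by presburger+
    ultimately show ?thesis unfolding A_def by (simp only: mem_Times_iff fst_conv snd_conv insert_iff empty_iff) blast
  qed
  have vB: "(of_int a, of_int b) \<in> vdom x y \<longleftrightarrow> (x, y) \<in> B" for x y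
  proof -
    have "(real_of_int a, real_of_int b) \<in> vdom x y \<longleftrightarrow> x \<le> a \<and> a \<le> x + 1 \<and> y - 1 \<le> b \<and> b \<le> y + 1"
      unfolding vdom_def mem_rect by (simp only: of_int_le_iff)
    moreover have "x \<le> a \<and> a \<le> x + 1 \<longleftrightarrow> x = a - 1 \<or> x = a"
      "y - 1 \<le> b \<and> b \<le> y + 1 \<longleftrightarrow> y = b - 1 \<or> y = b \<or> y = b + 1" by presburger+
    ultimately show ?thesis unfolding B_def by (simp only: mem_Times_iff fst_conv snd_conv insert_iff empty_iff) blast
  qed
  have "{D \<in> tiles (H, V). (of_int a, of_int b) \<in> D} =
      (\<lambda>(x, y). hdom x y) ` (A \<inter> H) \<union> (\<lambda>(x, y). vdom x y) ` (B \<inter> V)"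
  proof (intro equalityI subsetI)
    fix D assume "D \<in> {D \<in> tiles (H, V). (of_int a, of_int b) \<in> D}"
    then have D: "D \<in> tiles (H, V)" "(of_int a, of_int b) \<in> D" by blast+
    from D(1) show "D \<in> (\<lambda>(x, y). hdom x y) ` (A \<inter> H) \<union> (\<lambda>(x, y). vdom x y) ` (B \<inter> V)"
    proof (elim tilesE)
      fix x y assume "D = hdom x y" "(x, y) \<in> H"
      then show ?thesis using D(2) hA[of x y] by (intro UnI1 image_eqI[of _ _ "(x, y)"]) simp_all
    next
      fix x y assume "D = vdom x y" "(x, y) \<in> V"
      then show ?thesis using D(2) vB[of x y] by (intro UnI2 image_eqI[of _ _ "(x, y)"]) simp_all
    qed
  next
    fix D assume "D \<in> (\<lambda>(x, y). hdom x y) ` (A \<inter> H) \<union> (\<lambda>(x, y). vdom x y) ` (B \<inter> V)"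
    then consider x y where "D = hdom x y" "(x, y) \<in> A" "(x, y) \<in> H" | x y where "D = vdom x y" "(x, y) \<in> B" "(x, y) \<in> V"
      by fast
    then show "D \<in> {D \<in> tiles (H, V). (of_int a, of_int b) \<in> D}"
    proof cases
      case 1
      then show ?thesis using hA[of x y] by simp
    next
      case 2
      then show ?thesis using vB[of x y] by simp
    qed
  qed
  moreover have fin: "finite A" "finite B" by (simp_all add: A_def B_def)
  have "card ((\<lambda>(x, y). hdom x y) ` (A \<inter> H) \<union> (\<lambda>(x, y). vdom x y) ` (B \<inter> V)) = card (A \<inter> H) + card (B \<inter> V)"
  proof -
    have "inj_on (\<lambda>(x, y). hdom x y) (A \<inter> H)" "inj_on (\<lambda>(x, y). vdom x y) (B \<inter> V)" by (auto simp: inj_on_def)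
    moreover have "(\<lambda>(x, y). hdom x y) ` (A \<inter> H) \<inter> (\<lambda>(x, y). vdom x y) ` (B \<inter> V) = {}" by auto
    ultimately show ?thesis using fin by (simp add: card_Un_disjoint card_image)
  qed
  moreover have "card (A \<inter> H) = (\<Sum>z\<in>A. of_bool (z \<in> H))" "card (B \<inter> V) = (\<Sum>z\<in>B. of_bool (z \<in> V))"
    using fin sum_of_bool_eq[of A "\<lambda>z. z \<in> H", where 'a = nat] sum_of_bool_eq[of B "\<lambda>z. z \<in> V", where 'a = nat]
    by (simp_all only: Collect_mem_eq of_nat_id)
  moreover have "(\<Sum>z\<in>A. of_bool (z \<in> H)) = (of_bool ((a - 1, b - 1) \<in> H) + of_bool ((a - 1, b) \<in> H) +
      of_bool ((a, b - 1) \<in> H) + of_bool ((a, b) \<in> H) + of_bool ((a + 1, b - 1) \<in> H) + of_bool ((a + 1, b) \<in> H) :: nat)"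
    unfolding A_def by (simp add: sum.cartesian_product[symmetric])
  moreover have "(\<Sum>z\<in>B. of_bool (z \<in> V)) = (of_bool ((a - 1, b - 1) \<in> V) + of_bool ((a - 1, b) \<in> V) +
      of_bool ((a - 1, b + 1) \<in> V) + of_bool ((a, b - 1) \<in> V) + of_bool ((a, b) \<in> V) + of_bool ((a, b + 1) \<in> V) :: nat)"
    unfolding B_def by (simp add: sum.cartesian_product[symmetric])
  moreover have one: "of_bool ((x, y) \<in> H) + of_bool ((x + 1, y) \<in> H) +
        of_bool ((x, y) \<in> V) + of_bool ((x, y + 1) \<in> V) = (1::nat)" if "(x, y) \<in> C" for x y
    using HV that unfolding discrete_tilings_def by blast
  have C: "(a, b) \<in> C" "(a - 1, b) \<in> C" "(a, b - 1) \<in> C" "(a - 1, b - 1) \<in> C"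
    using ab by (simp_all add: inner_points_def)
  note one[OF C(1)] one[OF C(2)] one[OF C(3)] one[OF C(4)]
  ultimately show ?thesis unfolding midpoint_count_def prod.case by simp
qed

lemma tiling_wt_tiles:
  assumes "HV \<in> discrete_tilings C"
  shows "tiling_wt n m (region C) (tiles HV) =
    (\<Prod>(a, b)\<in>inner_points C. w_pow n m a b (1 - int (midpoint_count HV a b)))"
proof -
  have "{(a, b). (real_of_int a, real_of_int b) \<in> interior (region C)} = inner_points C"
    using interior_region_iff by auto
  then show ?thesis unfolding tiling_wt_def
  proof (rule prod.cong)
    fix z assume z: "z \<in> inner_points C"
    obtain a b where ab: "z = (a, b)" by (cases z)
    obtain H V where HV: "HV = (H, V)" by (cases HV)
    have "card {D \<in> tiles HV. (of_int a, of_int b) \<in> D} + midpoint_count HV a b = 4"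
      using card_tiles_at_point[of H V C a b] assms z unfolding ab HV by blast
    then have "int (card {D \<in> tiles HV. (of_int a, of_int b) \<in> D}) - 3 = 1 - int (midpoint_count HV a b)" by linarith
    then show "(case z of (a, b) \<Rightarrow> w_pow n m a b (int (card {D \<in> tiles HV. (of_int a, of_int b) \<in> D}) - 3)) =
        (case z of (a, b) \<Rightarrow> w_pow n m a b (1 - int (midpoint_count HV a b)))" unfolding ab prod.case by (simp only:)
  qed
qed

text \<open>The distance of row \<open>b\<close> from the two middle rows \<open>j - 1\<close> and
  \<open>j\<close> of the diamond. With every unit of distance a row loses one cell at each
  end.\<close>

definition row_dist :: "int \<Rightarrow> int \<Rightarrow> int" where
  "row_dist j b = (if j \<le> b then b - j else j - 1 - b)"

definition aztec_cells :: "int \<Rightarrow> int \<Rightarrow> int \<Rightarrow> int \<Rightarrow> (int \<times> int) set" where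
  "aztec_cells m i j l = {(a, b). 0 \<le> b \<and> b < m \<and> i - l + row_dist j b \<le> a \<and> a < i + l - row_dist j b}"

lemma unit_square_in_diamond_iff:
  "unit_square a b \<subseteq> {(x, y). \<bar>x - of_int i\<bar> + \<bar>y - of_int j\<bar> \<le> of_int l + 1} \<longleftrightarrow>
     i - l + row_dist j b \<le> a \<and> a < i + l - row_dist j b"
proof
  \<comment> \<open>The horizontal side of the square that is farther from the centre imposes the
    stronger condition.\<close>
  define b' where "b' = (if j \<le> b then b + 1 else b)"
  assume *: "unit_square a b \<subseteq> {(x, y). \<bar>x - of_int i\<bar> + \<bar>y - of_int j\<bar> \<le> of_int l + 1}"
  have "(real_of_int a, real_of_int b') \<in> unit_square a b" "(real_of_int (a + 1), real_of_int b') \<in> unit_square a b"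
    by (simp_all add: mem_rect b'_def)
  with * have "\<bar>real_of_int a - of_int i\<bar> + \<bar>real_of_int b' - of_int j\<bar> \<le> of_int l + 1"
    "\<bar>real_of_int (a + 1) - of_int i\<bar> + \<bar>real_of_int b' - of_int j\<bar> \<le> of_int l + 1" by blast+
  then have "real_of_int (\<bar>a - i\<bar> + \<bar>b' - j\<bar>) \<le> of_int (l + 1)" "real_of_int (\<bar>a + 1 - i\<bar> + \<bar>b' - j\<bar>) \<le> of_int (l + 1)" by simp_all
  then have "\<bar>a - i\<bar> + \<bar>b' - j\<bar> \<le> l + 1" "\<bar>a + 1 - i\<bar> + \<bar>b' - j\<bar> \<le> l + 1" by (simp_all only: of_int_le_iff)
  then show "i - l + row_dist j b \<le> a \<and> a < i + l - row_dist j b"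
    unfolding b'_def row_dist_def by (auto split: if_splits)
next
  assume *: "i - l + row_dist j b \<le> a \<and> a < i + l - row_dist j b"
  then have "i - l + row_dist j b \<le> a" "a + 1 \<le> i + l - row_dist j b" by simp_all
  then have "real_of_int (i - l + row_dist j b) \<le> of_int a" "real_of_int (a + 1) \<le> of_int (i + l - row_dist j b)"
    by (simp_all only: of_int_le_iff)
  then have ab: "of_int i - of_int l + real_of_int (row_dist j b) \<le> of_int a"
    "real_of_int a + 1 \<le> of_int i + of_int l - of_int (row_dist j b)" by simp_all
  have rd: "\<bar>y - real_of_int j\<bar> \<le> real_of_int (row_dist j b) + 1" if "of_int b \<le> y" "y \<le> of_int (b + 1)" for y
  proof (cases "j \<le> b")
    case True
    then have "real_of_int j \<le> of_int b" by simp
    then show ?thesis using that True by (simp add: row_dist_def)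
  next
    case False
    then have "b + 1 \<le> j" by simp
    then have "real_of_int (b + 1) \<le> of_int j" by (simp only: of_int_le_iff)
    then show ?thesis using that False by (simp add: row_dist_def)
  qed
  show "unit_square a b \<subseteq> {(x, y). \<bar>x - of_int i\<bar> + \<bar>y - of_int j\<bar> \<le> of_int l + 1}"
  proof clarify
    fix x y assume "(x, y) \<in> unit_square a b"
    then have xy: "of_int a \<le> x" "x \<le> of_int a + 1" "of_int b \<le> y" "y \<le> of_int (b + 1)" by (simp_all add: mem_rect)
    have "\<bar>x - of_int i\<bar> \<le> of_int l - real_of_int (row_dist j b)" using xy ab by linarith
    then show "\<bar>x - of_int i\<bar> + \<bar>y - of_int j\<bar> \<le> of_int l + 1" using rd[OF xy(3,4)] by linarith
  qed
qed

text \<open>A square of the diamond outside the strip meets the strip at most in a boundary line.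
  The points met there also belong to the adjacent square inside the strip, which is in the diamond
  because its row is no farther from the centre.\<close>

lemma aztec_strip_eq_region:
  assumes m: "m \<ge> 1" and j: "0 \<le> j" "j \<le> m"
  shows "aztec_strip m i j l = region (aztec_cells m i j l)"
proof (intro equalityI subsetI)
  fix z assume z: "z \<in> aztec_strip m i j l"
  obtain x y where xy: "z = (x, y)" by (cases z)
  obtain a b where ab: "i - l + row_dist j b \<le> a" "a < i + l - row_dist j b" "(x, y) \<in> unit_square a b"
    using z unfolding xy aztec_strip_def aztec_def unit_square_in_diamond_iff by blast
  have ys: "0 \<le> y" "y \<le> of_int m" using z by (simp_all add: xy aztec_strip_def strip_def)
  define b' where "b' = (if b < 0 then 0 else if m \<le> b then m - 1 else b)"
  have yb: "of_int b \<le> y" "y \<le> of_int (b + 1)" using ab(3) by (simp_all add: mem_rect)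
  have "real_of_int 0 \<le> of_int (b + 1)" "real_of_int b \<le> of_int m" using ys yb by simp_all
  then have bb: "0 \<le> b + 1" "b \<le> m" by (simp_all only: of_int_le_iff)
  have "of_int b' \<le> y \<and> y \<le> of_int b' + 1"
  proof -
    have "b = -1 \<and> b' = 0 \<or> b = m \<and> b' = m - 1 \<or> b' = b"
      using bb by (cases "b < 0"; cases "m \<le> b") (auto simp: b'_def)
    then show ?thesis by (elim disjE) (use ys yb m in auto)
  qed
  then have "(x, y) \<in> unit_square a b'" using ab(3) by (simp add: mem_rect)
  moreover have "row_dist j b' \<le> row_dist j b" using bb m j unfolding row_dist_def b'_def by auto
  then have "(a, b') \<in> aztec_cells m i j l" using ab(1,2) m unfolding aztec_cells_def b'_def by auto
  ultimately show "z \<in> region (aztec_cells m i j l)" unfolding xy region_def by blast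
next
  fix z assume "z \<in> region (aztec_cells m i j l)"
  then obtain a b where ab: "(a, b) \<in> aztec_cells m i j l" "z \<in> unit_square a b" unfolding region_def by blast
  obtain x y where xy: "z = (x, y)" by (cases z)
  have c: "0 \<le> b" "b < m" "i - l + row_dist j b \<le> a" "a < i + l - row_dist j b" using ab(1) by (simp_all add: aztec_cells_def)
  have "unit_square a b \<subseteq> {(x, y). \<bar>x - of_int i\<bar> + \<bar>y - of_int j\<bar> \<le> of_int l + 1}"
    unfolding unit_square_in_diamond_iff using c(3,4) by (rule conjI)
  then have "z \<in> aztec i j l"
    unfolding aztec_def by (intro UnionI[OF _ ab(2)] CollectI exI conjI) (rule refl, assumption)
  moreover have "real_of_int 0 \<le> of_int b" "real_of_int (b + 1) \<le> of_int m" using c by (simp_all only: of_int_le_iff)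
  then have "z \<in> strip m" using ab(2) unfolding xy strip_def by (simp add: mem_rect)
  ultimately show "z \<in> aztec_strip m i j l" unfolding aztec_strip_def by blast
qed

lemma Z_eq_sum_discrete:
  assumes "m \<ge> 1" "0 \<le> j" "j \<le> m"
  shows "Z n m i j l = (\<Sum>HV\<in>discrete_tilings (aztec_cells m i j l).
    \<Prod>(a, b)\<in>inner_points (aztec_cells m i j l). w_pow n m a b (1 - int (midpoint_count HV a b)))"
proof -
  define C where "C = aztec_cells m i j l"
  have "Z n m i j l = (\<Sum>T\<in>{T. domino_tiling (region C) T}. tiling_wt n m (region C) T)"
    unfolding Z_def aztec_strip_eq_region[OF assms] C_def ..
  moreover have "(\<Sum>HV\<in>discrete_tilings C. tiling_wt n m (region C) (tiles HV)) =
      (\<Sum>T\<in>{T. domino_tiling (region C) T}. tiling_wt n m (region C) T)"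
    by (rule sum.reindex_bij_betw[OF bij_betw_tiles, of "tiling_wt n m (region C)" C])
  moreover have "(\<Sum>HV\<in>discrete_tilings C. tiling_wt n m (region C) (tiles HV)) =
      (\<Sum>HV\<in>discrete_tilings C. \<Prod>(a, b)\<in>inner_points C. w_pow n m a b (1 - int (midpoint_count HV a b)))"
  proof (rule sum.cong[OF refl])
    fix HV assume HV: "HV \<in> discrete_tilings C"
    show "tiling_wt n m (region C) (tiles HV) =
        (\<Prod>(a, b)\<in>inner_points C. w_pow n m a b (1 - int (midpoint_count HV a b)))"
      by (rule tiling_wt_tiles[OF HV])
  qed
  ultimately show ?thesis unfolding C_def[symmetric] by (simp only:)
qed

section \<open>Tilings as families of lattice paths\<close>

text \<open>\<open>left_covered x S y\<close> says that the domino covering the cell \<open>(x, y)\<close> extends to the cell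
  \<open>(x - 1, y)\<close>. States record this information up to the checkerboard colouring, which makes
  their size independent of the column.\<close>

definition left_covered :: "int \<Rightarrow> int set \<Rightarrow> int \<Rightarrow> bool" where
  "left_covered x S y \<longleftrightarrow> ((y \<in> S) = odd (x + y))"

text \<open>The full column of height \<open>m\<close> is tiled, even where the region is shorter:
  cells outside the region are covered by horizontal dominoes that exist only in the states.\<close>

definition column_tiling :: "(int \<Rightarrow> int \<Rightarrow> bool) \<Rightarrow> int \<Rightarrow> int \<Rightarrow> int set \<Rightarrow> int set \<Rightarrow> int set \<Rightarrow> bool" where
  "column_tiling E m x S V S' \<longleftrightarrow> (\<forall>y\<in>V. E x y) \<and>
     (\<forall>y\<in>{0..<m}. of_bool (left_covered x S y) + of_bool (left_covered (x + 1) S' y) +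
        of_bool (y \<in> V) + of_bool (y + 1 \<in> V) = (1::nat))"

text \<open>The weight of the network edge entering the black cell \<open>(x, b)\<close>, whose
  domino extends to the left, down or up, in this order. If it extends to the right, no path visits
  the cell and the factor is 1.\<close>

definition column_factor :: "(int \<Rightarrow> int \<Rightarrow> 'a::comm_ring_1) \<Rightarrow> (int \<Rightarrow> int \<Rightarrow> 'a) \<Rightarrow> int \<Rightarrow> int set \<Rightarrow> int set \<Rightarrow> int \<Rightarrow> 'a" where
  "column_factor u v x S V b =
     (if b \<in> S then u (x + 1) (b + 1) * u (x + 1) b * (v x b * v x (b + 1))
      else if b \<in> V then u (x + 1) (b + 1) * v x b
      else if b + 1 \<in> V then u (x + 1) b * v x (b + 1) else 1)"

definition column_wt :: "(int \<Rightarrow> int \<Rightarrow> 'a::comm_ring_1) \<Rightarrow> (int \<Rightarrow> int \<Rightarrow> 'a) \<Rightarrow> int \<Rightarrow> int \<Rightarrow> int set \<Rightarrow> int set \<Rightarrow> 'a" where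
  "column_wt u v m x S V = (\<Prod>b\<in>{b \<in> {0..<m}. odd (x + b)}. column_factor u v x S V b)"

text \<open>No vertical domino sticks out at the bottom. Going upwards, the covering equation of
  each cell decides whether a vertical domino starts there.\<close>

lemma column_tiling_unique:
  assumes E: "\<And>y. E x y \<Longrightarrow> 0 < y \<and> y < m"
    and V: "column_tiling E m x S V S'" and W: "column_tiling E m x S W S'"
  shows "V = W"
proof -
  have VW: "y \<in> V \<or> y \<in> W \<Longrightarrow> 0 < y \<and> y < m" for y
    using V W E unfolding column_tiling_def by blast
  have "int k \<in> V \<longleftrightarrow> int k \<in> W" for k
  proof (induction k)
    case 0
    then show ?case using VW[of 0] by auto
  next
    case (Suc k)
    show ?case
    proof (cases "int k < m")
      case True
      then have k: "int k \<in> {0..<m}" by simp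
      have "of_bool (int k + 1 \<in> V) = (of_bool (int k + 1 \<in> W) :: nat)"
        using V[unfolded column_tiling_def, THEN conjunct2, rule_format, OF k]
          W[unfolded column_tiling_def, THEN conjunct2, rule_format, OF k] Suc by simp
      then show ?thesis by (simp add: add.commute of_bool_eq_iff)
    next
      case False
      then show ?thesis using VW[of "int (Suc k)"] by auto
    qed
  qed
  then have "y \<in> V \<longleftrightarrow> y \<in> W" for y using VW[of y] by (cases "0 \<le> y") (metis nonneg_int_cases, auto)
  then show ?thesis by blast
qed

text \<open>Horizontal dominoes let a path pass straight through the column, and a vertical one
  diverts it from its white cell to its black cell. The map \<open>f\<close> follows the paths to
  the right and \<open>g\<close> follows them back.\<close>

lemma column_tiling_bij:
  fixes u v :: "int \<Rightarrow> int \<Rightarrow> 'a::comm_ring_1"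
  assumes E: "\<And>y. E x y \<Longrightarrow> 0 < y \<and> y < m"
    and V: "column_tiling E m x S V S'" and S: "S \<subseteq> {0..<m}" "S' \<subseteq> {0..<m}"
  shows "\<exists>f. bij_betw f S S' \<and> strict_mono_on S f \<and> (\<Prod>s\<in>S. col_mat u v E x s (f s)) = column_wt u v m x S V"
proof -
  have VE: "E x y" "0 < y" "y < m" if "y \<in> V" for y
    using V E that unfolding column_tiling_def by blast+
  have eq: "of_bool ((y \<in> S) = odd (x + y)) + of_bool ((y \<in> S') = even (x + y)) +
      of_bool (y \<in> V) + of_bool (y + 1 \<in> V) = (1::nat)" if "0 \<le> y" "y < m" for y
  proof -
    have "odd (x + 1 + y) = even (x + y)" by simp
    then show ?thesis using V that unfolding column_tiling_def left_covered_def by simp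
  qed
  \<comment> \<open>A white cell belongs to \<open>S\<close> if it is not covered from the left, and
    to \<open>S'\<close> if it is covered from the right; for a black cell both conventions are
    reversed.\<close>
  have white: "(y \<in> S \<longrightarrow> of_bool (y \<in> S') + of_bool (y \<in> V) + of_bool (y + 1 \<in> V) = (1::nat)) \<and>
      (y \<notin> S \<longrightarrow> y \<notin> S' \<and> y \<notin> V \<and> y + 1 \<notin> V)" if "even (x + y)" "0 \<le> y" "y < m" for y
    using eq[OF that(2,3)] that(1) by (auto simp: of_bool_def split: if_splits)
  have black: "(y \<in> S \<longrightarrow> y \<in> S' \<and> y \<notin> V \<and> y + 1 \<notin> V) \<and>
      (y \<notin> S \<longrightarrow> of_bool (y \<notin> S') + of_bool (y \<in> V) + of_bool (y + 1 \<in> V) = (1::nat))" if "odd (x + y)" "0 \<le> y" "y < m" for y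
    using eq[OF that(2,3)] that(1) by (auto simp: of_bool_def split: if_splits)
  define f where "f y = (if odd (x + y) then y else if y + 1 \<in> V then y + 1 else if y \<in> V then y - 1 else y)" for y
  define g where "g y = (if even (x + y) then y else if y \<in> V then y - 1 else if y + 1 \<in> V then y + 1 else y)" for y
  have up: "y \<in> S \<and> y + 1 \<in> S' \<and> y \<notin> V \<and> y + 2 \<notin> V" if "even (x + y)" "y + 1 \<in> V" for y
  proof -
    have y: "0 \<le> y" "y < m" "y + 1 < m" using VE[OF that(2)] by simp_all
    have o: "odd (x + (y + 1))" using that(1) by simp
    have "y \<in> S \<and> y \<notin> V" using white[OF that(1) y(1,2)] that(2) by (auto simp: of_bool_def split: if_splits)
    moreover have "y + 1 \<in> S' \<and> y + 1 + 1 \<notin> V"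
      using black[OF o] y that(2) by (auto simp: of_bool_def split: if_splits)
    ultimately show ?thesis by (simp add: add.assoc)
  qed
  have down: "y \<in> S \<and> y - 1 \<in> S' \<and> y - 1 \<notin> V \<and> y + 1 \<notin> V" if "even (x + y)" "y \<in> V" for y
  proof -
    have y: "0 \<le> y" "y < m" "0 \<le> y - 1" "y - 1 < m" using VE[OF that(2)] by simp_all
    have o: "odd (x + (y - 1))" using that(1) by simp
    have "y \<in> S \<and> y + 1 \<notin> V" using white[OF that(1) y(1,2)] that(2) by (auto simp: of_bool_def split: if_splits)
    moreover have "y - 1 \<in> S' \<and> y - 1 \<notin> V"
      using black[OF o y(3,4)] that(2) by (auto simp: of_bool_def split: if_splits)
    ultimately show ?thesis by blast
  qed
  have bnd: "0 \<le> y" "y < m" if "y \<in> S \<or> y \<in> S'" for y using that S by auto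
  have fS: "f y \<in> S' \<and> g (f y) = y" if "y \<in> S" for y
  proof (cases "odd (x + y)")
    case True
    then show ?thesis using black[OF True bnd[of y]] that by (simp add: f_def g_def)
  next
    case False
    then have e: "even (x + y)" by simp
    consider "y + 1 \<in> V" | "y \<in> V" "y + 1 \<notin> V" | "y \<notin> V" "y + 1 \<notin> V" by blast
    then show ?thesis
    proof cases
      case 1
      have "f y = y + 1" using e 1 by (simp add: f_def)
      moreover have "g (y + 1) = y" using e 1 by (simp add: g_def)
      ultimately show ?thesis using up[OF e 1] by simp
    next
      case 2
      have "f y = y - 1" using e 2 by (simp add: f_def)
      moreover have "g (y - 1) = y" using e 2 down[OF e 2(1)] by (simp add: g_def)
      ultimately show ?thesis using down[OF e 2(1)] by simp
    next
      case 3
      have "f y = y" using e 3 by (simp add: f_def)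
      moreover have "g y = y" using e by (simp add: g_def)
      moreover have "y \<in> S'" using white[OF e bnd[of y]] that 3 by (auto simp: of_bool_def split: if_splits)
      ultimately show ?thesis by simp
    qed
  qed
  have gS: "g y \<in> S \<and> f (g y) = y \<and> col_mat u v E x (g y) y = (if odd (x + y) then column_factor u v x S V y else 1)"
    if y: "y \<in> S'" for y
  proof (cases "even (x + y)")
    case True
    have "y \<in> S" using white[OF True bnd[of y]] y by blast
    moreover have "y \<notin> V" "y + 1 \<notin> V"
      using white[OF True bnd[of y]] y calculation by (auto simp: of_bool_def split: if_splits)
    moreover have "g y = y" using True by (simp add: g_def)
    moreover have "f y = y" using True calculation by (simp add: f_def)
    moreover have "col_mat u v E x y y = 1" using True by (simp add: col_mat_def)
    ultimately show ?thesis using True by simp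
  next
    case False
    consider "y \<in> S" | "y \<notin> S" "y \<in> V" | "y \<notin> S" "y \<notin> V" "y + 1 \<in> V"
      using black[OF False bnd[of y]] y by (auto simp: of_bool_def split: if_splits)
    then show ?thesis
    proof cases
      case 1
      have "g y = y" using black[OF False bnd[of y]] 1 y False by (simp add: g_def)
      moreover have "f y = y" using False by (simp add: f_def)
      moreover have "col_mat u v E x y y = column_factor u v x S V y" using False 1 by (simp add: col_mat_def column_factor_def)
      ultimately show ?thesis using 1 False by simp
    next
      case 2
      have e: "even (x + (y - 1))" using False by simp
      have g: "g y = y - 1" using False 2 by (simp add: g_def)
      have V': "y - 1 + 1 \<in> V" using 2 by simp
      have "f (y - 1) = y" using e 2 by (simp add: f_def)
      moreover have "y - 1 \<in> S" using up[OF e V'] by blast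
      moreover have "col_mat u v E x (y - 1) y = column_factor u v x S V y"
        using e False 2 VE[OF 2(2)] by (simp add: col_mat_def column_factor_def)
      ultimately show ?thesis using g False by simp
    next
      case 3
      have e: "even (x + (y + 1))" using False by simp
      have g: "g y = y + 1" using False 3 by (simp add: g_def)
      have d: "y + 1 \<in> S" "y + 1 + 1 \<notin> V" using down[OF e 3(3)] by blast+
      have "f (y + 1) = y" using e 3 d by (simp add: f_def)
      moreover have "col_mat u v E x (y + 1) y = column_factor u v x S V y"
        using e False 3 VE[OF 3(3)] by (simp add: col_mat_def column_factor_def)
      ultimately show ?thesis using g d False by simp
    qed
  qed
  have bij: "bij_betw f S S'" by (rule bij_betw_byWitness[where f' = g]) (use fS gS in auto)
  have bijg: "bij_betw g S' S" by (rule bij_betw_byWitness[where f' = f]) (use fS gS in auto)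
  have "strict_mono_on S f"
  proof (rule strict_mono_onI)
    fix s s' assume s: "s \<in> S" "s' \<in> S" "s < s'"
    have "path_step x y (f y)" for y by (auto simp: path_step_def f_def)
    moreover have "f s \<noteq> f s'" using bij s by (auto simp: bij_betw_def inj_on_def)
    ultimately show "f s < f s'" using path_step_noncrossing s(3) by blast
  qed
  moreover have "(\<Prod>s\<in>S. col_mat u v E x s (f s)) = column_wt u v m x S V"
  proof -
    have 1: "(\<Prod>s\<in>S. col_mat u v E x s (f s)) = (\<Prod>y\<in>S'. col_mat u v E x (g y) (f (g y)))"
      by (rule prod.reindex_bij_betw[OF bijg, symmetric])
    have 2: "(\<Prod>y\<in>S'. col_mat u v E x (g y) (f (g y))) = (\<Prod>y\<in>S'. if odd (x + y) then column_factor u v x S V y else 1)"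
    proof (rule prod.cong[OF refl])
      fix y assume "y \<in> S'"
      from gS[OF this] show "col_mat u v E x (g y) (f (g y)) = (if odd (x + y) then column_factor u v x S V y else 1)"
        by (simp only:)
    qed
    have 3: "(\<Prod>y\<in>S'. if odd (x + y) then column_factor u v x S V y else 1) =
        (\<Prod>y\<in>{0..<m}. if odd (x + y) then column_factor u v x S V y else 1)"
    proof (rule prod.mono_neutral_left)
      show "\<forall>y\<in>{0..<m} - S'. (if odd (x + y) then column_factor u v x S V y else 1) = 1"
      proof
        fix y assume y: "y \<in> {0..<m} - S'"
        have "column_factor u v x S V y = 1" if o: "odd (x + y)"
        proof -
          have "y \<notin> S \<and> y \<notin> V \<and> y + 1 \<notin> V" using black[OF o] y by (auto simp: of_bool_def split: if_splits)
          then show ?thesis by (simp add: column_factor_def)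
        qed
        then show "(if odd (x + y) then column_factor u v x S V y else 1) = 1" by simp
      qed
    qed (use S in simp_all)
    have 4: "(\<Prod>y\<in>{0..<m}. if odd (x + y) then column_factor u v x S V y else 1) = column_wt u v m x S V"
      unfolding column_wt_def by (rule prod.inter_filter[symmetric]) simp
    show ?thesis unfolding 1 2 3 4 ..
  qed
  ultimately show ?thesis using bij by blast
qed

text \<open>A vertical domino is placed wherever a path changes its height. Injectivity of
  \<open>f\<close> prevents a black cell from being entered from two sides, so no cell is covered
  twice.\<close>

lemma column_tiling_exists:
  fixes u v :: "int \<Rightarrow> int \<Rightarrow> 'a::comm_ring_1"
  assumes f: "bij_betw f S S'" and S: "S \<subseteq> {0..<m}" "S' \<subseteq> {0..<m}"
    and nz: "\<And>s. s \<in> S \<Longrightarrow> col_mat u v E x s (f s) \<noteq> 0"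
  shows "\<exists>V. column_tiling E m x S V S'"
proof -
  have st: "odd (x + s) \<Longrightarrow> f s = s"
      "even (x + s) \<Longrightarrow> f s = s \<or> f s = s + 1 \<and> E x (s + 1) \<or> f s = s - 1 \<and> E x s" if "s \<in> S" for s
    using nz[OF that] by (auto simp: col_mat_def split: if_splits)
  have inj: "f s = f s' \<Longrightarrow> s = s'" if "s \<in> S" "s' \<in> S" for s s'
    using f that by (auto simp: bij_betw_def inj_on_def)
  have fS: "f s \<in> S'" if "s \<in> S" for s using f that by (auto simp: bij_betw_def)
  have surj: "\<exists>s\<in>S. y = f s" if "y \<in> S'" for y using f that by (auto simp: bij_betw_def)
  define V where "V = {y. y \<in> S \<and> f y = y - 1 \<or> y - 1 \<in> S \<and> f (y - 1) = y}"
  have wV: "y \<in> V \<longleftrightarrow> y \<in> S \<and> f y = y - 1" "y + 1 \<in> V \<longleftrightarrow> y \<in> S \<and> f y = y + 1"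
      "y \<in> S' \<longleftrightarrow> y \<in> S \<and> f y = y" if e: "even (x + y)" for y
  proof -
    have o: "odd (x + (y - 1))" "odd (x + (y + 1))" using e by simp_all
    show "y \<in> V \<longleftrightarrow> y \<in> S \<and> f y = y - 1" using st(1)[OF _ o(1)] unfolding V_def by auto
    show "y + 1 \<in> V \<longleftrightarrow> y \<in> S \<and> f y = y + 1" using st(1)[OF _ o(2)] unfolding V_def by auto
    show "y \<in> S' \<longleftrightarrow> y \<in> S \<and> f y = y"
    proof
      assume "y \<in> S'"
      then obtain s where s: "s \<in> S" "y = f s" using surj by blast
      have "s = y"
      proof (cases "odd (x + s)")
        case True
        then show ?thesis using st(1)[OF s(1)] s(2) by simp
      next
        case False
        then have "f s = s \<or> f s = s + 1 \<or> f s = s - 1" using st(2)[OF s(1)] by blast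
        then show ?thesis using False e s(2) by (elim disjE) simp_all
      qed
      then show "y \<in> S \<and> f y = y" using s by simp
    qed (use fS[of y] in auto)
  qed
  have bV: "y \<in> V \<longleftrightarrow> y - 1 \<in> S \<and> f (y - 1) = y" "y + 1 \<in> V \<longleftrightarrow> y + 1 \<in> S \<and> f (y + 1) = y"
      "y \<in> S' \<longleftrightarrow> y \<in> S \<or> y - 1 \<in> S \<and> f (y - 1) = y \<or> y + 1 \<in> S \<and> f (y + 1) = y" "y \<in> S \<Longrightarrow> f y = y"
    if o: "odd (x + y)" for y
  proof -
    show fy: "y \<in> S \<Longrightarrow> f y = y" by (rule st(1)[OF _ o])
    show "y \<in> V \<longleftrightarrow> y - 1 \<in> S \<and> f (y - 1) = y" using fy unfolding V_def by auto
    show "y + 1 \<in> V \<longleftrightarrow> y + 1 \<in> S \<and> f (y + 1) = y" using fy unfolding V_def by auto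
    show "y \<in> S' \<longleftrightarrow> y \<in> S \<or> y - 1 \<in> S \<and> f (y - 1) = y \<or> y + 1 \<in> S \<and> f (y + 1) = y"
    proof
      assume "y \<in> S'"
      then obtain s where s: "s \<in> S" "y = f s" using surj by blast
      have "f s = s \<or> f s = s + 1 \<or> f s = s - 1" using st[OF s(1)] by blast
      then have "s = y \<or> s = y - 1 \<or> s = y + 1" using s(2) by auto
      then show "y \<in> S \<or> y - 1 \<in> S \<and> f (y - 1) = y \<or> y + 1 \<in> S \<and> f (y + 1) = y" using s by auto
    qed (use fS[of y] fS[of "y - 1"] fS[of "y + 1"] fy in auto)
  qed
  have "E x y" if "y \<in> V" for y
  proof (cases "even (x + y)")
    case True
    then show ?thesis using wV(1)[OF True] that st(2)[of y] by auto
  next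
    case False
    then have "even (x + (y - 1))" by simp
    then show ?thesis using bV(1)[OF False] that st(2)[of "y - 1"] by auto
  qed
  moreover have "of_bool (left_covered x S y) + of_bool (left_covered (x + 1) S' y) +
        of_bool (y \<in> V) + of_bool (y + 1 \<in> V) = (1::nat)" if "y \<in> {0..<m}" for y
  proof (cases "even (x + y)")
    case True
    have 1: "left_covered x S y \<longleftrightarrow> y \<notin> S" "left_covered (x + 1) S' y \<longleftrightarrow> y \<in> S'"
      using True by (simp_all add: left_covered_def)
    have "y \<in> S \<Longrightarrow> f y = y \<or> f y = y + 1 \<or> f y = y - 1" using st(2)[of y] True by blast
    then show ?thesis unfolding 1 wV[OF True] by (auto simp: of_bool_def)
  next
    case False
    have 1: "left_covered x S y \<longleftrightarrow> y \<in> S" "left_covered (x + 1) S' y \<longleftrightarrow> y \<notin> S'"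
      using False by (simp_all add: left_covered_def)
    have "\<not> (y - 1 \<in> S \<and> f (y - 1) = y \<and> y \<in> S)" "\<not> (y + 1 \<in> S \<and> f (y + 1) = y \<and> y \<in> S)"
      "\<not> (y - 1 \<in> S \<and> f (y - 1) = y \<and> y + 1 \<in> S \<and> f (y + 1) = y)"
      using inj[of "y - 1" y] inj[of "y + 1" y] inj[of "y - 1" "y + 1"] bV(4)[OF False] by auto
    then show ?thesis unfolding 1 bV(1-3)[OF False] by (auto simp: of_bool_def)
  qed
  ultimately show ?thesis unfolding column_tiling_def by blast
qed

text \<open>At most one set \<open>V\<close> fits between two given states, and the minor is a
  single product. A nonzero product would make the increasing bijection a tiling, so without a
  tiling both sides vanish.\<close>

lemma minor_eq_sum_column_tilings:
  fixes u v :: "int \<Rightarrow> int \<Rightarrow> 'a::comm_ring_1"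
  assumes E: "\<And>y. E x y \<Longrightarrow> 0 < y \<and> y < m"
    and S: "S \<subseteq> {0..<m}" "S' \<subseteq> {0..<m}" "card S = card S'"
  shows "minor (col_mat u v E x) S S' = (\<Sum>V\<in>{V. column_tiling E m x S V S'}. column_wt u v m x S V)"
proof -
  have fin: "finite S" "finite S'" using S finite_subset by auto
  have mono: "minor (col_mat u v E x) S S' = (\<Prod>s\<in>S. col_mat u v E x s (f s))"
    if f: "bij_betw f S S'" "strict_mono_on S f" for f
  proof -
    have "(\<Prod>k<card S. col_mat u v E x (nth_elem S k) (nth_elem S' k)) =
        (\<Prod>k<card S. col_mat u v E x (nth_elem S k) (f (nth_elem S k)))"
      by (rule prod.cong[OF refl]) (simp add: strict_mono_on_nth_elem[OF fin(1) f])
    also have "\<dots> = (\<Prod>s\<in>S. col_mat u v E x s (f s))"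
      by (rule prod.reindex_bij_betw[OF nth_elem_bij[OF fin(1)]])
    finally show ?thesis unfolding minor_col_mat[OF fin S(3)] .
  qed
  show ?thesis
  proof (cases "\<exists>V. column_tiling E m x S V S'")
    case True
    then obtain V where V: "column_tiling E m x S V S'" by blast
    then have "{V. column_tiling E m x S V S'} = {V}" using column_tiling_unique[of E x m, OF E] by blast
    moreover obtain f where "bij_betw f S S'" "strict_mono_on S f"
        "(\<Prod>s\<in>S. col_mat u v E x s (f s)) = column_wt u v m x S V"
      using column_tiling_bij[of E x m, OF E V S(1,2)] by blast
    ultimately show ?thesis using mono by simp
  next
    case False
    define f where "f s = nth_elem S' (the_inv_into {..<card S} (nth_elem S) s)" for s
    have bS: "bij_betw (nth_elem S) {..<card S} S" by (rule nth_elem_bij[OF fin(1)])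
    have f_nth: "f (nth_elem S k) = nth_elem S' k" if "k < card S" for k
      using bS that by (simp add: f_def bij_betw_def the_inv_into_f_f)
    have "bij_betw (nth_elem S' \<circ> the_inv_into {..<card S} (nth_elem S)) S S'"
      by (rule bij_betw_trans[OF bij_betw_the_inv_into[OF bS]]) (use nth_elem_bij[OF fin(2)] S(3) in simp)
    then have "bij_betw f S S'" by (simp add: f_def[abs_def] o_def)
    then obtain s where s: "s \<in> S" "col_mat u v E x s (f s) = 0"
      using column_tiling_exists[of f S S' m u v E x] S False by blast
    obtain k where k: "k < card S" "s = nth_elem S k" using s(1) bS by (auto simp: bij_betw_def)
    have "(\<Prod>k<card S. col_mat u v E x (nth_elem S k) (nth_elem S' k)) = 0"
      by (rule prod_zero) (use k s(2) f_nth in auto)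
    then have "minor (col_mat u v E x) S S' = 0" unfolding minor_col_mat[OF fin S(3)] .
    moreover have "{V. column_tiling E m x S V S'} = {}" using False by simp
    ultimately show ?thesis by (simp only: sum.empty)
  qed
qed

lemma column_tiling_card:
  assumes "\<And>y. E x y \<Longrightarrow> 0 < y \<and> y < m" "column_tiling E m x S V S'" "S \<subseteq> {0..<m}" "S' \<subseteq> {0..<m}"
  shows "card S = card S'"
proof -
  obtain f :: "int \<Rightarrow> int" where "bij_betw f S S'"
    \<comment> \<open>Only the bijection matters, so trivial integer weights are inserted.\<close>
    using column_tiling_bij[of E x m, OF assms, where u = "\<lambda>_ _. 1 :: int" and v = "\<lambda>_ _. 1"] by blast
  then show ?thesis by (rule bij_betw_same_card)
qed

lemma finite_filter_set: "finite Y \<Longrightarrow> finite {y \<in> Y. P y}"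
  by simp

text \<open>Sorts the edge weights by lattice points: the first product belongs to line
  \<open>x\<close>, the second to line \<open>x + 1\<close>. Of the two horizontal dominoes that may
  touch a point with a midpoint, the column pays for the one in its black row and the neighbouring
  column for the other; \<open>u\<close> is paid by the column to the left of the point.\<close>

lemma column_wt_eq:
  fixes u v :: "int \<Rightarrow> int \<Rightarrow> 'a::comm_ring_1"
  assumes uv: "\<And>x y. u x y * v x y = 1" and one: "\<And>x. u x 0 = 1" "\<And>x. u x m = 1"
    and E: "\<And>y. E x y \<Longrightarrow> 0 < y \<and> y < m" and V: "column_tiling E m x S V S'" and m: "m \<ge> 1"
  shows "column_wt u v m x S V =
    (\<Prod>y\<in>{1..<m}. v x y ^ (of_bool (left_covered x S (if odd (x + y) then y else y - 1)) + of_bool (y \<in> V))) *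
    (\<Prod>y\<in>{1..<m}. u (x + 1) y * v (x + 1) y ^
      (of_bool (left_covered (x + 1) S' (if odd (x + y) then y else y - 1)) + of_bool (y \<in> V)))"
proof -
  have vone: "v x 0 = 1" "v x m = 1" for x using uv[of x 0] uv[of x m] one by simp_all
  define hl where "hl b = (of_bool (left_covered x S b) :: nat)" for b
  define hr where "hr b = (of_bool (left_covered (x + 1) S' b) :: nat)" for b
  define vt where "vt y = (of_bool (y \<in> V) :: nat)" for y
  \<comment> \<open>The share of the black cell \<open>b\<close> at the height \<open>y\<close> of
    its lower or upper side, on both lines that bound the column.\<close>
  define G where "G b y = u (x + 1) y * (v x y ^ (hl b + vt y) * v (x + 1) y ^ (hr b + vt y))" for b y
  have G1: "G b 0 = 1" "G b m = 1" for b by (simp_all add: G_def one vone)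
  have fac: "column_factor u v x S V b = G b b * G b (b + 1)" if b: "0 \<le> b" "b < m" "odd (x + b)" for b
  proof -
    have hlS: "left_covered x S b \<longleftrightarrow> b \<in> S" using b(3) by (simp add: left_covered_def)
    have eq: "of_bool (left_covered x S b) + of_bool (left_covered (x + 1) S' b) + of_bool (b \<in> V) + of_bool (b + 1 \<in> V) = (1::nat)"
      using V b unfolding column_tiling_def by simp
    have uv': "u (x + 1) b * v (x + 1) b = 1" "u (x + 1) (b + 1) * v (x + 1) (b + 1) = 1" by (rule uv)+
    consider "b \<in> S" "b \<notin> V" "b + 1 \<notin> V" "hl b = 1" "hr b = 0" | "b \<notin> S" "b \<in> V" "b + 1 \<notin> V" "hl b = 0" "hr b = 0"
      | "b \<notin> S" "b \<notin> V" "b + 1 \<in> V" "hl b = 0" "hr b = 0" | "b \<notin> S" "b \<notin> V" "b + 1 \<notin> V" "hl b = 0" "hr b = 1"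
      using eq hlS unfolding hl_def hr_def by (auto simp: of_bool_def split: if_splits)
    then show ?thesis
    proof cases
      case 1
      then show ?thesis by (simp add: column_factor_def G_def vt_def mult_ac)
    next
      case 2
      have "G b b * G b (b + 1) = (u (x + 1) b * v (x + 1) b) * (u (x + 1) (b + 1) * v x b)"
        using 2 by (simp add: G_def vt_def mult_ac)
      then show ?thesis using 2 uv' by (simp add: column_factor_def)
    next
      case 3
      have "G b b * G b (b + 1) = (u (x + 1) (b + 1) * v (x + 1) (b + 1)) * (u (x + 1) b * v x (b + 1))"
        using 3 by (simp add: G_def vt_def mult_ac)
      then show ?thesis using 3 uv' by (simp add: column_factor_def)
    next
      case 4
      have "G b b * G b (b + 1) = (u (x + 1) b * v (x + 1) b) * (u (x + 1) (b + 1) * v (x + 1) (b + 1))"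
        using 4 by (simp add: G_def vt_def mult_ac)
      then show ?thesis using 4 uv' by (simp add: column_factor_def)
    qed
  qed
  let ?B = "{b \<in> {0..<m}. odd (x + b)}"
  \<comment> \<open>Each height strictly between 0 and \<open>m\<close> is a side of exactly one
    black cell of the column. At the heights 0 and \<open>m\<close> all weights are 1.\<close>
  define F where "F y = G (if odd (x + y) then y else y - 1) y" for y
  have 1: "column_wt u v m x S V = (\<Prod>b\<in>?B. G b b) * (\<Prod>b\<in>?B. G b (b + 1))"
    unfolding column_wt_def prod.distrib[symmetric] by (rule prod.cong[OF refl]) (simp add: fac)
  have 2: "(\<Prod>b\<in>?B. G b b) = (\<Prod>y\<in>{y \<in> {0..<m}. odd (x + y)}. F y)"
    by (rule prod.cong[OF refl]) (simp add: F_def)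
  have 3: "(\<Prod>b\<in>?B. G b (b + 1)) = (\<Prod>y\<in>{y \<in> {1..m}. even (x + y)}. F y)"
    by (rule prod.reindex_bij_witness[where i = "\<lambda>y. y - 1" and j = "\<lambda>b. b + 1"]) (auto simp: F_def)
  have 4: "(\<Prod>y\<in>{y \<in> {0..<m}. odd (x + y)}. F y) = (\<Prod>y\<in>{y \<in> {1..<m}. odd (x + y)}. F y)"
  proof (rule prod.mono_neutral_right)
    show "\<forall>y\<in>{y \<in> {0..<m}. odd (x + y)} - {y \<in> {1..<m}. odd (x + y)}. F y = 1"
    proof
      fix y assume y: "y \<in> {y \<in> {0..<m}. odd (x + y)} - {y \<in> {1..<m}. odd (x + y)}"
      then have "y = 0" by auto
      then show "F y = 1" by (simp add: F_def G1)
    qed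
  qed (rule finite_filter_set, simp, force)
  have 5: "(\<Prod>y\<in>{y \<in> {1..m}. even (x + y)}. F y) = (\<Prod>y\<in>{y \<in> {1..<m}. even (x + y)}. F y)"
  proof (rule prod.mono_neutral_right)
    show "\<forall>y\<in>{y \<in> {1..m}. even (x + y)} - {y \<in> {1..<m}. even (x + y)}. F y = 1"
    proof
      fix y assume y: "y \<in> {y \<in> {1..m}. even (x + y)} - {y \<in> {1..<m}. even (x + y)}"
      then have "y = m" by auto
      then show "F y = 1" by (simp add: F_def G1)
    qed
  qed (rule finite_filter_set, simp, force)
  have 6: "(\<Prod>y\<in>{y \<in> {1..<m}. odd (x + y)}. F y) * (\<Prod>y\<in>{y \<in> {1..<m}. even (x + y)}. F y) = (\<Prod>y\<in>{1..<m}. F y)"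
  proof -
    have "{1..<m} = {y \<in> {1..<m}. odd (x + y)} \<union> {y \<in> {1..<m}. even (x + y)}" by blast
    moreover have "(\<Prod>y\<in>{y \<in> {1..<m}. odd (x + y)} \<union> {y \<in> {1..<m}. even (x + y)}. F y) =
        (\<Prod>y\<in>{y \<in> {1..<m}. odd (x + y)}. F y) * (\<Prod>y\<in>{y \<in> {1..<m}. even (x + y)}. F y)"
      by (rule prod.union_disjoint) (rule finite_filter_set, simp, rule finite_filter_set, simp, blast)
    ultimately show ?thesis by (simp only:)
  qed
  have 7: "(\<Prod>y\<in>{1..<m}. F y) =
    (\<Prod>y\<in>{1..<m}. v x y ^ (hl (if odd (x + y) then y else y - 1) + vt y)) *
    (\<Prod>y\<in>{1..<m}. u (x + 1) y * v (x + 1) y ^ (hr (if odd (x + y) then y else y - 1) + vt y))"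
    unfolding prod.distrib[symmetric] F_def G_def by (rule prod.cong[OF refl]) (simp only: mult_ac)
  show ?thesis unfolding 1 2 3 4 5 6 7 hl_def hr_def vt_def ..
qed

text \<open>Outside the region, rows are continued by the alternating pattern of a horizontal tiling, so that
  their states are constant there.\<close>

locale row_region =
  fixes m :: int and A B :: "int \<Rightarrow> int" and XL :: int and K :: nat
  assumes m: "m \<ge> 1" and AB: "\<And>y. 0 \<le> y \<Longrightarrow> y < m \<Longrightarrow> XL \<le> A y \<and> A y \<le> B y \<and> B y \<le> XL + int K"
begin

definition cells :: "(int \<times> int) set" where
  "cells = {(x, y). 0 \<le> y \<and> y < m \<and> A y \<le> x \<and> x < B y}"

definition vert_ok :: "int \<Rightarrow> int \<Rightarrow> bool" where
  "vert_ok x y \<longleftrightarrow> (x, y - 1) \<in> cells \<and> (x, y) \<in> cells"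

text \<open>No domino crosses the left end \<open>A y\<close> of a row, so the state there depends
  on the colour of the first cell only.\<close>

definition left_state :: "int set" where
  "left_state = {y \<in> {0..<m}. odd (A y - 1 + y)}"

definition right_state :: "int set" where
  "right_state = {y \<in> {0..<m}. odd (B y - 1 + y)}"

definition state :: "(int \<times> int) set \<Rightarrow> int \<Rightarrow> int set" where
  "state H x = {y \<in> {0..<m}. if x < A y then y \<in> left_state else if B y < x then y \<in> right_state
     else ((x, y) \<in> H) = odd (x + y)}"

lemma vert_ok_bounds: "vert_ok x y \<Longrightarrow> 0 < y \<and> y < m"
  by (auto simp: vert_ok_def cells_def)

lemma cells_window: "(x, y) \<in> cells \<Longrightarrow> XL \<le> x \<and> x < XL + int K"
  using AB[of y] by (auto simp: cells_def)

lemma H_cells: "(H, V) \<in> discrete_tilings cells \<Longrightarrow> (x, y) \<in> H \<Longrightarrow> (x - 1, y) \<in> cells \<and> (x, y) \<in> cells"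
  and V_cells: "(H, V) \<in> discrete_tilings cells \<Longrightarrow> (x, y) \<in> V \<Longrightarrow> vert_ok x y"
  unfolding discrete_tilings_def vert_ok_def by blast+

lemma left_covered_state:
  assumes HV: "(H, V) \<in> discrete_tilings cells" and y: "0 \<le> y" "y < m" and x: "A y \<le> x" "x \<le> B y"
  shows "left_covered x (state H x) y \<longleftrightarrow> (x, y) \<in> H"
  using y x by (auto simp: left_covered_def state_def)

lemma state_left: "(H, V) \<in> discrete_tilings cells \<Longrightarrow> 0 \<le> y \<Longrightarrow> y < m \<Longrightarrow> x \<le> A y \<Longrightarrow>
    y \<in> state H x \<longleftrightarrow> y \<in> left_state"
proof -
  assume HV: "(H, V) \<in> discrete_tilings cells" and y: "0 \<le> y" "y < m" and x: "x \<le> A y"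
  have "(A y, y) \<notin> H" using H_cells[OF HV, of "A y" y] by (auto simp: cells_def)
  then show ?thesis using y x AB[OF y] unfolding state_def left_state_def by (cases "x = A y") auto
qed

lemma state_right: "(H, V) \<in> discrete_tilings cells \<Longrightarrow> 0 \<le> y \<Longrightarrow> y < m \<Longrightarrow> B y \<le> x \<Longrightarrow>
    y \<in> state H x \<longleftrightarrow> y \<in> right_state"
proof -
  assume HV: "(H, V) \<in> discrete_tilings cells" and y: "0 \<le> y" "y < m" and x: "B y \<le> x"
  have "(B y, y) \<notin> H" using H_cells[OF HV, of "B y" y] by (auto simp: cells_def)
  then show ?thesis using y x AB[OF y] unfolding state_def right_state_def by (cases "x = B y") auto
qed

text \<open>Inside the region this is the covering condition. Outside, a constant state makes
  \<open>left_covered\<close> alternate from column to column, so every cell is covered by exactly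
  one horizontal domino.\<close>

lemma column_tiling_state:
  assumes HV: "(H, V) \<in> discrete_tilings cells"
  shows "column_tiling vert_ok m x (state H x) {y. (x, y) \<in> V} (state H (x + 1))"
  unfolding column_tiling_def
proof (intro conjI ballI)
  fix y assume "y \<in> {y. (x, y) \<in> V}"
  then show "vert_ok x y" using V_cells[OF HV] by simp
next
  fix y assume "y \<in> {0..<m}"
  then have y: "0 \<le> y" "y < m" by simp_all
  show "of_bool (left_covered x (state H x) y) + of_bool (left_covered (x + 1) (state H (x + 1)) y) +
      of_bool (y \<in> {y. (x, y) \<in> V}) + of_bool (y + 1 \<in> {y. (x, y) \<in> V}) = (1::nat)"
  proof (cases "(x, y) \<in> cells")
    case True
    then have x: "A y \<le> x" "x \<le> B y" "A y \<le> x + 1" "x + 1 \<le> B y" by (simp_all add: cells_def)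
    have "of_bool ((x, y) \<in> H) + of_bool ((x + 1, y) \<in> H) + of_bool ((x, y) \<in> V) + of_bool ((x, y + 1) \<in> V) = (1::nat)"
      using HV True unfolding discrete_tilings_def by blast
    then show ?thesis
      using left_covered_state[OF HV y x(1,2)] left_covered_state[OF HV y x(3,4)] by simp
  next
    case False
    then have out: "x < A y \<or> B y \<le> x" using y by (auto simp: cells_def)
    have "(x, y) \<notin> V" "(x, y + 1) \<notin> V"
      using V_cells[OF HV, of x y] V_cells[OF HV, of x "y + 1"] False by (auto simp: vert_ok_def)
    moreover have "y \<in> state H x \<longleftrightarrow> y \<in> state H (x + 1)"
      using out state_left[OF HV y, of x] state_left[OF HV y, of "x + 1"] state_right[OF HV y, of x] state_right[OF HV y, of "x + 1"]
      by auto
    ultimately show ?thesis by (auto simp: left_covered_def of_bool_def)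
  qed
qed

section \<open>Tilings of a region as sequences of states\<close>

definition paths_of :: "(int \<times> int) set \<times> (int \<times> int) set \<Rightarrow> (nat \<Rightarrow> int set) \<times> (nat \<Rightarrow> int set)" where
  "paths_of = (\<lambda>(H, V). (restrict (\<lambda>t. state H (XL + int t)) {..K}, restrict (\<lambda>t. {y. (XL + int t, y) \<in> V}) {..<K}))"

text \<open>Only horizontal dominoes with both cells in the region are kept, which discards the
  continuation of the rows.\<close>

definition tiling_of :: "(nat \<Rightarrow> int set) \<times> (nat \<Rightarrow> int set) \<Rightarrow> (int \<times> int) set \<times> (int \<times> int) set" where
  "tiling_of = (\<lambda>(Sq, Vq).
     ({(x, y). (x - 1, y) \<in> cells \<and> (x, y) \<in> cells \<and> left_covered x (Sq (nat (x - XL))) y},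
      {(x, y). XL \<le> x \<and> x < XL + int K \<and> y \<in> Vq (nat (x - XL))}))"

definition path_systems :: "nat \<Rightarrow> ((nat \<Rightarrow> int set) \<times> (nat \<Rightarrow> int set)) set" where
  "path_systems r = (SIGMA Sq:{Sq \<in> {..K} \<rightarrow>\<^sub>E ksubsets {0..<m} r. Sq 0 = left_state \<and> Sq K = right_state}.
     Pi\<^sub>E {..<K} (\<lambda>t. {V. column_tiling vert_ok m (XL + int t) (Sq t) V (Sq (Suc t))}))"

lemma state_subset: "state H x \<subseteq> {0..<m}"
  unfolding state_def by blast

lemma paths_of_in:
  assumes HV: "(H, V) \<in> discrete_tilings cells" and r: "card left_state = r"
  shows "paths_of (H, V) \<in> path_systems r"
proof -
  have S0: "state H XL = left_state"
  proof (rule Set.set_eqI)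
    fix y
    show "y \<in> state H XL \<longleftrightarrow> y \<in> left_state"
    proof (cases "0 \<le> y \<and> y < m")
      case True
      then show ?thesis using state_left[OF HV, of y XL] AB[of y] by simp
    qed (auto simp: state_def left_state_def)
  qed
  have SK: "state H (XL + int K) = right_state"
  proof (rule Set.set_eqI)
    fix y
    show "y \<in> state H (XL + int K) \<longleftrightarrow> y \<in> right_state"
    proof (cases "0 \<le> y \<and> y < m")
      case True
      then show ?thesis using state_right[OF HV, of y "XL + int K"] AB[of y] by simp
    qed (auto simp: state_def right_state_def)
  qed
  have card: "card (state H (XL + int t)) = r" for t
  proof (induction t)
    case 0
    then show ?case using S0 r by simp
  next
    case (Suc t)
    have "card (state H (XL + int t)) = card (state H (XL + int t + 1))"
      by (rule column_tiling_card[of vert_ok, OF vert_ok_bounds column_tiling_state[OF HV] state_subset state_subset])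
    then show ?case using Suc by (simp add: add.assoc add.commute[of 1])
  qed
  have ct: "column_tiling vert_ok m (XL + int t) (state H (XL + int t)) {y. (XL + int t, y) \<in> V} (state H (XL + int (Suc t)))" for t
  proof -
    have "XL + int (Suc t) = XL + int t + 1" by simp
    then show ?thesis using column_tiling_state[OF HV, of "XL + int t"] by (simp only:)
  qed
  show ?thesis
    unfolding path_systems_def paths_of_def prod.case
  proof (rule SigmaI)
    show "restrict (\<lambda>t. state H (XL + int t)) {..K} \<in>
        {Sq \<in> {..K} \<rightarrow>\<^sub>E ksubsets {0..<m} r. Sq 0 = left_state \<and> Sq K = right_state}"
      using S0 SK card state_subset by (simp add: ksubsets_def)
    show "restrict (\<lambda>t. {y. (XL + int t, y) \<in> V}) {..<K} \<in> Pi\<^sub>E {..<K}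
       (\<lambda>t. {V. column_tiling vert_ok m (XL + int t) (restrict (\<lambda>t. state H (XL + int t)) {..K} t) V
          (restrict (\<lambda>t. state H (XL + int t)) {..K} (Suc t))})"
      using ct by simp
  qed
qed

context
  fixes Sq Vq r
  assumes ps: "(Sq, Vq) \<in> path_systems r"
begin

lemma ps_column: "XL \<le> x \<Longrightarrow> x < XL + int K \<Longrightarrow>
  column_tiling vert_ok m x (Sq (nat (x - XL))) (Vq (nat (x - XL))) (Sq (nat (x + 1 - XL)))"
proof -
  assume x: "XL \<le> x" "x < XL + int K"
  then have t: "nat (x - XL) \<in> {..<K}" "XL + int (nat (x - XL)) = x" "Suc (nat (x - XL)) = nat (x + 1 - XL)" by auto
  have "Vq (nat (x - XL)) \<in> {V. column_tiling vert_ok m (XL + int (nat (x - XL))) (Sq (nat (x - XL))) V (Sq (Suc (nat (x - XL))))}"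
    using ps t(1) unfolding path_systems_def by (auto dest: PiE_mem)
  then show ?thesis unfolding t(2,3) by simp
qed

lemma ps_ends: "Sq 0 = left_state" "Sq K = right_state"
  using ps by (simp_all add: path_systems_def)

lemma ps_V: "XL \<le> x \<Longrightarrow> x < XL + int K \<Longrightarrow> y \<in> Vq (nat (x - XL)) \<Longrightarrow> vert_ok x y"
  using ps_column unfolding column_tiling_def by blast

lemma ps_one: "XL \<le> x \<Longrightarrow> x < XL + int K \<Longrightarrow> 0 \<le> y \<Longrightarrow> y < m \<Longrightarrow>
    of_bool (left_covered x (Sq (nat (x - XL))) y) + of_bool (left_covered (x + 1) (Sq (nat (x + 1 - XL))) y) +
      of_bool (y \<in> Vq (nat (x - XL))) + of_bool (y + 1 \<in> Vq (nat (x - XL))) = (1::nat)"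
  using ps_column[of x] unfolding column_tiling_def by simp

text \<open>No vertical domino reaches a cell outside the region, so it is covered from exactly one
  side; by the change of parity this leaves the state unchanged.\<close>

lemma ps_const:
  assumes x: "XL \<le> x" "x < XL + int K" and y: "0 \<le> y" "y < m" and out: "(x, y) \<notin> cells"
  shows "y \<in> Sq (nat (x + 1 - XL)) \<longleftrightarrow> y \<in> Sq (nat (x - XL))"
proof -
  have "y \<notin> Vq (nat (x - XL))" "y + 1 \<notin> Vq (nat (x - XL))"
    using ps_V[OF x, of y] ps_V[OF x, of "y + 1"] out by (auto simp: vert_ok_def)
  then show ?thesis using ps_one[OF x y] by (auto simp: left_covered_def of_bool_def split: if_splits)
qed

lemma ps_left:
  assumes y: "0 \<le> y" "y < m"
  shows "XL + int t \<le> A y \<Longrightarrow> y \<in> Sq t \<longleftrightarrow> y \<in> left_state"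
proof (induction t)
  case 0
  then show ?case using ps_ends by simp
next
  case (Suc t)
  have "(XL + int t, y) \<notin> cells" using Suc.prems by (simp add: cells_def)
  moreover have "XL + int t < XL + int K" using Suc.prems AB[OF y] by simp
  ultimately have "y \<in> Sq (nat (XL + int t + 1 - XL)) \<longleftrightarrow> y \<in> Sq (nat (XL + int t - XL))"
    by (intro ps_const y) simp_all
  moreover have "nat (XL + int t + 1 - XL) = Suc t" "nat (XL + int t - XL) = t" by simp_all
  ultimately show ?case using Suc by simp
qed

text \<open>The state is known in the last column, so the induction runs backwards from
  there.\<close>

lemma ps_right:
  assumes y: "0 \<le> y" "y < m"
  shows "t \<le> K \<Longrightarrow> B y \<le> XL + int (K - t) \<Longrightarrow> y \<in> Sq (K - t) \<longleftrightarrow> y \<in> right_state"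
proof (induction t)
  case 0
  then show ?case using ps_ends by simp
next
  case (Suc t)
  define s where "s = K - Suc t"
  have s: "Suc s = K - t" "s < K" using Suc.prems by (simp_all add: s_def)
  have "(XL + int s, y) \<notin> cells" using Suc.prems by (simp add: cells_def s_def)
  then have "y \<in> Sq (nat (XL + int s + 1 - XL)) \<longleftrightarrow> y \<in> Sq (nat (XL + int s - XL))"
    using s(2) by (intro ps_const y) simp_all
  moreover have "nat (XL + int s + 1 - XL) = Suc s" "nat (XL + int s - XL) = s" by simp_all
  moreover have "y \<in> Sq (K - t) \<longleftrightarrow> y \<in> right_state" using Suc by (simp add: s(1)[symmetric] s_def)
  ultimately show ?case using s(1) by (simp add: s_def)
qed

lemma ps_left_end: "0 \<le> y \<Longrightarrow> y < m \<Longrightarrow> XL \<le> x \<Longrightarrow> x \<le> A y \<Longrightarrow> y \<in> Sq (nat (x - XL)) \<longleftrightarrow> y \<in> left_state"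
  using ps_left[of y "nat (x - XL)"] by simp

lemma ps_right_end:
  assumes y: "0 \<le> y" "y < m" and x: "B y \<le> x" "x \<le> XL + int K"
  shows "y \<in> Sq (nat (x - XL)) \<longleftrightarrow> y \<in> right_state"
proof -
  have "XL \<le> x" using x AB[OF y] by simp
  then have "K - nat (XL + int K - x) = nat (x - XL)" "XL + int (nat (x - XL)) = x" using x by simp_all
  then show ?thesis using ps_right[OF y, of "nat (XL + int K - x)"] x \<open>XL \<le> x\<close> by simp
qed

text \<open>At the two ends of a row the prescribed states say that no domino sticks out, so
  discarding the continuation loses nothing at the ends.\<close>

lemma tiling_of_covered:
  assumes y: "0 \<le> y" "y < m" and x: "A y \<le> x" "x \<le> B y"
  shows "(x, y) \<in> fst (tiling_of (Sq, Vq)) \<longleftrightarrow> left_covered x (Sq (nat (x - XL))) y"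
proof -
  consider "x = A y" | "x = B y" | "A y < x" "x < B y" using x by linarith
  then show ?thesis
  proof cases
    case 1
    then have "(x, y) \<notin> fst (tiling_of (Sq, Vq))" by (simp add: tiling_of_def cells_def)
    moreover have "\<not> left_covered x (Sq (nat (x - XL))) y"
      using ps_left_end[OF y, of x] 1 AB[OF y] y by (simp add: left_covered_def left_state_def)
    ultimately show ?thesis by simp
  next
    case 2
    then have "(x, y) \<notin> fst (tiling_of (Sq, Vq))" by (simp add: tiling_of_def cells_def)
    moreover have "\<not> left_covered x (Sq (nat (x - XL))) y"
      using ps_right_end[OF y, of x] 2 AB[OF y] y by (simp add: left_covered_def right_state_def)
    ultimately show ?thesis by simp
  next
    case 3
    then show ?thesis using y by (simp add: tiling_of_def cells_def)
  qed
qed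

lemma tiling_of_in: "tiling_of (Sq, Vq) \<in> discrete_tilings cells"
proof -
  obtain H V where HV: "tiling_of (Sq, Vq) = (H, V)" by (cases "tiling_of (Sq, Vq)")
  have H: "H = {(x, y). (x - 1, y) \<in> cells \<and> (x, y) \<in> cells \<and> left_covered x (Sq (nat (x - XL))) y}"
    and V: "V = {(x, y). XL \<le> x \<and> x < XL + int K \<and> y \<in> Vq (nat (x - XL))}"
    using HV by (simp_all add: tiling_of_def)
  have "of_bool ((x, y) \<in> H) + of_bool ((x + 1, y) \<in> H) + of_bool ((x, y) \<in> V) + of_bool ((x, y + 1) \<in> V) = (1::nat)"
    if xy: "(x, y) \<in> cells" for x y
  proof -
    have y: "0 \<le> y" "y < m" and x: "A y \<le> x" "x \<le> B y" "A y \<le> x + 1" "x + 1 \<le> B y" using xy by (simp_all add: cells_def)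
    have w: "XL \<le> x" "x < XL + int K" using cells_window[OF xy] by simp_all
    have "(x, y) \<in> H \<longleftrightarrow> left_covered x (Sq (nat (x - XL))) y"
      using tiling_of_covered[OF y x(1,2)] HV by simp
    moreover have "(x + 1, y) \<in> H \<longleftrightarrow> left_covered (x + 1) (Sq (nat (x + 1 - XL))) y"
      using tiling_of_covered[OF y x(3,4)] HV by simp
    moreover have "(x, y) \<in> V \<longleftrightarrow> y \<in> Vq (nat (x - XL))" "(x, y + 1) \<in> V \<longleftrightarrow> y + 1 \<in> Vq (nat (x - XL))"
      using w by (simp_all add: V)
    ultimately show ?thesis using ps_one[OF w y] by (simp only:)
  qed
  moreover have "(x - 1, y) \<in> cells \<and> (x, y) \<in> cells" if "(x, y) \<in> H" for x y using that unfolding H by simp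
  moreover have "(x, y - 1) \<in> cells \<and> (x, y) \<in> cells" if "(x, y) \<in> V" for x y
    using that ps_V[of x y] unfolding V vert_ok_def by simp
  ultimately show ?thesis unfolding HV discrete_tilings_def by blast
qed

lemma paths_of_tiling_of: "paths_of (tiling_of (Sq, Vq)) = (Sq, Vq)"
proof -
  obtain H V where HV: "tiling_of (Sq, Vq) = (H, V)" by (cases "tiling_of (Sq, Vq)")
  have HVd: "(H, V) \<in> discrete_tilings cells" using tiling_of_in HV by simp
  have V: "V = {(x, y). XL \<le> x \<and> x < XL + int K \<and> y \<in> Vq (nat (x - XL))}"
    using HV by (simp_all add: tiling_of_def)
  have SqJ: "Sq t \<subseteq> {0..<m}" if "t \<le> K" for t
    using ps that by (auto simp: path_systems_def ksubsets_def dest!: PiE_mem)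
  have ext: "Sq t = undefined" if "\<not> t \<le> K" for t
    using ps that by (auto simp: path_systems_def PiE_def extensional_def)
  have extV: "Vq t = undefined" if "\<not> t < K" for t
    using ps that by (auto simp: path_systems_def PiE_def extensional_def)
  have "state H (XL + int t) = Sq t" if t: "t \<le> K" for t
  proof (rule Set.set_eqI)
    fix y
    show "y \<in> state H (XL + int t) \<longleftrightarrow> y \<in> Sq t"
    proof (cases "0 \<le> y \<and> y < m")
      case True
      then have y: "0 \<le> y" "y < m" by simp_all
      consider "XL + int t < A y" | "B y < XL + int t" | "A y \<le> XL + int t" "XL + int t \<le> B y" by linarith
      then show ?thesis
      proof cases
        case 1
        then show ?thesis using state_left[OF HVd y, of "XL + int t"] ps_left[OF y, of t] by simp
      next
        case 2
        then show ?thesis using state_right[OF HVd y, of "XL + int t"] ps_right_end[OF y, of "XL + int t"] t by simp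
      next
        case 3
        have "(XL + int t, y) \<in> H \<longleftrightarrow> left_covered (XL + int t) (Sq t) y"
          using tiling_of_covered[OF y 3] HV by simp
        then have "left_covered (XL + int t) (state H (XL + int t)) y \<longleftrightarrow> left_covered (XL + int t) (Sq t) y"
          using left_covered_state[OF HVd y 3] by simp
        then show ?thesis unfolding left_covered_def by auto
      qed
    next
      case False
      then show ?thesis using SqJ[OF t] state_subset[of H "XL + int t"] by auto
    qed
  qed
  then have "restrict (\<lambda>t. state H (XL + int t)) {..K} = Sq"
    using ext by (auto simp: fun_eq_iff)
  moreover have "restrict (\<lambda>t. {y. (XL + int t, y) \<in> V}) {..<K} = Vq"
    using extV by (auto simp: fun_eq_iff V)
  ultimately show ?thesis unfolding HV paths_of_def by simp
qed

end

lemma tiling_of_paths_of: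
  assumes HV: "(H, V) \<in> discrete_tilings cells"
  shows "tiling_of (paths_of (H, V)) = (H, V)"
proof -
  have 1: "(x, y) \<in> fst (tiling_of (paths_of (H, V))) \<longleftrightarrow> (x, y) \<in> H" for x y
  proof (cases "(x - 1, y) \<in> cells \<and> (x, y) \<in> cells")
    case True
    then have y: "0 \<le> y" "y < m" and x: "A y \<le> x" "x \<le> B y" by (simp_all add: cells_def)
    have w: "XL \<le> x" "x < XL + int K" using cells_window True by blast+
    then have "nat (x - XL) \<le> K" by linarith
    then have "restrict (\<lambda>t. state H (XL + int t)) {..K} (nat (x - XL)) = state H x" using w by simp
    then show ?thesis using True left_covered_state[OF HV y x] by (simp add: tiling_of_def paths_of_def)
  next
    case False
    then show ?thesis using H_cells[OF HV, of x y] by (auto simp: tiling_of_def paths_of_def)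
  qed
  have 2: "(x, y) \<in> snd (tiling_of (paths_of (H, V))) \<longleftrightarrow> (x, y) \<in> V" for x y
  proof -
    have "(x, y) \<in> V \<Longrightarrow> XL \<le> x \<and> x < XL + int K" using V_cells[OF HV] cells_window unfolding vert_ok_def by blast
    then show ?thesis by (auto simp: tiling_of_def paths_of_def)
  qed
  have "fst (tiling_of (paths_of (H, V))) = H" "snd (tiling_of (paths_of (H, V))) = V" using 1 2 by auto
  then show ?thesis by (metis prod.collapse)
qed

text \<open>Column weights are regrouped by vertical lines: line \<open>x\<close> receives
  \<open>Rf x\<close> from column \<open>x - 1\<close> and \<open>Lf x\<close> from column
  \<open>x\<close>. The two columns have opposite black rows, so together they account for all
  dominoes with a midpoint at a given point.\<close>

lemma prod_columns_eq:
  fixes u v :: "int \<Rightarrow> int \<Rightarrow> 'a::comm_ring_1"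
  assumes uv: "\<And>x y. u x y * v x y = 1" and one: "\<And>x y. (x, y) \<notin> inner_points cells \<Longrightarrow> u x y = 1"
    and HV: "(H, V) \<in> discrete_tilings cells"
  shows "(\<Prod>t<K. column_wt u v m (XL + int t) (state H (XL + int t)) {y. (XL + int t, y) \<in> V}) =
    (\<Prod>(a, b)\<in>inner_points cells. u a b * v a b ^ midpoint_count (H, V) a b)"
proof -
  have vone: "v x y = 1" if "(x, y) \<notin> inner_points cells" for x y using uv[of x y] one[OF that] by simp
  have inner: "0 < b \<and> b < m \<and> XL < a \<and> a < XL + int K" if "(a, b) \<in> inner_points cells" for a b
  proof -
    have c: "(a, b) \<in> cells" "(a - 1, b) \<in> cells" "(a, b - 1) \<in> cells" using that by (simp_all add: inner_points_def)
    show ?thesis using cells_window[OF c(1)] cells_window[OF c(2)] c by (auto simp: cells_def)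
  qed
  have u0: "u x 0 = 1" "u x m = 1" for x using one[of x 0] one[of x m] inner[of x 0] inner[of x m] by blast+
  \<comment> \<open>The row next to the point \<open>(x, y)\<close> whose cell in column
    \<open>x\<close> is black; \<open>\<beta> (x - 1) y\<close> is the other row.\<close>
  define \<beta> where "\<beta> x y = (if odd (x + y) then y else y - 1 :: int)" for x y :: int
  define hl where "hl x y = (of_bool (left_covered x (state H x) y) :: nat)" for x y
  define vt where "vt x y = (of_bool ((x, y) \<in> V) :: nat)" for x y
  define Lf where "Lf x = (\<Prod>y\<in>{1..<m}. v x y ^ (hl x (\<beta> x y) + vt x y))" for x
  define Rf where "Rf x = (\<Prod>y\<in>{1..<m}. u x y * v x y ^ (hl x (\<beta> (x - 1) y) + vt (x - 1) y))" for x
  have col: "column_wt u v m x (state H x) {y. (x, y) \<in> V} = Lf x * Rf (x + 1)" for x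
    using column_wt_eq[of u v m vert_ok x, OF uv u0 vert_ok_bounds column_tiling_state[OF HV] m]
    by (simp add: Lf_def Rf_def hl_def vt_def \<beta>_def)
  \<comment> \<open>The extreme lines contain no interior points, so the products over
    \<open>Lf\<close> and \<open>Rf\<close> can be extended to a common range.\<close>
  have edge: "Lf x = 1 \<and> Rf x = 1" if "x \<le> XL \<or> XL + int K \<le> x" for x
  proof -
    have "(x, y) \<notin> inner_points cells" for y using inner[of x y] that by auto
    then show ?thesis by (simp add: Lf_def Rf_def one vone)
  qed
  have 1: "(\<Prod>t<K. column_wt u v m (XL + int t) (state H (XL + int t)) {y. (XL + int t, y) \<in> V}) =
      (\<Prod>t<K. Lf (XL + int t)) * (\<Prod>t<K. Rf (XL + int t + 1))"
    unfolding col prod.distrib ..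
  have 2: "(\<Prod>t<K. Lf (XL + int t)) = (\<Prod>t<Suc K. Lf (XL + int t))"
    using edge[of "XL + int K"] by simp
  have 3: "(\<Prod>t<K. Rf (XL + int t + 1)) = (\<Prod>t<Suc K. Rf (XL + int t))"
  proof -
    have "(\<Prod>t<Suc K. Rf (XL + int t)) = Rf (XL + int 0) * (\<Prod>t<K. Rf (XL + int (Suc t)))"
      by (rule prod.lessThan_Suc_shift)
    moreover have "XL + int (Suc t) = XL + int t + 1" for t by simp
    ultimately show ?thesis using edge[of XL] by (simp only:) simp
  qed
  define G where "G x y = u x y * v x y ^ (hl x y + hl x (y - 1) + vt x y + vt (x - 1) y)" for x y
  have LR: "Lf x * Rf x = (\<Prod>y\<in>{1..<m}. G x y)" for x
    unfolding Lf_def Rf_def prod.distrib[symmetric]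
  proof (rule prod.cong[OF refl])
    fix y
    have "hl x (\<beta> x y) + hl x (\<beta> (x - 1) y) = hl x y + hl x (y - 1)"
      by (cases "odd (x + y)") (simp_all add: \<beta>_def)
    then have e: "hl x y + hl x (y - 1) + vt x y + vt (x - 1) y = (hl x (\<beta> x y) + vt x y) + (hl x (\<beta> (x - 1) y) + vt (x - 1) y)"
      by simp
    show "v x y ^ (hl x (\<beta> x y) + vt x y) * (u x y * v x y ^ (hl x (\<beta> (x - 1) y) + vt (x - 1) y)) = G x y"
      unfolding G_def e power_add[of _ "hl x (\<beta> x y) + vt x y"] by (simp only: mult_ac)
  qed
  have 4: "(\<Prod>t<Suc K. Lf (XL + int t)) * (\<Prod>t<Suc K. Rf (XL + int t)) = (\<Prod>t<Suc K. \<Prod>y\<in>{1..<m}. G (XL + int t) y)"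
    unfolding prod.distrib[symmetric] LR ..
  have 5: "(\<Prod>t<Suc K. \<Prod>y\<in>{1..<m}. G (XL + int t) y) = (\<Prod>x\<in>{XL..XL + int K}. \<Prod>y\<in>{1..<m}. G x y)"
    by (rule prod.reindex_bij_witness[where i = "\<lambda>x. nat (x - XL)" and j = "\<lambda>t. XL + int t"]) auto
  have 6: "(\<Prod>x\<in>{XL..XL + int K}. \<Prod>y\<in>{1..<m}. G x y) = (\<Prod>(x, y)\<in>{XL..XL + int K} \<times> {1..<m}. G x y)"
    by (rule prod.cartesian_product)
  have 7: "(\<Prod>(x, y)\<in>{XL..XL + int K} \<times> {1..<m}. G x y) = (\<Prod>(x, y)\<in>inner_points cells. G x y)"
  proof (rule prod.mono_neutral_right)
    show "inner_points cells \<subseteq> {XL..XL + int K} \<times> {1..<m}"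
    proof
      fix z assume z: "z \<in> inner_points cells"
      obtain a b where ab: "z = (a, b)" by (cases z)
      show "z \<in> {XL..XL + int K} \<times> {1..<m}" using inner[of a b] z unfolding ab by simp
    qed
    show "\<forall>z\<in>{XL..XL + int K} \<times> {1..<m} - inner_points cells. (case z of (x, y) \<Rightarrow> G x y) = 1"
    proof
      fix z assume z: "z \<in> {XL..XL + int K} \<times> {1..<m} - inner_points cells"
      obtain a b where ab: "z = (a, b)" by (cases z)
      have "(a, b) \<notin> inner_points cells" using z ab by blast
      then show "(case z of (x, y) \<Rightarrow> G x y) = 1" unfolding ab prod.case G_def by (simp add: one vone)
    qed
  qed simp
  have 8: "(\<Prod>(x, y)\<in>inner_points cells. G x y) = (\<Prod>(a, b)\<in>inner_points cells. u a b * v a b ^ midpoint_count (H, V) a b)"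
  proof (rule prod.cong[OF refl])
    fix z assume z: "z \<in> inner_points cells"
    obtain a b where ab: "z = (a, b)" by (cases z)
    have c: "(a, b) \<in> cells" "(a - 1, b) \<in> cells" "(a, b - 1) \<in> cells" "(a - 1, b - 1) \<in> cells"
      using z unfolding ab by (simp_all add: inner_points_def)
    have "hl a b = of_bool ((a, b) \<in> H)" "hl a (b - 1) = of_bool ((a, b - 1) \<in> H)"
      unfolding hl_def using left_covered_state[OF HV, of b a] left_covered_state[OF HV, of "b - 1" a] c by (simp_all add: cells_def)
    then have "hl a b + hl a (b - 1) + vt a b + vt (a - 1) b = midpoint_count (H, V) a b"
      by (simp add: midpoint_count_def vt_def)
    then show "(case z of (x, y) \<Rightarrow> G x y) = (case z of (a, b) \<Rightarrow> u a b * v a b ^ midpoint_count (H, V) a b)"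
      unfolding ab prod.case G_def by (simp only:)
  qed
  show ?thesis unfolding 1 2 3 4 5 6 7 8 ..
qed

text \<open>The sum over states comes from Cauchy-Binet, the sum over vertical dominoes from the
  column minors; together they run over \<open>path_systems\<close>, which correspond to
  tilings.\<close>

theorem minor_eq_sum_tilings:
  fixes u v :: "int \<Rightarrow> int \<Rightarrow> 'a::comm_ring_1"
  assumes uv: "\<And>x y. u x y * v x y = 1" and one: "\<And>x y. (x, y) \<notin> inner_points cells \<Longrightarrow> u x y = 1"
    and r: "card left_state = r" "card right_state = r"
  shows "minor (prod_mat {0..<m} (col_mat u v vert_ok) XL K) left_state right_state =
    (\<Sum>HV\<in>discrete_tilings cells. \<Prod>(a, b)\<in>inner_points cells. u a b * v a b ^ midpoint_count HV a b)"
proof -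
  let ?J = "{0..<m}"
  let ?SQ = "{Sq \<in> {..K} \<rightarrow>\<^sub>E ksubsets ?J r. Sq 0 = left_state \<and> Sq K = right_state}"
  let ?\<V> = "\<lambda>Sq t. {V. column_tiling vert_ok m (XL + int t) (Sq t) V (Sq (Suc t))}"
  let ?c = "\<lambda>Sq Vq t. column_wt u v m (XL + int t) (Sq t) (Vq t)"
  have ends: "left_state \<in> ksubsets ?J r" "right_state \<in> ksubsets ?J r"
    using r by (auto simp: ksubsets_def left_state_def right_state_def)
  have finV: "finite (?\<V> Sq t)" for Sq t
  proof (rule finite_subset)
    show "?\<V> Sq t \<subseteq> Pow {0..<m}" using vert_ok_bounds unfolding column_tiling_def by fastforce
  qed simp
  have finSQ: "finite ?SQ"
    by (rule finite_subset[of _ "{..K} \<rightarrow>\<^sub>E ksubsets ?J r"]) (auto intro: finite_PiE)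
  have 1: "minor (prod_mat ?J (col_mat u v vert_ok) XL K) left_state right_state =
    (\<Sum>Sq\<in>?SQ. \<Prod>t<K. minor (col_mat u v vert_ok (XL + int t)) (Sq t) (Sq (Suc t)))"
    by (rule minor_prod_mat[OF _ ends]) simp
  have 2: "(\<Prod>t<K. minor (col_mat u v vert_ok (XL + int t)) (Sq t) (Sq (Suc t))) =
      (\<Sum>Vq\<in>Pi\<^sub>E {..<K} (?\<V> Sq). \<Prod>t<K. ?c Sq Vq t)" if Sq: "Sq \<in> ?SQ" for Sq
  proof -
    have SqJ: "Sq t \<subseteq> ?J" "card (Sq t) = r" if "t \<le> K" for t
    proof -
      have "Sq t \<in> ksubsets ?J r" using Sq that by (auto dest: PiE_mem)
      then show "Sq t \<subseteq> ?J" "card (Sq t) = r" by (simp_all add: ksubsets_def)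
    qed
    have "(\<Prod>t<K. minor (col_mat u v vert_ok (XL + int t)) (Sq t) (Sq (Suc t))) =
        (\<Prod>t<K. \<Sum>V\<in>?\<V> Sq t. column_wt u v m (XL + int t) (Sq t) V)"
    proof (rule prod.cong[OF refl])
      fix t assume "t \<in> {..<K}"
      then have t: "t \<le> K" "Suc t \<le> K" by simp_all
      have "card (Sq t) = card (Sq (Suc t))" using SqJ(2) t by simp
      then show "minor (col_mat u v vert_ok (XL + int t)) (Sq t) (Sq (Suc t)) =
          (\<Sum>V\<in>?\<V> Sq t. column_wt u v m (XL + int t) (Sq t) V)"
        by (intro minor_eq_sum_column_tilings vert_ok_bounds SqJ(1)[OF t(1)] SqJ(1)[OF t(2)])
    qed
    moreover have "(\<Prod>t\<in>{..<K}. \<Sum>V\<in>?\<V> Sq t. column_wt u v m (XL + int t) (Sq t) V) =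
        (\<Sum>Vq\<in>Pi\<^sub>E {..<K} (?\<V> Sq). \<Prod>t\<in>{..<K}. column_wt u v m (XL + int t) (Sq t) (Vq t))"
      by (rule prod_sum_PiE) (simp_all only: finite_lessThan finV)
    ultimately show ?thesis by (rule trans)
  qed
  have 3: "(\<Sum>Sq\<in>?SQ. \<Prod>t<K. minor (col_mat u v vert_ok (XL + int t)) (Sq t) (Sq (Suc t))) =
      (\<Sum>Sq\<in>?SQ. \<Sum>Vq\<in>Pi\<^sub>E {..<K} (?\<V> Sq). \<Prod>t<K. ?c Sq Vq t)"
    by (rule sum.cong[OF refl], rule 2)
  have 4: "(\<Sum>Sq\<in>?SQ. \<Sum>Vq\<in>Pi\<^sub>E {..<K} (?\<V> Sq). \<Prod>t<K. ?c Sq Vq t) =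
      (\<Sum>(Sq, Vq)\<in>path_systems r. \<Prod>t<K. ?c Sq Vq t)"
    unfolding path_systems_def
  proof (rule sum.Sigma[OF finSQ])
    show "\<forall>Sq\<in>?SQ. finite (Pi\<^sub>E {..<K} (?\<V> Sq))" using finV by (intro ballI finite_PiE) simp_all
  qed
  have 5: "(\<Sum>(Sq, Vq)\<in>path_systems r. \<Prod>t<K. ?c Sq Vq t) =
      (\<Sum>HV\<in>discrete_tilings cells. \<Prod>(a, b)\<in>inner_points cells. u a b * v a b ^ midpoint_count HV a b)"
  proof (rule sum.reindex_bij_witness[where j = tiling_of and i = paths_of])
    fix p assume p: "p \<in> path_systems r"
    obtain Sq Vq where SV: "p = (Sq, Vq)" by (cases p)
    note ps = p[unfolded SV]
    show "paths_of (tiling_of p) = p" unfolding SV by (rule paths_of_tiling_of[OF ps])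
    show "tiling_of p \<in> discrete_tilings cells" unfolding SV by (rule tiling_of_in[OF ps])
    obtain H V where HV: "tiling_of p = (H, V)" by (cases "tiling_of p")
    have HVd: "(H, V) \<in> discrete_tilings cells" using tiling_of_in[OF ps] HV SV by simp
    have pHV: "(Sq, Vq) = paths_of (H, V)" using paths_of_tiling_of[OF ps] HV SV by simp
    have "(\<Prod>t<K. ?c Sq Vq t) = (\<Prod>t<K. column_wt u v m (XL + int t) (state H (XL + int t)) {y. (XL + int t, y) \<in> V})"
      by (rule prod.cong[OF refl]) (use pHV in \<open>simp add: paths_of_def\<close>)
    also have "\<dots> = (\<Prod>(a, b)\<in>inner_points cells. u a b * v a b ^ midpoint_count (H, V) a b)"
      by (rule prod_columns_eq[of u v, OF uv one HVd])
    finally show "(\<Prod>(a, b)\<in>inner_points cells. u a b * v a b ^ midpoint_count (tiling_of p) a b) =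
        (case p of (Sq, Vq) \<Rightarrow> \<Prod>t<K. ?c Sq Vq t)" unfolding SV HV[unfolded SV] prod.case by (rule sym)
  next
    fix HV assume HV: "HV \<in> discrete_tilings cells"
    obtain H V where HV': "HV = (H, V)" by (cases HV)
    show "tiling_of (paths_of HV) = HV" using tiling_of_paths_of HV unfolding HV' by blast
    show "paths_of HV \<in> path_systems r" using paths_of_in[OF _ r(1)] HV unfolding HV' by blast
  qed
  show ?thesis unfolding 1 3 4 5 ..
qed

end

text \<open>Compares columns of different diamonds or of translates. Besides the weights and
  vertical dominoes of the column, only its parity enters.\<close>

lemma col_mat_cong:
  assumes "even (x - x')" "\<And>y. 0 \<le> y \<Longrightarrow> y \<le> m \<Longrightarrow> u (x + 1) y = u' (x' + 1) y"
    "\<And>y. 0 \<le> y \<Longrightarrow> y \<le> m \<Longrightarrow> v x y = v' x' y" "\<And>y. 0 \<le> y \<Longrightarrow> y < m \<Longrightarrow> E x y = E' x' y"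
    and s: "s \<in> {0..<m}" "s' \<in> {0..<m}"
  shows "col_mat u v E x s s' = col_mat u' v' E' x' s s'"
proof -
  have b: "0 \<le> s" "s < m" "0 \<le> s'" "s' < m" using s by simp_all
  have p: "odd (x + s) \<longleftrightarrow> odd (x' + s)" using assms(1) by simp
  have u: "u (x + 1) s = u' (x' + 1) s" "u (x + 1) (s + 1) = u' (x' + 1) (s + 1)"
    "u (x + 1) s' = u' (x' + 1) s'" "u (x + 1) (s' + 1) = u' (x' + 1) (s' + 1)" using b by (auto intro!: assms(2))
  have v: "v x s = v' x' s" "v x (s + 1) = v' x' (s + 1)" "v x s' = v' x' s'" "v x (s' + 1) = v' x' (s' + 1)"
    using b by (auto intro!: assms(3))
  have E: "E x s = E' x' s" "E x s' = E' x' s'" using b by (auto intro!: assms(4))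
  show ?thesis unfolding col_mat_def p u v E ..
qed

lemma w_inv_power: "w_inv n m x y ^ k = w_pow n m x y (- int k)"
  by (induction k) (simp_all add: w_pow_0 w_pow_add)

text \<open>\<open>par\<close> says that \<open>S\<close> is the left state. It is also the right
  state, since the two ends of a row differ by an even number. The bound \<open>l \<ge> m\<close>
  prevents rows of negative length, and points off the interior are given weight 1.\<close>

lemma Z_eq_minor:
  fixes n m i j l :: int
  assumes m: "m \<ge> 1" and j: "0 \<le> j" "j \<le> m" and l: "l \<ge> m" and S: "S \<subseteq> {0..<m}"
    and par: "\<And>y. 0 \<le> y \<Longrightarrow> y < m \<Longrightarrow> y \<in> S \<longleftrightarrow> odd (i - l + row_dist j y - 1 + y)"
  defines "C \<equiv> aztec_cells m i j l"
  shows "Z n m i j l = minor (prod_mat {0..<m} (col_mat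
      (\<lambda>x y. if (x, y) \<in> inner_points C then w n m x y else 1)
      (\<lambda>x y. if (x, y) \<in> inner_points C then w_inv n m x y else 1)
      (\<lambda>x y. (x, y - 1) \<in> C \<and> (x, y) \<in> C)) (i - l) (nat (2 * l))) S S"
proof -
  have rd: "0 \<le> row_dist j y \<and> row_dist j y \<le> m" if "0 \<le> y" "y < m" for y
    using that j by (simp add: row_dist_def)
  interpret row_region m "\<lambda>y. i - l + row_dist j y" "\<lambda>y. i + l - row_dist j y" "i - l" "nat (2 * l)"
    using m l rd by unfold_locales fastforce+
  have cells: "cells = C" unfolding cells_def C_def aztec_cells_def ..
  have LS: "left_state = S" using S par unfolding left_state_def by auto
  have RS: "right_state = S"
  proof (rule Set.set_eqI)
    fix y
    have "odd (i + l - row_dist j y - 1 + y) \<longleftrightarrow> odd (i - l + row_dist j y - 1 + y)" by presburger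
    then show "y \<in> right_state \<longleftrightarrow> y \<in> S" using S par[of y] unfolding right_state_def by auto
  qed
  let ?u = "\<lambda>x y. if (x, y) \<in> inner_points C then w n m x y else 1"
  let ?v = "\<lambda>x y. if (x, y) \<in> inner_points C then w_inv n m x y else 1"
  have uv: "?u x y * ?v x y = 1" for x y by (simp add: w_pow_add w_pow_0)
  have vo: "vert_ok = (\<lambda>x y. (x, y - 1) \<in> C \<and> (x, y) \<in> C)" unfolding vert_ok_def[abs_def] cells ..
  have 1: "minor (prod_mat {0..<m} (col_mat ?u ?v vert_ok) (i - l) (nat (2 * l))) left_state right_state =
    (\<Sum>HV\<in>discrete_tilings cells. \<Prod>(a, b)\<in>inner_points cells. ?u a b * ?v a b ^ midpoint_count HV a b)"
    by (rule minor_eq_sum_tilings[OF uv]) (simp_all add: cells LS RS)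
  have 2: "(\<Sum>HV\<in>discrete_tilings C. \<Prod>(a, b)\<in>inner_points C. ?u a b * ?v a b ^ midpoint_count HV a b) =
      (\<Sum>HV\<in>discrete_tilings C. \<Prod>(a, b)\<in>inner_points C. w_pow n m a b (1 - int (midpoint_count HV a b)))"
  proof (rule sum.cong[OF refl], rule prod.cong[OF refl])
    fix HV z assume z: "z \<in> inner_points C"
    obtain a b where ab: "z = (a, b)" by (cases z)
    show "(case z of (a, b) \<Rightarrow> ?u a b * ?v a b ^ midpoint_count HV a b) =
        (case z of (a, b) \<Rightarrow> w_pow n m a b (1 - int (midpoint_count HV a b)))"
      using z unfolding ab prod.case by (simp add: w_inv_power w_pow_add)
  qed
  have "Z n m i j l = (\<Sum>HV\<in>discrete_tilings C. \<Prod>(a, b)\<in>inner_points C. w_pow n m a b (1 - int (midpoint_count HV a b)))"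
    unfolding C_def by (rule Z_eq_sum_discrete[OF m j])
  also have "\<dots> = minor (prod_mat {0..<m} (col_mat ?u ?v vert_ok) (i - l) (nat (2 * l))) left_state right_state"
    unfolding 2[symmetric] 1 cells ..
  finally show ?thesis unfolding LS RS vo .
qed

section \<open>The recurrence\<close>

text \<open>The start is a multiple of \<open>2 * n\<close>, so every block is
  \<open>turn_mat\<close> itself and not a cyclic rotation of its factors.\<close>

lemma prod_mat_strip_mat_power:
  assumes n: "n \<ge> 1" and s: "s \<in> {0..<m}" "s' \<in> {0..<m}"
  shows "prod_mat {0..<m} (strip_mat n m) (2 * n * z) (nat (2 * n) * k) s s' =
    prod_mat {0..<m} (\<lambda>_. turn_mat n m) 0 k s s'"
proof -
  let ?J = "{0..<m}"
  have "prod_mat ?J (strip_mat n m) (2 * n * z) (nat (2 * n) * k) s s' =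
      prod_mat ?J (\<lambda>t. prod_mat ?J (strip_mat n m) (2 * n * z + int (nat (2 * n)) * t) (nat (2 * n))) 0 k s s'"
    by (rule prod_mat_mult) (use s in simp_all)
  also have "\<dots> = prod_mat ?J (\<lambda>_. turn_mat n m) 0 k s s'"
  proof (rule prod_mat_cong[OF s])
    fix t :: nat and s s' assume s: "s \<in> ?J" "s' \<in> ?J"
    show "prod_mat ?J (strip_mat n m) (2 * n * z + int (nat (2 * n)) * (0 + int t)) (nat (2 * n)) s s' = turn_mat n m s s'"
      unfolding turn_mat_def
    proof (rule prod_mat_cong[OF s])
      fix t' :: nat and a b
      have "2 * n * z + int (nat (2 * n)) * (0 + int t) + int t' = (0 + int t') + 2 * n * (z + int t)"
        using n by (simp add: algebra_simps)
      then show "strip_mat n m (2 * n * z + int (nat (2 * n)) * (0 + int t) + int t') a b = strip_mat n m (0 + int t') a b"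
        by (simp only: strip_mat_periodic)
    qed
  qed
  finally show ?thesis .
qed

text \<open>The diamond is cut at column \<open>XM\<close>, where all rows have begun, and again
  \<open>2 * n * k\<close> columns later. The left piece does not see the right end, the middle
  piece consists of full turns, and the right piece is a translate of the one for
  \<open>k = 0\<close>. So only the middle depends on \<open>k\<close>.\<close>

lemma Z_minor_expansion:
  fixes n m i j l0 :: int
  assumes m: "m \<ge> 1" and n: "n \<ge> 1" and j: "0 \<le> j" "j \<le> m" and S: "S \<subseteq> {0..<m}" "card S = r"
    and par: "\<And>y. 0 \<le> y \<Longrightarrow> y < m \<Longrightarrow> y \<in> S \<longleftrightarrow> odd (i - l0 + row_dist j y - 1 + y)"
  shows "\<exists>c \<alpha> \<beta>. \<forall>k. Z n m (i + int (c + k) * n) j (int (c + k) * n + l0) =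
    (\<Sum>R\<in>ksubsets {0..<m} r. \<Sum>R'\<in>ksubsets {0..<m} r.
       \<alpha> R * minor (prod_mat {0..<m} (\<lambda>_. turn_mat n m) 0 k) R R' * \<beta> R')"
proof -
  let ?J = "{0..<m}"
  define C where "C l = aztec_cells m (i + int l * n) j (int l * n + l0)" for l :: nat
  define u where "u l = (\<lambda>x y. if (x, y) \<in> inner_points (C l) then w n m x y else 1)" for l
  define v where "v l = (\<lambda>x y. if (x, y) \<in> inner_points (C l) then w_inv n m x y else 1)" for l
  define E where "E l = (\<lambda>x y. (x, y - 1) \<in> C l \<and> (x, y) \<in> C l)" for l
  define M where "M l = col_mat (u l) (v l) (E l)" for l
  define XL where "XL = i - l0"
  \<comment> \<open>\<open>z\<close> makes \<open>XM\<close> a multiple of \<open>2 * n\<close> that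
    lies beyond the start of every row; \<open>c\<close> makes all rows of the diamond with index
    \<open>c\<close> extend beyond column \<open>XM + 1\<close>.\<close>
  define z where "z = \<bar>i\<bar> + \<bar>l0\<bar> + m + 2"
  define XM where "XM = 2 * n * z"
  define c where "c = nat (XM + \<bar>i\<bar> + \<bar>l0\<bar> + 2 * m + 4)"
  have zpos: "0 \<le> z" using m by (simp add: z_def)
  have nz: "z \<le> n * z" using mult_right_mono[OF n zpos] by simp
  have XM: "XL + m + 2 \<le> XM" using nz zpos unfolding XM_def XL_def z_def by linarith
  have XM0: "0 \<le> XM" unfolding XM_def using n zpos by simp
  have nl: "int l \<le> int l * n" for l using mult_left_mono[OF n, of "int l"] by simp
  have c: "int c = XM + \<bar>i\<bar> + \<bar>l0\<bar> + 2 * m + 4" using XM0 m by (simp add: c_def)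
  have cbig: "XM + \<bar>i\<bar> + \<bar>l0\<bar> + 2 * m + 4 \<le> int c * n" using nl[of c] c by simp
  have rd: "0 \<le> row_dist j y" "row_dist j y \<le> m" if "0 \<le> y" "y < m" for y
    using that j by (simp_all add: row_dist_def)
  have Cc: "(x, y) \<in> C l \<longleftrightarrow> 0 \<le> y \<and> y < m \<and> XL + row_dist j y \<le> x \<and> x < i + l0 + 2 * (int l * n) - row_dist j y" for l x y
    unfolding C_def aztec_cells_def XL_def by (auto simp: algebra_simps)
  have ck: "int (c + k) * n = int c * n + int k * n" for k by (simp add: algebra_simps)
  have kn: "0 \<le> int k * n" for k using n by simp
  have left: "(x, y) \<in> C (c + k) \<longleftrightarrow> (x, y) \<in> C c" if "x \<le> XM + 1" for x y k
    using that XM0 cbig kn[of k] rd[of y] unfolding Cc ck by (auto simp: algebra_simps simp del: of_nat_add)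
  have mid: "(x, y) \<in> C (c + k) \<longleftrightarrow> 0 \<le> y \<and> y < m" if "XM - 1 \<le> x" "x \<le> XM + 2 * (int k * n) + 1" for x y k
    using that XM0 kn[of k] cbig XM rd[of y] unfolding Cc ck by (auto simp: algebra_simps simp del: of_nat_add)
  have right: "(x + 2 * (int k * n), y) \<in> C (c + k) \<longleftrightarrow> (x, y) \<in> C c" if "XM - 1 \<le> x" for x y k
    using that XM kn[of k] rd[of y] unfolding Cc ck by (auto simp del: of_nat_add)
  have "M (c + k) x s s' = M c x s s'" if "x < XM" "s \<in> ?J" "s' \<in> ?J" for k x s s'
    unfolding M_def
  proof (rule col_mat_cong[of x x m])
    have in_eq: "(x', y) \<in> inner_points (C (c + k)) \<longleftrightarrow> (x', y) \<in> inner_points (C c)" if "x' \<le> XM + 1" for x' y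
      using left[of x'] left[of "x' - 1"] that unfolding inner_points_def by simp
    show "u (c + k) (x + 1) y = u c (x + 1) y" "v (c + k) x y = v c x y" for y
      using in_eq[of "x + 1" y] in_eq[of x y] that(1) unfolding u_def v_def by simp_all
    show "E (c + k) x y = E c x y" for y using left[of x] that(1) unfolding E_def by simp
  qed (use that in simp_all)
  note M_left = this
  have "M (c + k) x s s' = strip_mat n m x s s'" if x: "XM \<le> x" "x < XM + 2 * (int k * n)" and s: "s \<in> ?J" "s' \<in> ?J" for k x s s'
    unfolding M_def strip_mat_def
  proof (rule col_mat_cong[of x x m])
    have in_eq: "(x', y) \<in> inner_points (C (c + k)) \<longleftrightarrow> 0 < y \<and> y < m" if "XM \<le> x'" "x' \<le> XM + 2 * (int k * n) + 1" for x' y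
    proof -
      have "(x', y') \<in> C (c + k) \<longleftrightarrow> 0 \<le> y' \<and> y' < m" "(x' - 1, y') \<in> C (c + k) \<longleftrightarrow> 0 \<le> y' \<and> y' < m" for y'
        by (rule mid; use that in linarith)+
      note c = this
      show ?thesis unfolding inner_points_def by (simp add: c) linarith
    qed
    show "u (c + k) (x + 1) y = w n m (x + 1) y" for y
      using in_eq[of "x + 1" y] x unfolding u_def by (auto simp: w_pow_def)
    show "v (c + k) x y = w_inv n m x y" for y
      using in_eq[of x y] x unfolding v_def by (auto simp: w_pow_def)
    show "E (c + k) x y = (0 < y \<and> y < m)" for y
    proof -
      have "(x, y') \<in> C (c + k) \<longleftrightarrow> 0 \<le> y' \<and> y' < m" for y' by (rule mid; use x in linarith)
      then show ?thesis unfolding E_def by (simp only:) linarith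
    qed
  qed (use s in simp_all)
  note M_mid = this
  \<comment> \<open>The right end moves by exactly \<open>2 * n * k\<close>, and this translation
    preserves both the colouring and the periodic weights.\<close>
  have "M (c + k) (x + 2 * (int k * n)) s s' = M c x s s'" if x: "XM \<le> x" and s: "s \<in> ?J" "s' \<in> ?J" for k x s s'
    unfolding M_def
  proof (rule col_mat_cong[of _ _ m])
    have in_eq: "(x' + 2 * (int k * n), y) \<in> inner_points (C (c + k)) \<longleftrightarrow> (x', y) \<in> inner_points (C c)" if "XM \<le> x'" for x' y
    proof -
      have c: "(x' + 2 * (int k * n), y') \<in> C (c + k) \<longleftrightarrow> (x', y') \<in> C c" for y'
        by (rule right) (use that in simp)
      have "(x' - 1 + 2 * (int k * n), y') \<in> C (c + k) \<longleftrightarrow> (x' - 1, y') \<in> C c" for y'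
        by (rule right) (use that in simp)
      moreover have "x' - 1 + 2 * (int k * n) = x' + 2 * (int k * n) - 1" by simp
      ultimately have c': "(x' + 2 * (int k * n) - 1, y') \<in> C (c + k) \<longleftrightarrow> (x' - 1, y') \<in> C c" for y' by simp
      show ?thesis unfolding inner_points_def by (simp only: mem_Collect_eq prod.case c c')
    qed
    have w_per: "w_pow n m (x' + 2 * (int k * n)) y e = w_pow n m x' y e" for x' y e
      using w_pow_periodic[of n m x' "int k" y e] by (simp add: mult_ac)
    have e: "x + 2 * (int k * n) + 1 = (x + 1) + 2 * (int k * n)" by simp
    show "u (c + k) (x + 2 * (int k * n) + 1) y = u c (x + 1) y" for y
      using in_eq[of "x + 1" y] x unfolding u_def e w_per by simp
    show "v (c + k) (x + 2 * (int k * n)) y = v c x y" for y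
      using in_eq[of x y] x unfolding v_def w_per by simp
    show "E (c + k) (x + 2 * (int k * n)) y = E c x y" for y
      using right[of x k] x unfolding E_def by simp
  qed (use s in simp_all)
  note M_right = this
  define a where "a = nat (XM - XL)"
  define b where "b = nat (i + l0 + 2 * (int c * n) - XM)"
  have a: "int a = XM - XL" using XM m by (simp add: a_def)
  have b: "int b = i + l0 + 2 * (int c * n) - XM" using cbig XM0 m by (simp add: b_def)
  define Lm where "Lm = prod_mat ?J (M c) XL a"
  define Rm where "Rm = prod_mat ?J (M c) XM b"
  define Tm where "Tm k = prod_mat ?J (\<lambda>_. turn_mat n m) 0 k" for k
  have fac: "prod_mat ?J (M (c + k)) XL (nat (2 * (int (c + k) * n + l0))) s s' = mm ?J Lm (mm ?J (Tm k) Rm) s s'"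
    if s: "s \<in> ?J" "s' \<in> ?J" for k s s'
  proof -
    define p where "p = nat (2 * n) * k"
    have p: "int p = 2 * (int k * n)" using n by (simp add: p_def)
    have len: "nat (2 * (int (c + k) * n + l0)) = a + (p + b)"
    proof -
      have "2 * (int (c + k) * n + l0) = int (a + (p + b))" unfolding ck using a b p by (simp add: XL_def)
      then show ?thesis by simp
    qed
    have "prod_mat ?J (M (c + k)) XL (a + (p + b)) s s' =
        mm ?J (prod_mat ?J (M (c + k)) XL a) (prod_mat ?J (M (c + k)) (XL + int a) (p + b)) s s'"
      by (rule prod_mat_add[OF _ s]) simp
    also have "\<dots> = mm ?J Lm (mm ?J (Tm k) Rm) s s'"
    proof (rule mm_cong)
      fix q assume q: "q \<in> ?J"
      show "prod_mat ?J (M (c + k)) XL a s q = Lm s q"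
        unfolding Lm_def by (rule prod_mat_cong[OF s(1) q], rule M_left) (use a in simp_all)
      have XLa: "XL + int a = XM" using a by simp
      have "prod_mat ?J (M (c + k)) XM (p + b) q s' =
          mm ?J (prod_mat ?J (M (c + k)) XM p) (prod_mat ?J (M (c + k)) (XM + int p) b) q s'"
        by (rule prod_mat_add[OF _ q s(2)]) simp
      also have "\<dots> = mm ?J (Tm k) Rm q s'"
      proof (rule mm_cong)
        fix q' assume q': "q' \<in> ?J"
        have "prod_mat ?J (M (c + k)) XM p q q' = prod_mat ?J (strip_mat n m) XM p q q'"
          by (rule prod_mat_cong[OF q q'], rule M_mid) (use p in simp_all)
        also have "\<dots> = Tm k q q'"
          unfolding XM_def p_def Tm_def by (rule prod_mat_strip_mat_power[OF n q q'])
        finally show "prod_mat ?J (M (c + k)) XM p q q' = Tm k q q'" .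
        show "prod_mat ?J (M (c + k)) (XM + int p) b q' s' = Rm q' s'"
          unfolding Rm_def
        proof (rule prod_mat_cong[OF q' s(2)])
          fix t s1 s2 assume s12: "s1 \<in> ?J" "s2 \<in> ?J"
          have "XM + int p + int t = (XM + int t) + 2 * (int k * n)" unfolding p by simp
          then show "M (c + k) (XM + int p + int t) s1 s2 = M c (XM + int t) s1 s2"
            by (simp only:) (rule M_right; use s12 in simp)
        qed
      qed
      finally show "prod_mat ?J (M (c + k)) (XL + int a) (p + b) q s' = mm ?J (Tm k) Rm q s'" unfolding XLa .
    qed
    finally show ?thesis unfolding len .
  qed
  have finS: "finite S" using S(1) finite_subset by blast
  have "Z n m (i + int (c + k) * n) j (int (c + k) * n + l0) =
    (\<Sum>R\<in>ksubsets ?J r. \<Sum>R'\<in>ksubsets ?J r. minor Lm S R * minor (Tm k) R R' * minor Rm R' S)" for k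
  proof -
    let ?l = "int (c + k) * n + l0"
    have il: "i + int (c + k) * n - ?l = XL" by (simp add: XL_def)
    have lm: "m \<le> ?l" unfolding ck using cbig kn[of k] XM0 m by linarith
    have "Z n m (i + int (c + k) * n) j ?l = minor (prod_mat ?J (M (c + k)) (i + int (c + k) * n - ?l) (nat (2 * ?l))) S S"
      unfolding M_def u_def v_def E_def C_def
    proof (rule Z_eq_minor[OF m j lm S(1)])
      fix y :: int assume y: "0 \<le> y" "y < m"
      show "(y \<in> S) = odd (i + int (c + k) * n - ?l + row_dist j y - 1 + y)" unfolding il XL_def by (rule par[OF y])
    qed
    also have "\<dots> = minor (mm ?J Lm (mm ?J (Tm k) Rm)) S S"
      unfolding il by (rule minor_cong) (use S(1) finS fac in \<open>auto simp: subset_eq\<close>)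
    also have "\<dots> = (\<Sum>R\<in>ksubsets ?J r. minor Lm S R * minor (mm ?J (Tm k) Rm) R S)"
      by (rule cauchy_binet[OF _ S(2)]) simp
    also have "\<dots> = (\<Sum>R\<in>ksubsets ?J r. \<Sum>R'\<in>ksubsets ?J r. minor Lm S R * minor (Tm k) R R' * minor Rm R' S)"
    proof (rule sum.cong[OF refl])
      fix R assume "R \<in> ksubsets ?J r"
      then have cR: "card R = r" by (simp add: ksubsets_def)
      have "minor (mm ?J (Tm k) Rm) R S = (\<Sum>R'\<in>ksubsets ?J r. minor (Tm k) R R' * minor Rm R' S)"
        by (rule cauchy_binet[OF _ cR]) simp
      then show "minor Lm S R * minor (mm ?J (Tm k) Rm) R S =
          (\<Sum>R'\<in>ksubsets ?J r. minor Lm S R * minor (Tm k) R R' * minor Rm R' S)"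
        by (simp add: sum_distrib_left mult.assoc)
    qed
    finally show ?thesis .
  qed
  then show ?thesis unfolding Tm_def
    by (intro exI[of _ c] exI[of _ "\<lambda>R. minor Lm S R"] exI[of _ "\<lambda>R. minor Rm R S"]) blast
qed

lemma recurrence_at_offset: "recurrence_at P (\<lambda>k. f (c + k)) k \<longleftrightarrow> recurrence_at P f (c + k)"
  by (simp add: recurrence_at_def add.assoc)

lemma Z_recurrence:
  fixes n m i j l0 :: int
  assumes m: "m \<ge> 1" and n: "n \<ge> 1" and j: "0 \<le> j" "j \<le> m" and S: "S \<subseteq> {0..<m}" "card S = r"
    and par: "\<And>y. 0 \<le> y \<Longrightarrow> y < m \<Longrightarrow> y \<in> S \<longleftrightarrow> odd (i - l0 + row_dist j y - 1 + y)"
  shows "\<forall>\<^sub>\<infinity>k. recurrence_at (Q_net_e n m r) (\<lambda>l. emb (Z n m (i + int l * n) j (int l * n + l0))) k"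
proof -
  interpret comm_ring_hom emb by (rule emb_hom)
  let ?K = "ksubsets {0..<m} r"
  let ?T = "\<lambda>k. prod_mat {0..<m} (\<lambda>_. turn_mat n m) 0 k"
  let ?f = "\<lambda>l. emb (Z n m (i + int l * n) j (int l * n + l0))"
  obtain c \<alpha> \<beta> where Z: "\<forall>k. Z n m (i + int (c + k) * n) j (int (c + k) * n + l0) =
    (\<Sum>R\<in>?K. \<Sum>R'\<in>?K. \<alpha> R * minor (?T k) R R' * \<beta> R')"
  proof -
    have "\<exists>c \<alpha> \<beta>. \<forall>k. Z n m (i + int (c + k) * n) j (int (c + k) * n + l0) =
        (\<Sum>R\<in>?K. \<Sum>R'\<in>?K. \<alpha> R * minor (?T k) R R' * \<beta> R')"
      by (rule Z_minor_expansion[OF m n j S]) (rule par)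
    then show thesis using that by (elim exE)
  qed
  have fin: "finite ?K" by simp
  have "recurrence_at (Q_net_e n m r) (\<lambda>k. ?f (c + k)) k" for k
  proof -
    have f: "?f (c + k) = (\<Sum>R\<in>?K. emb (\<alpha> R) * (\<Sum>R'\<in>?K. emb (\<beta> R') * emb (minor (?T k) R R')))" for k
      unfolding Z[rule_format] hom_sum hom_mult sum_distrib_left
      by (rule sum.cong[OF refl], rule sum.cong[OF refl]) (simp only: mult_ac)
    show ?thesis unfolding f
    proof (rule recurrence_at_linear[OF fin], rule recurrence_at_linear[OF fin])
      fix R R' assume "R \<in> ?K" "R' \<in> ?K"
      then show "recurrence_at (Q_net_e n m r) (\<lambda>k. emb (minor (?T k) R R')) k"
        using turn_mat_recurrence[OF n] m by simp
    qed
  qed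
  then have ev: "recurrence_at (Q_net_e n m r) ?f (c + k)" for k using recurrence_at_offset[of _ ?f c] by blast
  show ?thesis unfolding MOST_nat_le
  proof (intro exI[of _ c] allI impI)
    fix k assume "c \<le> k"
    then show "recurrence_at (Q_net_e n m r) ?f k" using ev[of "k - c"] by simp
  qed
qed

theorem theorem5p8:
  fixes n m i j l0 :: int and f :: "nat \<Rightarrow> laurent"
  assumes "m \<ge> 2" and "n \<ge> 1" and "0 \<le> j" and "j \<le> m"
  assumes "\<And>l. f l = Z n m (i + int l * n) j (int l * n + l0)"
  shows "(even (i + j + l0) \<longrightarrow>
            (\<forall>\<^sub>\<infinity>k. recurrence_at (Q_net_e n m (nat (m - j))) (\<lambda>l. emb (f l)) k)) \<and>
         (odd (i + j + l0) \<longrightarrow>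
            (\<forall>\<^sub>\<infinity>k. recurrence_at (Q_net_e n m (nat j)) (\<lambda>l. emb (f l)) k))"
proof -
  have m: "m \<ge> 1" using assms(1) by simp
  \<comment> \<open>\<open>row_dist j y + y\<close> equals \<open>2 * y - j\<close> for rows from
    \<open>j\<close> upwards and \<open>j - 1\<close> below, so the two groups of rows have opposite
    parities and exactly one of them forms the state.\<close>
  have up: "odd (i - l0 + row_dist j y - 1 + y) \<longleftrightarrow> even (i + j + l0)" if "j \<le> y" for y
    using that unfolding row_dist_def by simp presburger
  have down: "odd (i - l0 + row_dist j y - 1 + y) \<longleftrightarrow> odd (i + j + l0)" if "\<not> j \<le> y" for y
    using that unfolding row_dist_def by simp presburger
  show ?thesis unfolding assms(5)
  proof (intro conjI impI)
    assume ev: "even (i + j + l0)"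
    show "\<forall>\<^sub>\<infinity>k. recurrence_at (Q_net_e n m (nat (m - j))) (\<lambda>l. emb (Z n m (i + int l * n) j (int l * n + l0))) k"
    proof (rule Z_recurrence[OF m assms(2-4), of "{j..<m}"])
      show "(y \<in> {j..<m}) = odd (i - l0 + row_dist j y - 1 + y)" if "0 \<le> y" "y < m" for y
        using up[of y] down[of y] ev that by (cases "j \<le> y") simp_all
    qed (use assms in simp_all)
  next
    assume od: "odd (i + j + l0)"
    show "\<forall>\<^sub>\<infinity>k. recurrence_at (Q_net_e n m (nat j)) (\<lambda>l. emb (Z n m (i + int l * n) j (int l * n + l0))) k"
    proof (rule Z_recurrence[OF m assms(2-4), of "{0..<j}"])
      show "(y \<in> {0..<j}) = odd (i - l0 + row_dist j y - 1 + y)" if "0 \<le> y" "y < m" for y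
        using up[of y] down[of y] od that by (cases "j \<le> y") simp_all
    qed (use assms in simp_all)
  qed
qed

end
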